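(* Let $\mathcal X$ be a compact metrizable space, $\mathcal Y\subset\mathbb R^d$ compact with convex hull $\mathrm{co}(\mathcal Y)$ and conical hull $\mathcal Z$, let $F:\mathcal X\times\mathcal Z\to(-\infty,0]$ be convex in its second variable, and let $c(x,m)=F\left(x,\int y\,dm\right)$ for $x\in\mathcal X$, $m\in\mathcal M(\mathcal Y)$. Assume that: - $0\notin\mathrm{co}(\mathcal Y)$; - $F$ is nonpositive, continuous on $\mathcal X\times\mathcal Z$, and there exist continuous functions $a_k:\mathcal X\to\mathbb R$ and $u_k:\mathcal X\to\mathbb R^d$, $k\ge0$, such that $F(x,z)=\sup_{k\ge0}\{u_k(x)\cdot z+a_k(x)\}$ for all $x\in\mathcal X$, $z\in\mathcal Z$; - for all $x\in\mathcal X$ and $z\in\mathcal Z\setminus\{0\}$, $\frac{F(x,\lambda z)}{\lambda}\to0$ as $\lambda\to+\infty$; - $\sup_{x\in\mathcal X,\,y\in\mathcal Y}F(x,\lambda y)\to-\infty$ as $\lambda\to+\infty$. Then for all $\mu\in\mathcal P(\mathcal X)$ and $\nu\in\mathcal P(\mathcal Y)$, $$\mathcal I_c(\mu,\nu)=\sup_{\varphi\in\Phi^+(\mathcal Z)\cap L^1(\nu)}\left\{\int Q_F\varphi(x)\,\mu(dx)-\int\varphi(y)\,\nu(dy)\right\},\qquad Q_F\varphi(x)=\inf_{z\in\mathcal Z}\{\varphi(z)+F(x,z)\}.$$ Furthermore, the supremum is attained at some $\bar\varphi\in\Phi^+(\mathcal Z)\cap L^1(\nu)$ which is positive on $\mathcal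 Z\setminus\{0\}$. Finally, any weak solution of the transport problem between $\mu$ and $\nu$ is a strong solution.
   Context: $\mathcal P(E)$: Borel probability measures on $E$; $\mathcal M(\mathcal Y)$: finite nonnegative Borel measures on $\mathcal Y$. The conical hull of $\mathcal Y$ is $\mathcal Z=\{\sum_{i=1}^n\lambda_iy_i:\ n\ge1,\ \lambda_i\ge0,\ y_i\in\mathcal Y\}$. $\varphi:\mathcal Z\to\mathbb R\cup\{+\infty\}$ is positively $1$-homogenous if $\varphi(tz)=t\varphi(z)$ for all $t\ge0$ and all $z$ with $\varphi(z)<+\infty$. $\Phi^+(\mathcal Z)$ is the set of all nonnegative, lower semicontinuous, convex, positively $1$-homogenous functions $\varphi:\mathcal Z\to\mathbb R_+\cup\{+\infty\}$. $\Pi(\ll\mu,\nu)$ is the set of Borel probability measures $\pi$ on $\mathcal X\times\mathcal Y$ with first marginal $\pi_1\ll\mu$ and second marginal $\nu$. For such $\pi(dxdy)=\pi_1(dx)\pi^x(dy)$ let $I_c^\mu[\pi]=\int c\left(x,\frac{d\pi_1}{d\mu}(x)\pi^x\right)\mu(dx)$. The transport problem is $\mathcal I_c(\mu,\nu)=\inf_{\pi\in\Pi(\ll\mu,\nu)}I_c^\mu[\pi]$ (equivalently, the infimum of $\int c(x,q^x)\mu(dx)$ over nonnegative kernels $q$ with $\int q^x(dy)\mu(dx)=\nu(dy)$). A strong solution is a $\bar\pi\in\Pi(\ll\mu,\nu)$ with $I_c^\mu[\bar\pi]=\mathcal I_c(\mu,\nu)$. A weak solution is a $\bar\pi\in\mathcal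 P(\mathcal X\times\mathcal Y)$ that is the weak limit of some sequence $\pi_n\in\Pi(\ll\mu,\nu)$ with $I_c^\mu[\pi_n]\to\mathcal I_c(\mu,\nu)$. *)

theory Defs
  imports "HOL-Probability.Probability"
begin

text \<open>
  Spaces are carrier sets of a topological type; the Borel sets of a carrier are the traces of
  the Borel sets of the type, and \<open>space (prob_algebra (borel_on S))\<close> is the set of Borel
  probability measures on \<open>S\<close>.
\<close>

abbreviation borel_on :: "'a::topological_space set \<Rightarrow> 'a measure" where
  "borel_on S \<equiv> restrict_space borel S"

abbreviation borel_probs :: "'a::topological_space set \<Rightarrow> 'a measure set" where
  "borel_probs S \<equiv> space (prob_algebra (borel_on S))"

text \<open>
  Unlike \<open>convex_cone hull Y\<close>, which always contains \<open>0\<close>, this set is empty for empty \<open>Y\<close>;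
  for nonempty \<open>Y\<close> the two agree.
\<close>

definition conical_hull :: "'a::real_vector set \<Rightarrow> 'a set" where
  "conical_hull Y = {\<Sum>i<n. l i *\<^sub>R y i | (n::nat) l y.
     1 \<le> n \<and> (\<forall>i<n. 0 \<le> l i \<and> y i \<in> Y)}"

text \<open>
  Integral of an extended real function. The map \<open>e2ennreal\<close> sends negative
  values to \<open>0\<close>, so the two terms are the integrals of the positive and of the negative part. It
  is meaningful when at least one of them is finite.
\<close>

definition ext_integral :: "'a measure \<Rightarrow> ('a \<Rightarrow> ereal) \<Rightarrow> ereal" where
  "ext_integral M f =
     enn2ereal (\<integral>\<^sup>+x. e2ennreal (f x) \<partial>M) - enn2ereal (\<integral>\<^sup>+x. e2ennreal (- f x) \<partial>M)"

definition ext_L1 :: "'a measure \<Rightarrow> ('a \<Rightarrow> ereal) set" where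
  "ext_L1 M = {f \<in> borel_measurable M. (\<integral>\<^sup>+x. e2ennreal \<bar>f x\<bar> \<partial>M) < \<infinity>}"

definition lsc_on :: "'a::topological_space set \<Rightarrow> ('a \<Rightarrow> ereal) \<Rightarrow> bool" where
  "lsc_on S f \<longleftrightarrow> (\<forall>z\<in>S. f z \<le> Liminf (at z within S) f)"

text \<open>Used only for functions that do not take the value \<open>- \<infinity>\<close>; note \<open>0 * \<infinity> = 0\<close> in \<open>ereal\<close>.\<close>

definition ext_convex_on :: "'a::real_vector set \<Rightarrow> ('a \<Rightarrow> ereal) \<Rightarrow> bool" where
  "ext_convex_on S f \<longleftrightarrow> convex S \<and>
     (\<forall>x\<in>S. \<forall>y\<in>S. \<forall>u\<ge>0. \<forall>v\<ge>0. u + v = 1 \<longrightarrow>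
        f (u *\<^sub>R x + v *\<^sub>R y) \<le> ereal u * f x + ereal v * f y)"

definition pos_homogeneous_on :: "'a::real_vector set \<Rightarrow> ('a \<Rightarrow> ereal) \<Rightarrow> bool" where
  "pos_homogeneous_on S f \<longleftrightarrow>
     (\<forall>t\<ge>0. \<forall>z\<in>S. f z < \<infinity> \<longrightarrow> f (t *\<^sub>R z) = ereal t * f z)"

text \<open>Only the values on \<open>Z\<close> matter: functions in \<open>Phi_plus Z\<close> are unconstrained elsewhere.\<close>

definition Phi_plus :: "'a::real_normed_vector set \<Rightarrow> ('a \<Rightarrow> ereal) set" where
  "Phi_plus Z = {\<phi>. (\<forall>z\<in>Z. 0 \<le> \<phi> z) \<and> lsc_on Z \<phi> \<and> ext_convex_on Z \<phi> \<and>
     pos_homogeneous_on Z \<phi>}"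

definition Q_trans :: "'a set \<Rightarrow> ('x \<Rightarrow> 'a \<Rightarrow> real) \<Rightarrow> ('a \<Rightarrow> ereal) \<Rightarrow> 'x \<Rightarrow> ereal" where
  "Q_trans Z F \<phi> x = (INF z\<in>Z. \<phi> z + ereal (F x z))"

definition barycentric_cost ::
  "('x \<Rightarrow> 'a::euclidean_space \<Rightarrow> real) \<Rightarrow> 'x \<Rightarrow> 'a measure \<Rightarrow> ereal" where
  "barycentric_cost F x m = ereal (F x (\<integral>y. y \<partial>m))"

definition marginal1 :: "'x::topological_space set \<Rightarrow> ('x \<times> 'y::topological_space) measure \<Rightarrow> 'x measure"
  where "marginal1 X p = distr p (borel_on X) fst"

definition marginal2 :: "'y::topological_space set \<Rightarrow> ('x::topological_space \<times> 'y) measure \<Rightarrow> 'y measure"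
  where "marginal2 Y p = distr p (borel_on Y) snd"

text \<open>\<open>absolutely_continuous \<mu> \<rho>\<close> means \<open>\<rho> \<lless> \<mu>\<close>.\<close>

definition plans_ac ::
  "'x::topological_space set \<Rightarrow> 'y::topological_space set \<Rightarrow> 'x measure \<Rightarrow> 'y measure \<Rightarrow>
   ('x \<times> 'y) measure set" where
  "plans_ac X Y \<mu> \<nu> = {p \<in> borel_probs (X \<times> Y).
     absolutely_continuous \<mu> (marginal1 X p) \<and> marginal2 Y p = \<nu>}"

definition disintegration ::
  "'x::topological_space set \<Rightarrow> 'y::topological_space set \<Rightarrow> ('x \<times> 'y) measure \<Rightarrow>
   ('x \<Rightarrow> 'y measure) \<Rightarrow> bool" where
  "disintegration X Y p K \<longleftrightarrow>
     K \<in> borel_on X \<rightarrow>\<^sub>M prob_algebra (borel_on Y) \<and>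
     (\<forall>C\<in>sets (borel_on (X \<times> Y)).
        emeasure p C = (\<integral>\<^sup>+x. emeasure (K x) (Pair x -` C) \<partial>marginal1 X p))"

text \<open>
  For compact metric \<open>X\<close>, \<open>Y\<close> a disintegration exists and is unique up to a null set of the first
  marginal. On such a null set the density with respect to \<open>\<mu>\<close> vanishes \<open>\<mu>\<close>-almost everywhere, so
  the choice of the kernel does not affect \<open>transport_cost\<close> below.
\<close>

definition disint_kernel ::
  "'x::topological_space set \<Rightarrow> 'y::topological_space set \<Rightarrow> ('x \<times> 'y) measure \<Rightarrow> 'x \<Rightarrow> 'y measure"
  where "disint_kernel X Y p = (SOME K. disintegration X Y p K)"

definition transport_cost ::
  "'x::topological_space set \<Rightarrow> 'y::topological_space set \<Rightarrow> ('x \<Rightarrow> 'y measure \<Rightarrow> ereal) \<Rightarrow>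
   'x measure \<Rightarrow> ('x \<times> 'y) measure \<Rightarrow> ereal" where
  "transport_cost X Y c \<mu> p =
     ext_integral \<mu> (\<lambda>x. c x (scale_measure (RN_deriv \<mu> (marginal1 X p) x) (disint_kernel X Y p x)))"

definition transport_value ::
  "'x::topological_space set \<Rightarrow> 'y::topological_space set \<Rightarrow> ('x \<Rightarrow> 'y measure \<Rightarrow> ereal) \<Rightarrow>
   'x measure \<Rightarrow> 'y measure \<Rightarrow> ereal" where
  "transport_value X Y c \<mu> \<nu> = (INF p\<in>plans_ac X Y \<mu> \<nu>. transport_cost X Y c \<mu> p)"

definition weak_limit_on ::
  "'a::topological_space set \<Rightarrow> (nat \<Rightarrow> 'a measure) \<Rightarrow> 'a measure \<Rightarrow> bool" where
  "weak_limit_on S P p \<longleftrightarrow>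
     (\<forall>f::'a \<Rightarrow> real. continuous_on S f \<and> bounded (f ` S) \<longrightarrow>
        (\<lambda>n. \<integral>z. f z \<partial>P n) \<longlonglongrightarrow> (\<integral>z. f z \<partial>p))"

definition strong_solution ::
  "'x::topological_space set \<Rightarrow> 'y::topological_space set \<Rightarrow> ('x \<Rightarrow> 'y measure \<Rightarrow> ereal) \<Rightarrow>
   'x measure \<Rightarrow> 'y measure \<Rightarrow> ('x \<times> 'y) measure \<Rightarrow> bool" where
  "strong_solution X Y c \<mu> \<nu> p \<longleftrightarrow>
     p \<in> plans_ac X Y \<mu> \<nu> \<and> transport_cost X Y c \<mu> p = transport_value X Y c \<mu> \<nu>"

definition weak_solution ::
  "'x::topological_space set \<Rightarrow> 'y::topological_space set \<Rightarrow> ('x \<Rightarrow> 'y measure \<Rightarrow> ereal) \<Rightarrow>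
   'x measure \<Rightarrow> 'y measure \<Rightarrow> ('x \<times> 'y) measure \<Rightarrow> bool" where
  "weak_solution X Y c \<mu> \<nu> p \<longleftrightarrow> p \<in> borel_probs (X \<times> Y) \<and>
     (\<exists>P. (\<forall>n. P n \<in> plans_ac X Y \<mu> \<nu>) \<and> weak_limit_on (X \<times> Y) P p \<and>
          (\<lambda>n. transport_cost X Y c \<mu> (P n)) \<longlonglongrightarrow> transport_value X Y c \<mu> \<nu>)"

definition dual_objective ::
  "'a set \<Rightarrow> ('x \<Rightarrow> 'a \<Rightarrow> real) \<Rightarrow> 'x measure \<Rightarrow> 'a measure \<Rightarrow> ('a \<Rightarrow> ereal) \<Rightarrow> ereal" where
  "dual_objective Z F \<mu> \<nu> \<phi> = ext_integral \<mu> (Q_trans Z F \<phi>) - ext_integral \<nu> \<phi>"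

end

theory Submission
  imports Defs
begin

text \<open>
  The cost of a plan \<open>p\<close> with kernel \<open>q\<close> depends only on its barycentric map
  \<open>S x = \<integral>y. y \<partial>q\<^sup>x\<close>, an integrable map into the cone \<open>Z\<close>. Every estimate below is measured with
  one linear functional \<open>e\<close> that is at least \<open>1\<close> on \<open>Y\<close>. It exists because \<open>0\<close> is not in the convex
  hull of \<open>Y\<close>, and it makes \<open>Z\<close> closed with compact slices \<open>e \<bullet> z \<le> L\<close>. By convexity and
  compactness the two growth conditions on \<open>F\<close> become uniform: for every \<open>\<eta> > 0\<close> the function \<open>F\<close> is
  bounded below by \<open>- \<eta> * (e \<bullet> z) - M\<close>, and it tends to \<open>- \<infinity>\<close> uniformly as \<open>e \<bullet> z\<close> grows.

  Weak duality (\<open>weak_duality\<close>) is Jensen's inequality \<open>\<phi> (S x) \<le> \<integral>y. \<phi> y \<partial>q\<^sup>x\<close> for a sublinear lower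
  semicontinuous \<open>\<phi>\<close>, integrated over \<open>x\<close>. The kernel in the cost is an arbitrarily chosen
  disintegration, so its existence has to be known first (\<open>disintegration_exists\<close>).

  There is no gap (\<open>approximate_duality\<close>) because the problem is finite dimensional up to a small
  error. Cut \<open>X\<close> into finitely many cells with centres \<open>c i\<close> and freeze \<open>F\<close> at the centres. A plan
  that is constant in \<open>x\<close> on each cell is a partition of unity \<open>r i\<close> on \<open>Y\<close>, and its cost is a convex
  function of the finitely many vectors \<open>\<integral>y. r i y *\<^sub>R y \<partial>\<nu>\<close>, hence nearly a maximum of finitely many
  affine functions. A theorem of the alternative replaces this maximum by one convex combination,
  that is, by affine minorants \<open>w i \<bullet> z + b i\<close> of \<open>F (c i)\<close>. Against linear functions the best
  partition of unity sends \<open>y\<close> to the cell that minimises \<open>w i \<bullet> y\<close>, so the linear problem is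
  solved explicitly and \<open>\<phi> z = Max\<^sub>i (- (w i \<bullet> z))\<close> is a nearly optimal dual function.

  The dual supremum is attained (\<open>dual_attained\<close>) at an epigraphical limit of nearly optimal
  functions: such limits exist along a subsequence (\<open>epi_convergent_subsequence\<close>), inherit
  sublinearity, and are compatible with Fatou's lemma in both terms of the dual objective.
  Coercivity of \<open>F\<close> forces every optimal \<open>\<phi>\<close> to dominate \<open>\<delta> * (e \<bullet> z)\<close> for some \<open>\<delta> > 0\<close>, in
  particular to be positive off the origin.

  This lower bound also handles weak solutions. Along a minimising sequence the slack in weak
  duality tends to \<open>0\<close>, and the slack controls the part of \<open>e \<bullet> S\<close> above a fixed level \<open>C\<close>
  (\<open>excess_mass\<close>). Therefore the barycentric maps are uniformly integrable, the first marginal of a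
  weak limit is at most \<open>C\<close> times \<open>\<mu>\<close>, and the cost is lower semicontinuous along the sequence because
  it is an increasing limit of costs given by finitely many affine functions
  (\<open>weak_solution_is_strong\<close>).
\<close>

section \<open>Finite minimax, barycenters and epi-convergence\<close>

text \<open>
  Separate the open negative quadrant of the plane from the set of pairs that dominate some value
  \<open>(f c, g c)\<close>.
\<close>

lemma convexlike_pair:
  fixes f g :: "'c \<Rightarrow> real"
  assumes mix: "\<And>c d t. c \<in> S \<Longrightarrow> d \<in> S \<Longrightarrow> 0 \<le> t \<Longrightarrow> t \<le> 1 \<Longrightarrow>
      \<exists>m\<in>S. f m \<le> (1 - t) * f c + t * f d \<and> g m \<le> (1 - t) * g c + t * g d"
    and pos: "\<And>c. c \<in> S \<Longrightarrow> 0 \<le> f c \<or> 0 \<le> g c"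
  shows "\<exists>t\<ge>0. t \<le> 1 \<and> (\<forall>c\<in>S. 0 \<le> (1 - t) * f c + t * g c)"
proof (cases "S = {}")
  case False
  define U where "U = {p. \<exists>c\<in>S. f c \<le> fst p \<and> g c \<le> snd p}"
  define N where "N = {p. fst p < (0::real) \<and> snd p < (0::real)}"
  have "convex N"
    unfolding convex_alt N_def
    by (auto intro!: convex_bound_lt[where a=0 and 'a=real, simplified])
  moreover have "convex U"
    unfolding convex_alt
  proof (intro ballI allI impI)
    fix p q :: "real \<times> real" and t :: real
    assume "p \<in> U" "q \<in> U" and t: "0 \<le> t \<and> t \<le> 1"
    then obtain c d where cd: "c \<in> S" "d \<in> S" "f c \<le> fst p" "g c \<le> snd p" "f d \<le> fst q" "g d \<le> snd q"
      by (auto simp: U_def)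
    obtain m where m: "m \<in> S" "f m \<le> (1 - t) * f c + t * f d" "g m \<le> (1 - t) * g c + t * g d"
      using mix[of c d t] cd t by auto
    have "(1 - t) * f c + t * f d \<le> (1 - t) * fst p + t * fst q"
         "(1 - t) * g c + t * g d \<le> (1 - t) * snd p + t * snd q"
      using cd t by (auto intro!: add_mono mult_left_mono)
    then show "(1 - t) *\<^sub>R p + t *\<^sub>R q \<in> U"
      using m by (auto simp: U_def intro!: bexI[of _ m])
  qed
  moreover have "N \<noteq> {}" by (auto simp: N_def intro!: exI[of _ "-1"])
  moreover have "U \<noteq> {}" using False by (auto simp: U_def)
  moreover have "N \<inter> U = {}" using pos by (force simp: N_def U_def)
  ultimately obtain w \<beta> where w: "w \<noteq> 0" "\<forall>p\<in>N. w \<bullet> p \<le> \<beta>" "\<forall>p\<in>U. \<beta> \<le> w \<bullet> p"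
    using separating_hyperplane_sets[of N U] by blast
  obtain a b where ab: "w = (a, b)" by (cases w)
  have N: "a * x + b * y \<le> \<beta>" if "x < 0" "y < 0" for x y
    using w(2) that by (auto simp: ab N_def inner_prod_def)
  have beta: "0 \<le> \<beta>"
  proof (rule ccontr)
    assume "\<not> 0 \<le> \<beta>"
    define s where "s = - \<beta> / (2 * (\<bar>a\<bar> + \<bar>b\<bar> + 1))"
    have s: "s > 0" using \<open>\<not> 0 \<le> \<beta>\<close> by (auto simp: s_def intro!: divide_neg_pos)
    have "a * (- s) + b * (- s) \<le> \<beta>" by (rule N) (use s in auto)
    moreover have "(a + b) * s \<le> (\<bar>a\<bar> + \<bar>b\<bar> + 1) * s"
      using s by (intro mult_right_mono) auto
    moreover have "(\<bar>a\<bar> + \<bar>b\<bar> + 1) * s = - \<beta> / 2" unfolding s_def by (simp add: field_simps)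
    ultimately show False using \<open>\<not> 0 \<le> \<beta>\<close> by (simp add: distrib_right)
  qed
  have a0: "0 \<le> a"
  proof (rule ccontr)
    assume a: "\<not> 0 \<le> a"
    define t where "t = (\<beta> + \<bar>b\<bar> + 1) / a"
    have "t < 0" "a * t = \<beta> + \<bar>b\<bar> + 1" using a beta by (auto simp: t_def intro!: divide_pos_neg)
    then show False using N[of t "-1"] by simp
  qed
  have b0: "0 \<le> b"
  proof (rule ccontr)
    assume a: "\<not> 0 \<le> b"
    define t where "t = (\<beta> + \<bar>a\<bar> + 1) / b"
    have "t < 0" "b * t = \<beta> + \<bar>a\<bar> + 1" using a beta by (auto simp: t_def intro!: divide_pos_neg)
    then show False using N[of "-1" t] by simp
  qed
  have ab0: "a + b > 0" using w(1) a0 b0 by (auto simp: ab zero_prod_def)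
  show ?thesis
  proof (intro exI[of _ "b / (a + b)"] conjI ballI)
    fix c assume "c \<in> S"
    then have "(f c, g c) \<in> U" by (auto simp: U_def)
    then have "0 \<le> a * f c + b * g c" using w(3) beta by (force simp: ab inner_prod_def)
    also have "a * f c + b * g c = (a + b) * ((1 - b / (a + b)) * f c + b / (a + b) * g c)"
    proof -
      have "(a + b) * (1 - b / (a + b)) = a" "(a + b) * (b / (a + b)) = b"
        using ab0 by (simp_all add: right_diff_distrib)
      then show ?thesis by (simp only: distrib_left mult.assoc[symmetric])
    qed
    finally show "0 \<le> (1 - b / (a + b)) * f c + b / (a + b) * g c"
      using ab0 by (simp add: zero_le_mult_iff)
  qed (use a0 b0 ab0 in auto)
qed auto

text \<open>
  Ky Fan's theorem of the alternative for convexlike functions. Induction on the number of functions: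
  where the new function is negative the others already admit a nonnegative combination, and that
  combination and the new function form a pair.
\<close>

lemma convexlike_alternative:
  fixes f :: "'i \<Rightarrow> 'c \<Rightarrow> real"
  assumes "finite I" "I \<noteq> {}"
    and "\<And>c d t. c \<in> S \<Longrightarrow> d \<in> S \<Longrightarrow> 0 \<le> t \<Longrightarrow> t \<le> 1 \<Longrightarrow>
      \<exists>m\<in>S. \<forall>i\<in>I. f i m \<le> (1 - t) * f i c + t * f i d"
    and "\<And>c. c \<in> S \<Longrightarrow> \<exists>i\<in>I. 0 \<le> f i c"
  shows "\<exists>l. (\<forall>i\<in>I. 0 \<le> l i) \<and> sum l I = 1 \<and> (\<forall>c\<in>S. 0 \<le> (\<Sum>i\<in>I. l i * f i c))"
  using assms
proof (induction arbitrary: S rule: finite_ne_induct)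
  case (singleton i)
  then show ?case by (intro exI[of _ "\<lambda>_. 1"]) auto
next
  case (insert j I)
  define S' where "S' = {c \<in> S. f j c < 0}"
  have "\<exists>l. (\<forall>i\<in>I. 0 \<le> l i) \<and> sum l I = 1 \<and> (\<forall>c\<in>S'. 0 \<le> (\<Sum>i\<in>I. l i * f i c))"
  proof (rule insert.IH)
    fix c d t :: "_" assume cd: "c \<in> S'" "d \<in> S'" "0 \<le> t" "t \<le> (1::real)"
    then obtain m where m: "m \<in> S" "\<forall>i\<in>insert j I. f i m \<le> (1 - t) * f i c + t * f i d"
      using insert.prems(1)[of c d t] by (auto simp: S'_def)
    have "(1 - t) * f j c + t * f j d < 0"
      using cd by (intro convex_bound_lt[of "f j c" 0 "f j d" "1 - t" t, simplified]) (auto simp: S'_def)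
    then have "m \<in> S'" using m by (force simp: S'_def)
    then show "\<exists>m\<in>S'. \<forall>i\<in>I. f i m \<le> (1 - t) * f i c + t * f i d" using m by auto
  next
    fix c assume "c \<in> S'"
    then show "\<exists>i\<in>I. 0 \<le> f i c" using insert.prems(2)[of c] by (auto simp: S'_def)
  qed
  then obtain l where l: "\<And>i. i \<in> I \<Longrightarrow> 0 \<le> l i" "sum l I = 1" "\<And>c. c \<in> S' \<Longrightarrow> 0 \<le> (\<Sum>i\<in>I. l i * f i c)"
    by auto
  define g where "g c = (\<Sum>i\<in>I. l i * f i c)" for c
  have "\<exists>t\<ge>0. t \<le> 1 \<and> (\<forall>c\<in>S. 0 \<le> (1 - t) * g c + t * f j c)"
  proof (rule convexlike_pair)
    fix c d t assume cd: "c \<in> S" "d \<in> S" "0 \<le> t" "t \<le> (1::real)"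
    then obtain m where m: "m \<in> S" "\<forall>i\<in>insert j I. f i m \<le> (1 - t) * f i c + t * f i d"
      using insert.prems(1)[of c d t] by auto
    have "g m \<le> (\<Sum>i\<in>I. l i * ((1 - t) * f i c + t * f i d))"
      unfolding g_def using m l(1) by (intro sum_mono mult_left_mono) auto
    also have "\<dots> = (1 - t) * g c + t * g d"
      by (simp add: g_def sum_distrib_left flip: sum.distrib) (simp add: algebra_simps)
    finally show "\<exists>m\<in>S. g m \<le> (1 - t) * g c + t * g d \<and> f j m \<le> (1 - t) * f j c + t * f j d"
      using m by auto
  next
    fix c assume "c \<in> S"
    then show "0 \<le> g c \<or> 0 \<le> f j c" using l(3)[of c] by (force simp: S'_def g_def)
  qed
  then obtain t where t: "0 \<le> t" "t \<le> 1" "\<And>c. c \<in> S \<Longrightarrow> 0 \<le> (1 - t) * g c + t * f j c" by auto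
  define l' where "l' i = (if i = j then t else (1 - t) * l i)" for i
  have s: "(\<Sum>i\<in>insert j I. l' i * h i) = t * h j + (1 - t) * (\<Sum>i\<in>I. l i * h i)" for h :: "_ \<Rightarrow> real"
  proof -
    have "(\<Sum>i\<in>I. l' i * h i) = (1 - t) * (\<Sum>i\<in>I. l i * h i)"
      unfolding sum_distrib_left using insert.hyps by (intro sum.cong) (auto simp: l'_def)
    then show ?thesis using insert.hyps by (simp add: l'_def)
  qed
  show ?case
  proof (intro exI[of _ l'] conjI ballI)
    fix c assume "c \<in> S"
    then show "0 \<le> (\<Sum>i\<in>insert j I. l' i * f i c)" using t(3)[of c] by (simp add: s g_def add.commute)
  next
    show "sum l' (insert j I) = 1" using s[of "\<lambda>_. 1"] l(2) by simp
  qed (use t l in \<open>auto simp: l'_def\<close>)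
qed

text \<open>
  A point outside a closed convex set is strictly separated from it, and the separating functional can
  be integrated.
\<close>

lemma (in prob_space) integral_in_closed_convex:
  fixes f :: "'a \<Rightarrow> 'b::euclidean_space"
  assumes f: "integrable M f" and C: "AE x in M. f x \<in> C" "closed C" "convex C"
  shows "(\<integral>x. f x \<partial>M) \<in> C"
proof (rule ccontr)
  assume "(\<integral>x. f x \<partial>M) \<notin> C"
  then obtain w \<beta> where w: "w \<bullet> (\<integral>x. f x \<partial>M) < \<beta>" "\<forall>x\<in>C. \<beta> < w \<bullet> x"
    using separating_hyperplane_closed_point[OF C(3,2)] by blast
  have "\<beta> \<le> (\<integral>x. w \<bullet> f x \<partial>M)"
  proof (rule integral_ge_const)
    show "integrable M (\<lambda>x. w \<bullet> f x)" using f by simp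
    show "AE x in M. \<beta> \<le> w \<bullet> f x" using C(1) by eventually_elim (use w(2) in force)
  qed
  then show False using w(1) f by simp
qed

text \<open>
  For each \<open>n\<close> serve the largest requirement \<open>k \<le> n\<close> that can be met at
  \<open>n\<close>; requirements are nested, so serving a late one serves all earlier ones.
\<close>

lemma eventually_diagonal_choice:
  assumes "\<And>k. eventually (\<lambda>n. \<exists>x. P k n x) sequentially"
    and "\<And>k l n x. k \<le> l \<Longrightarrow> P l n x \<Longrightarrow> P k n x"
  shows "\<exists>s. \<forall>k::nat. eventually (\<lambda>n::nat. P k n (s n)) sequentially"
proof -
  define K where "K n = Max {k. k \<le> n \<and> (\<exists>x. P k n x)}" for n
  define s where "s n = (SOME x. P (K n) n x)" for n
  have "eventually (\<lambda>n. P k n (s n)) sequentially" for k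
    using assms(1)[of k] eventually_ge_at_top[of k]
  proof eventually_elim
    case (elim n)
    let ?A = "{k. k \<le> n \<and> (\<exists>x. P k n x)}"
    have "finite ?A" "k \<in> ?A" using elim by auto
    then have "K n \<in> ?A" "k \<le> K n" unfolding K_def using Max_in[of ?A] by (blast, simp)
    then have "P (K n) n (s n)" unfolding s_def by (metis (mono_tags, lifting) mem_Collect_eq someI_ex)
    then show ?case using assms(2) \<open>k \<le> K n\<close> by blast
  qed
  then show ?thesis by blast
qed

text \<open>
  Compactness of epi-convergence (Gamma-convergence). A diagonal subsequence makes the infima over all
  members of a countable base converge; the limit function at \<open>z\<close> is the supremum of
  these limits over the basic neighbourhoods of \<open>z\<close>. The last two conclusions are the
  lower bound along arbitrary sequences and the existence of recovery sequences.
\<close>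

lemma epi_convergent_subsequence:
  fixes f :: "nat \<Rightarrow> 'a::{metric_space, second_countable_topology} \<Rightarrow> ereal"
  obtains r g where "strict_mono r" "lsc_on Z g"
    "\<And>z s. z \<in> Z \<Longrightarrow> (\<And>n. s n \<in> Z) \<Longrightarrow> s \<longlonglongrightarrow> z \<Longrightarrow> g z \<le> liminf (\<lambda>n. f (r n) (s n))"
    "\<And>z. z \<in> Z \<Longrightarrow> \<exists>s. (\<forall>n. s n \<in> Z) \<and> s \<longlonglongrightarrow> z \<and> (\<lambda>n. f (r n) (s n)) \<longlonglongrightarrow> g z"
proof -
  obtain \<B> :: "'a set set" where \<B>: "countable \<B>" "topological_basis \<B>"
    using ex_countable_basis by auto
  have ne: "\<B> \<noteq> {}" using topological_basisE[OF \<B>(2), of UNIV undefined] by auto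
  define B where "B = from_nat_into \<B>"
  have B: "range B = \<B>" unfolding B_def using \<B>(1) ne by (simp add: range_from_nat_into)
  have opB: "open (B j)" for j using \<B>(2) B topological_basis_open by blast
  have ballB: "\<exists>j. z \<in> B j \<and> B j \<subseteq> W" if "open W" "z \<in> W" for z W
    using topological_basisE[OF \<B>(2) that] B by (metis rangeE)
  define m where "m j n = (INF z\<in>Z \<inter> B j. f n z)" for j n
  interpret subseqs "\<lambda>j s. \<exists>l. (\<lambda>n. m j (s n)) \<longlonglongrightarrow> l"
  proof
    fix j :: nat and s :: "nat \<Rightarrow> nat" assume "strict_mono s"
    obtain l r where "strict_mono r" "((\<lambda>n. m j (s n)) \<circ> r) \<longlonglongrightarrow> l"
      using compact_complete_linorder by blast
    then show "\<exists>r. strict_mono r \<and> (\<exists>l. (\<lambda>n. m j ((s \<circ> r) n)) \<longlonglongrightarrow> l)" by (auto simp: o_def)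
  qed
  have "\<exists>l. (\<lambda>n. m j (diagseq n)) \<longlonglongrightarrow> l" for j
  proof -
    have "\<exists>l. (\<lambda>n. m j ((diagseq \<circ> (+) (Suc j)) n)) \<longlonglongrightarrow> l"
    proof (rule diagseq_holds)
      fix k and s r :: "nat \<Rightarrow> nat" assume r: "strict_mono r" and "\<exists>l. (\<lambda>n. m k (s n)) \<longlonglongrightarrow> l"
      then obtain l where "(\<lambda>n. m k (s n)) \<longlonglongrightarrow> l" by blast
      from LIMSEQ_subseq_LIMSEQ[OF this r] show "\<exists>l. (\<lambda>n. m k ((s \<circ> r) n)) \<longlonglongrightarrow> l"
        by (auto simp: o_def)
    qed
    then obtain l where "(\<lambda>n. m j (diagseq (Suc j + n))) \<longlonglongrightarrow> l" by (auto simp: o_def)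
    then have "(\<lambda>n. m j (diagseq (n + Suc j))) \<longlonglongrightarrow> l" by (simp add: add.commute)
    then have "(\<lambda>n. m j (diagseq n)) \<longlonglongrightarrow> l" by (rule LIMSEQ_offset)
    then show ?thesis by blast
  qed
  then have "\<exists>c. \<forall>j. (\<lambda>n. m j (diagseq n)) \<longlonglongrightarrow> c j" by (intro choice allI)
  then obtain c where c: "\<And>j. (\<lambda>n. m j (diagseq n)) \<longlonglongrightarrow> c j" by blast
  define g where "g z = (SUP j\<in>{j. z \<in> B j}. c j)" for z
  have g_ge: "c j \<le> g z" if "z \<in> B j" for j z unfolding g_def by (rule SUP_upper) (use that in simp)
  have lower: "g z \<le> liminf (\<lambda>n. f (diagseq n) (s n))" if z: "z \<in> Z" "\<And>n. s n \<in> Z" "s \<longlonglongrightarrow> z" for z s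
    unfolding g_def
  proof (rule SUP_least)
    fix j assume j: "j \<in> {j. z \<in> B j}"
    have "eventually (\<lambda>n. s n \<in> B j) sequentially"
      by (rule topological_tendstoD[OF z(3) opB]) (use j in simp)
    then have "eventually (\<lambda>n. m j (diagseq n) \<le> f (diagseq n) (s n)) sequentially"
      by eventually_elim (auto simp: m_def z intro!: INF_lower)
    then have "liminf (\<lambda>n. m j (diagseq n)) \<le> liminf (\<lambda>n. f (diagseq n) (s n))" by (rule Liminf_mono)
    then show "c j \<le> liminf (\<lambda>n. f (diagseq n) (s n))"
      using lim_imp_Liminf[OF _ c[of j]] by simp
  qed
  show thesis
  proof (rule that[of diagseq g])
    show "strict_mono diagseq" by (rule subseq_diagseq)
    show "lsc_on Z g"
      unfolding lsc_on_def
    proof (intro ballI)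
      fix z assume "z \<in> Z"
      show "g z \<le> Liminf (at z within Z) g"
        unfolding le_Liminf_iff
      proof (intro allI impI)
        fix y assume "y < g z"
        then obtain j where j: "z \<in> B j" "y < c j" unfolding g_def by (auto simp: less_SUP_iff)
        have "eventually (\<lambda>x. x \<in> B j) (at z within Z)"
          using j(1) opB by (metis eventually_at_topological)
        then show "eventually (\<lambda>x. y < g x) (at z within Z)"
          by eventually_elim (use j(2) g_ge in \<open>auto intro: less_le_trans\<close>)
      qed
    qed
    show "g z \<le> liminf (\<lambda>n. f (diagseq n) (s n))" if "z \<in> Z" "\<And>n. s n \<in> Z" "s \<longlonglongrightarrow> z" for z s
      using lower[OF that] .
    fix z assume z: "z \<in> Z"
    (* The k-th requirement on a recovery point: within 1 / (k + 1) of z and with a value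
       exceeding g z by at most 1 / (k + 1). The case g z = -\<infinity> needs its own scale of values. *)
    define P where "P k n x \<longleftrightarrow> x \<in> Z \<and> dist x z < 1 / real (Suc k) \<and>
       (g z < \<infinity> \<longrightarrow> (if g z = -\<infinity> then f (diagseq n) x < - ereal (real k) else f (diagseq n) x < g z + ereal (1 / Suc k)))" for k n x
    have "\<exists>s. \<forall>k. eventually (\<lambda>n. P k n (s n)) sequentially"
    proof (rule eventually_diagonal_choice)
      fix k
      show "eventually (\<lambda>n. \<exists>x. P k n x) sequentially"
      proof (cases "g z < \<infinity>")
        case False
        then show ?thesis using z by (auto simp: P_def intro!: exI[of _ z] always_eventually)
      next
        case True
        obtain j where j: "z \<in> B j" "B j \<subseteq> ball z (1 / real (Suc k))"
          using ballB[of "ball z (1 / real (Suc k))" z] by auto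
        define b where "b = (if g z = -\<infinity> then - ereal (real k) else g z + ereal (1 / Suc k))"
        have "g z < b" using True unfolding b_def by (cases "g z") auto
        then have "c j < b" using g_ge[OF j(1)] by order
        then have "eventually (\<lambda>n. m j (diagseq n) < b) sequentially"
          using order_tendstoD(2)[OF c[of j]] by blast
        then show ?thesis
        proof eventually_elim
          case (elim n)
          then obtain x where "x \<in> Z \<inter> B j" "f (diagseq n) x < b" unfolding m_def by (auto simp: INF_less_iff)
          then show ?case using j(2) by (auto simp: P_def b_def dist_commute intro!: exI[of _ x])
        qed
      qed
    next
      fix k l n x assume kl: "k \<le> l" and "P l n x"
      moreover have "1 / real (Suc l) \<le> 1 / real (Suc k)" using kl by (simp add: frac_le)
      moreover have "ereal (1 / real (Suc l)) \<le> ereal (1 / real (Suc k))" using calculation by simp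
      moreover have "g z + ereal (1 / real (Suc l)) \<le> g z + ereal (1 / real (Suc k))"
        using calculation(4) by (rule add_left_mono)
      moreover have "- ereal (real l) \<le> - ereal (real k)" using kl by simp
      ultimately show "P k n x" unfolding P_def by (auto split: if_splits intro: less_le_trans)
    qed
    then obtain s0 where s0: "\<And>k. eventually (\<lambda>n. P k n (s0 n)) sequentially" by blast
    define s where "s n = (if s0 n \<in> Z then s0 n else z)" for n
    have s: "eventually (\<lambda>n. P k n (s n)) sequentially" for k
      using s0[of k] by eventually_elim (auto simp: s_def P_def)
    have sZ: "s n \<in> Z" for n using z by (simp add: s_def)
    have lim: "s \<longlonglongrightarrow> z"
      unfolding tendsto_iff
    proof (intro allI impI)
      fix e :: real assume "0 < e"
      then obtain k where "1 / real (Suc k) < e" using nat_approx_posE by blast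
      with s[of k] show "eventually (\<lambda>n. dist (s n) z < e) sequentially"
        by (auto simp: P_def elim!: eventually_mono)
    qed
    have "limsup (\<lambda>n. f (diagseq n) (s n)) \<le> g z"
      unfolding Limsup_le_iff
    proof (intro allI impI)
      fix y assume y: "g z < y"
      have "\<exists>k. (if g z = -\<infinity> then - ereal (real k) else g z + ereal (1 / Suc k)) \<le> y"
      proof (cases "g z")
        case (real v)
        then obtain k where "ereal (v + 1 / Suc k) \<le> y"
        proof (cases y)
          case (real y')
          then have "0 < y' - v" using y \<open>g z = ereal v\<close> by simp
          then obtain k where "1 / real (Suc k) < y' - v" using nat_approx_posE by blast
          then show ?thesis using real that[of k] by simp
        qed (use y in auto)
        then show ?thesis using real by auto
      next
        case MInf
        show ?thesis
        proof (cases y)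
          case (real y')
          obtain k :: nat where "real k > - y'" using reals_Archimedean2 by blast
          then show ?thesis using MInf real by (auto intro!: exI[of _ k])
        qed (use MInf y in auto)
      qed (use y in auto)
      then obtain k where k: "(if g z = -\<infinity> then - ereal (real k) else g z + ereal (1 / Suc k)) \<le> y" by blast
      have "g z < \<infinity>" using y by auto
      with s[of k] show "eventually (\<lambda>n. f (diagseq n) (s n) < y) sequentially"
        using k by (auto simp: P_def elim!: eventually_mono split: if_splits)
    qed
    moreover have "g z \<le> liminf (\<lambda>n. f (diagseq n) (s n))" by (rule lower[OF z sZ lim])
    ultimately have "(\<lambda>n. f (diagseq n) (s n)) \<longlonglongrightarrow> g z"
      using Liminf_le_Limsup[of sequentially "\<lambda>n. f (diagseq n) (s n)"]
      by (intro Liminf_eq_Limsup) auto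
    then show "\<exists>s. (\<forall>n. s n \<in> Z) \<and> s \<longlonglongrightarrow> z \<and> (\<lambda>n. f (diagseq n) (s n)) \<longlonglongrightarrow> g z"
      using sZ lim by blast
  qed
qed

section \<open>Borel sets of compact products and continuous approximation\<close>

lemma compact_countable_dense:
  fixes X :: "'a::metric_space set"
  assumes "compact X"
  obtains D where "countable D" "D \<subseteq> X" "\<And>x e. x \<in> X \<Longrightarrow> 0 < e \<Longrightarrow> \<exists>d\<in>D. dist d x < e"
proof -
  have "\<exists>k. finite k \<and> k \<subseteq> X \<and> X \<subseteq> (\<Union>x\<in>k. ball x (1 / real (Suc n)))" for n
    using seq_compact_imp_totally_bounded[OF compact_imp_seq_compact[OF assms], rule_format, of "1 / real (Suc n)"] by simp
  then obtain k where k: "\<And>n. finite (k n)" "\<And>n. k n \<subseteq> X"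
      "\<And>n. X \<subseteq> (\<Union>x\<in>k n. ball x (1 / real (Suc n)))" by metis
  show thesis
  proof (rule that[of "\<Union>n. k n"])
    fix x and e :: real assume "x \<in> X" "0 < e"
    then obtain n where "1 / real (Suc n) < e" using nat_approx_posE by blast
    moreover obtain d where "d \<in> k n" "dist d x < 1 / real (Suc n)" using k(3)[of n] \<open>x \<in> X\<close> by auto
    ultimately show "\<exists>d\<in>\<Union>n. k n. dist d x < e" by (meson UN_I UNIV_I less_trans)
  qed (use k in \<open>auto intro: countable_finite\<close>)
qed

lemma fst_measurable_borel_on [measurable]: "fst \<in> borel_on (X \<times> Y) \<rightarrow>\<^sub>M borel_on X"
  by (intro measurable_restrict_space3 borel_measurable_continuous_onI) (auto intro: continuous_on_fst)

lemma snd_measurable_borel_on [measurable]: "snd \<in> borel_on (X \<times> Y) \<rightarrow>\<^sub>M borel_on Y"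
  by (intro measurable_restrict_space3 borel_measurable_continuous_onI) (auto intro: continuous_on_snd)

text \<open>
  Only \<open>X\<close> itself, not its type, is second countable: balls with centres in a countable
  dense subset of \<open>X\<close> give countably many rectangles that exhaust every relatively open
  set.
\<close>

lemma sets_borel_on_Times:
  fixes X :: "'a::metric_space set" and Y :: "'b::second_countable_topology set"
  assumes "compact X"
  shows "sets (borel_on (X \<times> Y)) = sets (borel_on X \<Otimes>\<^sub>M borel_on Y)"
proof (rule antisym)
  have "(\<lambda>z. (fst z, snd z)) \<in> borel_on (X \<times> Y) \<rightarrow>\<^sub>M (borel_on X \<Otimes>\<^sub>M borel_on Y)"
    by measurable
  then have id: "(\<lambda>z. z) \<in> borel_on (X \<times> Y) \<rightarrow>\<^sub>M (borel_on X \<Otimes>\<^sub>M borel_on Y)" by simp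
  show "sets (borel_on X \<Otimes>\<^sub>M borel_on Y) \<subseteq> sets (borel_on (X \<times> Y))"
  proof
    fix A assume A: "A \<in> sets (borel_on X \<Otimes>\<^sub>M borel_on Y)"
    then have "A \<subseteq> X \<times> Y" using sets.sets_into_space[OF A] by (auto simp: space_pair_measure space_restrict_space)
    then show "A \<in> sets (borel_on (X \<times> Y))"
      using measurable_sets[OF id A] by (simp add: space_restrict_space Int_absorb2)
  qed
next
  obtain D where D: "countable D" "D \<subseteq> X" "\<And>x e. x \<in> X \<Longrightarrow> 0 < e \<Longrightarrow> \<exists>d\<in>D. dist d x < e"
    using compact_countable_dense[OF assms] by blast
  obtain B :: "'b set set" where B: "countable B" "topological_basis B" using ex_countable_basis by auto
  define R where "R = (\<lambda>(d, n, b). (X \<inter> ball d (1 / real (Suc n))) \<times> (Y \<inter> b)) ` (D \<times> UNIV \<times> B)"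
  have R: "countable R" unfolding R_def using D B by auto
  have Rs: "r \<in> sets (borel_on X \<Otimes>\<^sub>M borel_on Y)" if "r \<in> R" for r
    using that topological_basis_open[OF B(2)] unfolding R_def
    by (auto intro!: pair_measureI simp: sets_restrict_space)
  have op: "W \<inter> (X \<times> Y) \<in> sets (borel_on X \<Otimes>\<^sub>M borel_on Y)" if W: "open W" for W :: "('a \<times> 'b) set"
  proof -
    have "W \<inter> (X \<times> Y) = \<Union>{r\<in>R. r \<subseteq> W}"
    proof (intro set_eqI iffI)
      fix z assume z: "z \<in> W \<inter> (X \<times> Y)"
      obtain x y where xy: "z = (x, y)" by (cases z)
      obtain S T where ST: "open S" "open T" "x \<in> S" "y \<in> T" "S \<times> T \<subseteq> W"
        using open_prod_elim[OF W, of z] z xy by (metis IntD1 mem_Sigma_iff)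
      obtain e where e: "e > 0" "ball x e \<subseteq> S" using ST openE by blast
      obtain n where n: "1 / real (Suc n) < e / 2" using nat_approx_posE[of "e/2"] e by auto
      obtain d where d: "d \<in> D" "dist d x < 1 / real (Suc n)" using D(3)[of x "1 / real (Suc n)"] z xy by auto
      obtain b where b: "b \<in> B" "y \<in> b" "b \<subseteq> T" using topological_basisE[OF B(2) ST(2,4)] by metis
      have "ball d (1 / real (Suc n)) \<subseteq> ball x e"
      proof
        fix x' assume "x' \<in> ball d (1 / real (Suc n))"
        then show "x' \<in> ball x e" using n d dist_triangle[of x x' d] by (auto simp: dist_commute)
      qed
      then have "(X \<inter> ball d (1 / real (Suc n))) \<times> (Y \<inter> b) \<subseteq> W" using e ST b by blast
      then show "z \<in> \<Union>{r\<in>R. r \<subseteq> W}"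
        using d b z xy by (intro UnionI[of "(X \<inter> ball d (1 / real (Suc n))) \<times> (Y \<inter> b)"])
          (force simp: R_def)+
    qed (auto simp: R_def)
    moreover have "countable {r\<in>R. r \<subseteq> W}" using R by auto
    ultimately show ?thesis using Rs by (auto intro!: sets.countable_Union)
  qed
  have "(\<lambda>z. z) \<in> borel_measurable (borel_on X \<Otimes>\<^sub>M borel_on Y)"
    using op by (intro borel_measurableI) (auto simp: space_pair_measure space_restrict_space)
  then show "sets (borel_on (X \<times> Y)) \<subseteq> sets (borel_on X \<Otimes>\<^sub>M borel_on Y)"
    using measurable_sets[of "\<lambda>z. z" "borel_on X \<Otimes>\<^sub>M borel_on Y" borel]
    by (auto simp: sets_restrict_space space_pair_measure space_restrict_space Int_commute)
qed

lemma continuous_approx_closed: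
  fixes M :: "'a::metric_space measure"
  assumes M: "finite_measure M" "sets M = sets (borel_on X)" and C: "closed C" "C \<noteq> {}"
  shows "(\<lambda>n. \<integral>x. \<bar>indicator C x - max 0 (1 - real n * infdist x C)\<bar> \<partial>M) \<longlonglongrightarrow> 0"
proof -
  interpret finite_measure M by fact
  have meas: "h \<in> borel_measurable M" if "h \<in> borel_measurable borel" for h :: "'a \<Rightarrow> real"
    using measurable_restrict_space1[OF that, of X] M(2) measurable_cong_sets by blast
  have "(\<lambda>n. \<integral>x. \<bar>indicator C x - max 0 (1 - real n * infdist x C)\<bar> \<partial>M) \<longlonglongrightarrow> (\<integral>x. 0 \<partial>M)"
  proof (rule integral_dominated_convergence[where w="\<lambda>_. 1"])
    show "AE x in M. (\<lambda>n. \<bar>indicator C x - max 0 (1 - real n * infdist x C)\<bar>) \<longlonglongrightarrow> 0"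
    proof (rule AE_I2)
      fix x
      show "(\<lambda>n. \<bar>indicator C x - max 0 (1 - real n * infdist x C)\<bar>) \<longlonglongrightarrow> (0::real)"
      proof (cases "x \<in> C")
        case False
        then have p: "infdist x C > 0" using C by (metis in_closed_iff_infdist_zero infdist_nonneg less_eq_real_def)
        obtain N :: nat where N: "real N > 1 / infdist x C" using reals_Archimedean2 by blast
        have "eventually (\<lambda>n. \<bar>indicator C x - max 0 (1 - real n * infdist x C)\<bar> = (0::real)) sequentially"
          using eventually_ge_at_top[of N]
        proof eventually_elim
          case (elim n)
          then have "1 / infdist x C < real n" using N by linarith
          then have "1 < real n * infdist x C" using p by (simp add: field_simps)
          then show ?case using False by simp
        qed
        then show ?thesis by (simp add: tendsto_eventually)
      qed auto
    qed
    show "(\<lambda>x. \<bar>indicator C x - max 0 (1 - real i * infdist x C)\<bar>) \<in> borel_measurable M" for i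
      using C by (intro meas borel_measurable_abs borel_measurable_diff borel_measurable_indicator
            borel_measurable_continuous_onI continuous_intros) auto
  qed (auto simp: indicator_def infdist_nonneg intro!: AE_I2 split: split_max)
  then show ?thesis by simp
qed

text \<open>
  Dynkin's argument: the property holds for closed sets, by continuous functions of the distance to
  the set, and passes to complements and countable disjoint unions. Two measures are treated at once
  since the approximation is used simultaneously for \<open>\<mu>\<close> and for the first marginal
  of a limit plan.
\<close>

lemma continuous_approx_indicator:
  fixes M N :: "'a::metric_space measure"
  assumes M: "finite_measure M" "sets M = sets (borel_on X)"
    and N: "finite_measure N" "sets N = sets (borel_on X)"
    and A: "A \<in> sets borel" and e: "e > 0"
  shows "\<exists>f. continuous_on UNIV f \<and> (\<forall>x. 0 \<le> f x \<and> f x \<le> 1) \<and>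
    (\<integral>x. \<bar>indicator A x - f x\<bar> \<partial>M) < e \<and> (\<integral>x. \<bar>indicator A x - f x\<bar> \<partial>N) < (e::real)"
proof -
  interpret M: finite_measure M by fact
  interpret N: finite_measure N by fact
  have measM: "h \<in> borel_measurable M" if "h \<in> borel_measurable borel" for h :: "'a \<Rightarrow> real"
    using measurable_restrict_space1[OF that, of X] M(2) measurable_cong_sets by blast
  have measN: "h \<in> borel_measurable N" if "h \<in> borel_measurable borel" for h :: "'a \<Rightarrow> real"
    using measurable_restrict_space1[OF that, of X] N(2) measurable_cong_sets by blast
  define P where "P A \<longleftrightarrow> A \<in> sets borel \<and> (\<forall>e>0. \<exists>f. continuous_on UNIV f \<and> (\<forall>x. 0 \<le> f x \<and> f x \<le> 1) \<and>
    (\<integral>x. \<bar>indicator A x - f x\<bar> \<partial>M) < e \<and> (\<integral>x. \<bar>indicator A x - f x\<bar> \<partial>N) < (e::real))" for A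
  have Istab: "Int_stable (Collect (closed :: 'a set \<Rightarrow> bool))" by (auto simp: Int_stable_def)
  have pow: "Collect (closed :: 'a set \<Rightarrow> bool) \<subseteq> Pow UNIV" by simp
  have "A \<in> sigma_sets UNIV (Collect closed)"
    using A unfolding borel_eq_closed by simp
  then have "P A"
  proof (induction rule: sigma_sets_induct_disjoint[OF Istab pow, consumes 1, case_names basic empty compl union])
    case (basic C)
    then have C: "closed C" by simp
    show ?case
    proof (cases "C = {}")
      case True
      then show ?thesis unfolding P_def by (auto intro!: exI[of _ "\<lambda>_. 0"])
    next
      case False
      show ?thesis unfolding P_def
      proof (intro conjI allI impI)
        fix e :: real assume e: "e > 0"
        have "eventually (\<lambda>n. (\<integral>x. \<bar>indicator C x - max 0 (1 - real n * infdist x C)\<bar> \<partial>M) < e \<and>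
          (\<integral>x. \<bar>indicator C x - max 0 (1 - real n * infdist x C)\<bar> \<partial>N) < e) sequentially"
          using order_tendstoD(2)[OF continuous_approx_closed[OF M C False] e]
                order_tendstoD(2)[OF continuous_approx_closed[OF N C False] e]
          by eventually_elim auto
        then obtain n where "(\<integral>x. \<bar>indicator C x - max 0 (1 - real n * infdist x C)\<bar> \<partial>M) < e"
          "(\<integral>x. \<bar>indicator C x - max 0 (1 - real n * infdist x C)\<bar> \<partial>N) < e"
          by (auto simp: eventually_sequentially)
        then show "\<exists>f. continuous_on UNIV f \<and> (\<forall>x. 0 \<le> f x \<and> f x \<le> 1) \<and>
          (\<integral>x. \<bar>indicator C x - f x\<bar> \<partial>M) < e \<and> (\<integral>x. \<bar>indicator C x - f x\<bar> \<partial>N) < e"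
          by (intro exI[of _ "\<lambda>x. max 0 (1 - real n * infdist x C)"])
             (auto intro!: continuous_intros simp: infdist_nonneg)
      qed (use C in auto)
    qed
  next
    case empty
    then show ?case unfolding P_def by (auto intro!: exI[of _ "\<lambda>_. 0"])
  next
    case (compl A)
    show ?case unfolding P_def
    proof (intro conjI allI impI)
      fix e :: real assume "e > 0"
      then obtain f where f: "continuous_on UNIV f" "\<forall>x. 0 \<le> f x \<and> f x \<le> 1"
        "(\<integral>x. \<bar>indicator A x - f x\<bar> \<partial>M) < e" "(\<integral>x. \<bar>indicator A x - f x\<bar> \<partial>N) < e"
        using compl unfolding P_def by metis
      have "\<bar>indicator (UNIV - A) x - (1 - f x)\<bar> = \<bar>indicator A x - f x\<bar>" for x
        by (cases "x \<in> A") (simp_all add: abs_minus_commute)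
      then show "\<exists>f. continuous_on UNIV f \<and> (\<forall>x. 0 \<le> f x \<and> f x \<le> 1) \<and>
          (\<integral>x. \<bar>indicator (UNIV - A) x - f x\<bar> \<partial>M) < e \<and> (\<integral>x. \<bar>indicator (UNIV - A) x - f x\<bar> \<partial>N) < e"
        using f by (intro exI[of _ "\<lambda>x. 1 - f x"]) (auto intro!: continuous_intros)
    qed (use compl in \<open>auto simp: P_def\<close>)
  next
    case (union A)
    then have PA: "P (A i)" and sA[measurable]: "A i \<in> sets borel" for i by (auto simp: P_def)
    show ?case unfolding P_def
    proof (intro conjI allI impI)
      fix e :: real assume e: "e > 0"
      define U where "U n = (\<Union>i<n. A i)" for n
      have sU[measurable]: "U n \<in> sets borel" for n by (auto simp: U_def)
      have lim: "(\<lambda>n. \<integral>x. \<bar>indicator (\<Union>i. A i) x - indicator (U n) x\<bar> \<partial>K) \<longlonglongrightarrow> (0::real)"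
        if K: "finite_measure K" and mK: "\<And>h :: 'a \<Rightarrow> real. h \<in> borel_measurable borel \<Longrightarrow> h \<in> borel_measurable K" for K
      proof -
        interpret K: finite_measure K by fact
        have "(\<lambda>n. \<integral>x. \<bar>indicator (\<Union>i. A i) x - indicator (U n) x\<bar> \<partial>K) \<longlonglongrightarrow> (\<integral>x. (0::real) \<partial>K)"
        proof (rule integral_dominated_convergence[where w="\<lambda>_. 1"])
          show "AE x in K. (\<lambda>n. \<bar>indicator (\<Union>i. A i) x - indicator (U n) x\<bar>) \<longlonglongrightarrow> (0::real)"
          proof (rule AE_I2)
            fix x
            have "(\<lambda>n. indicator (U n) x) \<longlonglongrightarrow> (indicator (\<Union>i. A i) x :: real)"
              unfolding U_def by (rule LIMSEQ_indicator_UN)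
            then have "(\<lambda>n. \<bar>indicator (\<Union>i. A i) x - indicator (U n) x\<bar>) \<longlonglongrightarrow> \<bar>indicator (\<Union>i. A i) x - indicator (\<Union>i. A i) x :: real\<bar>"
              by (intro tendsto_intros)
            then show "(\<lambda>n. \<bar>indicator (\<Union>i. A i) x - indicator (U n) x\<bar>) \<longlonglongrightarrow> (0::real)" by simp
          qed
        qed (auto simp: indicator_def intro!: AE_I2 mK)
        then show ?thesis by simp
      qed
      have "eventually (\<lambda>n. (\<integral>x. \<bar>indicator (\<Union>i. A i) x - indicator (U n) x\<bar> \<partial>M) < e / 2 \<and>
           (\<integral>x. \<bar>indicator (\<Union>i. A i) x - indicator (U n) x\<bar> \<partial>N) < e / 2) sequentially"
        using order_tendstoD(2)[OF lim[OF M(1) measM] half_gt_zero[OF e]]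
              order_tendstoD(2)[OF lim[OF N(1) measN] half_gt_zero[OF e]]
        by (auto elim: eventually_elim2)
      then obtain n where n: "(\<integral>x. \<bar>indicator (\<Union>i. A i) x - indicator (U n) x\<bar> \<partial>M) < e / 2"
           "(\<integral>x. \<bar>indicator (\<Union>i. A i) x - indicator (U n) x\<bar> \<partial>N) < e / 2"
        by (auto simp: eventually_sequentially)
      define d where "d = e / (2 * (real n + 1))"
      have "d > 0" using e by (simp add: d_def)
      have "\<exists>f. continuous_on UNIV f \<and> (\<forall>x. 0 \<le> f x \<and> f x \<le> 1) \<and>
          (\<integral>x. \<bar>indicator (A i) x - f x\<bar> \<partial>M) < d \<and> (\<integral>x. \<bar>indicator (A i) x - f x\<bar> \<partial>N) < d" for i
        using PA[of i] \<open>d > 0\<close> unfolding P_def by blast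
      then have "\<exists>f. \<forall>i. continuous_on UNIV (f i) \<and> (\<forall>x. 0 \<le> f i x \<and> f i x \<le> 1) \<and>
          (\<integral>x. \<bar>indicator (A i) x - f i x\<bar> \<partial>M) < d \<and> (\<integral>x. \<bar>indicator (A i) x - f i x\<bar> \<partial>N) < d"
        by (intro choice allI)
      then obtain f where f: "\<And>i. continuous_on UNIV (f i)" "\<And>i x. 0 \<le> f i x" "\<And>i x. f i x \<le> 1"
          "\<And>i. (\<integral>x. \<bar>indicator (A i) x - f i x\<bar> \<partial>M) < d" "\<And>i. (\<integral>x. \<bar>indicator (A i) x - f i x\<bar> \<partial>N) < d"
        by blast
      define g where "g x = min 1 (\<Sum>i<n. f i x)" for x
      have gc: "continuous_on UNIV g" unfolding g_def by (intro continuous_intros f)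
      have g01: "0 \<le> g x" "g x \<le> 1" for x using f by (auto simp: g_def intro!: sum_nonneg)
      have fb[measurable]: "f i \<in> borel_measurable borel" for i using f(1) by (rule borel_measurable_continuous_onI)
      have gb[measurable]: "g \<in> borel_measurable borel" using gc by (rule borel_measurable_continuous_onI)
      have pw: "\<bar>indicator (\<Union>i. A i) x - g x\<bar> \<le> \<bar>indicator (\<Union>i. A i) x - indicator (U n) x\<bar> + (\<Sum>i<n. \<bar>indicator (A i) x - f i x\<bar>)" for x
      proof -
        have "indicator (U n) x = min 1 (\<Sum>i<n. indicator (A i) x :: real)"
        proof (cases "x \<in> U n")
          case True
          then obtain i where i: "i < n" "x \<in> A i" by (auto simp: U_def)
          have "indicator (A i) x \<le> (\<Sum>i<n. indicator (A i) x :: real)"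
            using i by (intro member_le_sum) auto
          then show ?thesis using True i by simp
        qed (auto simp: U_def)
        moreover have "\<bar>(\<Sum>i<n. indicator (A i) x) - (\<Sum>i<n. f i x)\<bar> \<le> (\<Sum>i<n. \<bar>indicator (A i) x - f i x\<bar>)"
          unfolding sum_subtractf[symmetric] by (rule sum_abs)
        ultimately show ?thesis unfolding g_def by linarith
      qed
      have bound: "(\<integral>x. \<bar>indicator (\<Union>i. A i) x - g x\<bar> \<partial>K) < e"
        if K: "finite_measure K" and mK: "\<And>h :: 'a \<Rightarrow> real. h \<in> borel_measurable borel \<Longrightarrow> h \<in> borel_measurable K"
          and a: "(\<integral>x. \<bar>indicator (\<Union>i. A i) x - indicator (U n) x\<bar> \<partial>K) < e / 2"
          and b: "\<And>i. (\<integral>x. \<bar>indicator (A i) x - f i x\<bar> \<partial>K) < d" for K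
      proof -
        interpret K: finite_measure K by fact
        have int1: "integrable K (\<lambda>x. \<bar>indicator (\<Union>i. A i) x - indicator (U n) x :: real\<bar>)"
          by (intro K.integrable_const_bound[where B=1] mK AE_I2) (auto simp: indicator_def)
        have int2: "integrable K (\<lambda>x. \<bar>indicator (A i) x - f i x\<bar>)" for i
          by (intro K.integrable_const_bound[where B=1] mK AE_I2)
             (use f in \<open>auto simp: indicator_def abs_le_iff\<close>, smt (verit) f(2), smt (verit) f(3))
        have int3: "integrable K (\<lambda>x. \<bar>indicator (\<Union>i. A i) x - g x\<bar>)"
          by (intro K.integrable_const_bound[where B=1] mK AE_I2)
             (use g01 in \<open>auto simp: indicator_def abs_le_iff\<close>, smt (verit) g01(1), smt (verit) g01(2))
        have "(\<integral>x. \<bar>indicator (\<Union>i. A i) x - g x\<bar> \<partial>K) \<le> (\<integral>x. \<bar>indicator (\<Union>i. A i) x - indicator (U n) x\<bar> + (\<Sum>i<n. \<bar>indicator (A i) x - f i x\<bar>) \<partial>K)"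
          using int1 int2 int3 pw by (intro integral_mono) auto
        also have "\<dots> = (\<integral>x. \<bar>indicator (\<Union>i. A i) x - indicator (U n) x\<bar> \<partial>K) + (\<Sum>i<n. (\<integral>x. \<bar>indicator (A i) x - f i x\<bar> \<partial>K))"
          using int1 int2 by (simp add: Bochner_Integration.integral_sum)
        also have "\<dots> < e / 2 + (\<Sum>i<n. d)"
          using a b by (intro add_less_le_mono sum_mono) (auto intro: less_imp_le)
        also have "\<dots> \<le> e" using e by (simp add: d_def field_simps)
        finally show ?thesis .
      qed
      show "\<exists>f. continuous_on UNIV f \<and> (\<forall>x. 0 \<le> f x \<and> f x \<le> 1) \<and>
          (\<integral>x. \<bar>indicator (\<Union>i. A i) x - f x\<bar> \<partial>M) < e \<and> (\<integral>x. \<bar>indicator (\<Union>i. A i) x - f x\<bar> \<partial>N) < e"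
        using gc g01 bound[OF M(1) measM n(1) f(4)] bound[OF N(1) measN n(2) f(5)] by blast
    qed auto
  qed
  then show ?thesis using e unfolding P_def by blast
qed

text \<open>
  Testing with continuous functions into \<open>[0, 1]\<close> suffices, because indicators are limits
  of such functions in the \<open>L\<^sup>1\<close> norms of both measures.
\<close>

lemma measure_le_of_continuous:
  fixes M N :: "'a::metric_space measure"
  assumes M: "finite_measure M" "sets M = sets (borel_on X)"
    and N: "finite_measure N" "sets N = sets (borel_on X)"
    and C: "0 \<le> C"
    and le: "\<And>f. continuous_on UNIV f \<Longrightarrow> (\<And>x. 0 \<le> f x) \<Longrightarrow> (\<And>x. f x \<le> 1) \<Longrightarrow>
      (\<integral>x. f x \<partial>M) \<le> C * (\<integral>x. f x \<partial>N)"
    and A: "A \<in> sets M"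
  shows "measure M A \<le> C * measure N A"
proof (rule field_le_epsilon)
  fix e :: real assume e: "e > 0"
  interpret M: finite_measure M by fact
  interpret N: finite_measure N by fact
  have meas: "h \<in> borel_measurable M" "h \<in> borel_measurable N" if "h \<in> borel_measurable borel" for h :: "'a \<Rightarrow> real"
    using measurable_restrict_space1[OF that, of X] M(2) N(2) measurable_cong_sets by blast+
  obtain A' where A': "A' \<in> sets borel" "A = A' \<inter> X"
    using A unfolding M(2) by (auto simp: sets_restrict_space)
  have sp: "space M = X" "space N = X"
    using sets_eq_imp_space_eq[OF M(2)] sets_eq_imp_space_eq[OF N(2)] by (auto simp: space_restrict_space)
  define d where "d = e / (1 + C)"
  have d: "d > 0" using e C by (simp add: d_def)
  obtain f where f: "continuous_on UNIV f" "\<And>x. 0 \<le> f x" "\<And>x. f x \<le> 1"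
    "(\<integral>x. \<bar>indicator A' x - f x\<bar> \<partial>M) < d" "(\<integral>x. \<bar>indicator A' x - f x\<bar> \<partial>N) < d"
    using continuous_approx_indicator[OF M N A'(1) d] by metis
  have fb: "f \<in> borel_measurable borel" using f(1) by (rule borel_measurable_continuous_onI)
  have i: "integrable M f" "integrable N f" "integrable M (indicator A' :: 'a \<Rightarrow> real)" "integrable N (indicator A' :: 'a \<Rightarrow> real)"
    using A' fb f
    by (auto intro!: M.integrable_const_bound[where B=1] N.integrable_const_bound[where B=1] AE_I2 meas simp: indicator_def)
  have mA: "(\<integral>x. indicator A' x \<partial>M) = measure M A" "(\<integral>x. indicator A' x \<partial>N) = measure N A"
    using A' by (simp_all add: sp)
  have "measure M A - (\<integral>x. f x \<partial>M) = (\<integral>x. indicator A' x - f x \<partial>M)"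
    using i mA by simp
  also have "\<dots> \<le> (\<integral>x. \<bar>indicator A' x - f x\<bar> \<partial>M)" using i by (intro integral_mono) auto
  finally have 1: "measure M A \<le> (\<integral>x. f x \<partial>M) + d" using f by simp
  have "(\<integral>x. f x \<partial>N) - measure N A = (\<integral>x. f x - indicator A' x \<partial>N)"
    using i mA by simp
  also have "\<dots> \<le> (\<integral>x. \<bar>indicator A' x - f x\<bar> \<partial>N)" using i by (intro integral_mono) auto
  finally have 2: "(\<integral>x. f x \<partial>N) \<le> measure N A + d" using f by simp
  have "measure M A \<le> C * (\<integral>x. f x \<partial>N) + d" using 1 le[OF f(1-3)] by simp
  also have "\<dots> \<le> C * (measure N A + d) + d" using 2 C by (intro add_right_mono mult_left_mono) auto
  also have "\<dots> = C * measure N A + d * (1 + C)" by (simp add: algebra_simps)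
  also have "d * (1 + C) = e" using C by (simp add: d_def)
  finally show "measure M A \<le> C * measure N A + e" .
qed

section \<open>Disintegration over the first coordinate\<close>

text \<open>
  Reading base-4 digits: \<open>1/4 \<le> digit_rest n t\<close> is the digit number \<open>n\<close>
  of \<open>t\<close> when all digits are \<open>0\<close> or \<open>1\<close>.
\<close>

primrec digit_rest :: "nat \<Rightarrow> real \<Rightarrow> real" where
  "digit_rest 0 t = t"
| "digit_rest (Suc n) t = 4 * digit_rest n t - (if 1/4 \<le> digit_rest n t then 1 else 0)"

text \<open>
  In base \<open>4\<close> with digits \<open>0\<close> and \<open>1\<close> the digits after a given
  one contribute at most a third of its unit. So the expansion is unique and each digit can be read
  off by comparing with \<open>1/4\<close>.
\<close>

definition encode_bits :: "(nat \<Rightarrow> bool) \<Rightarrow> real" where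
  "encode_bits b = (\<Sum>n. of_bool (b n) / 4 ^ Suc n)"

lemma summable_encode_bits: "summable (\<lambda>n. of_bool (b n) / 4 ^ Suc n :: real)"
proof (rule summable_comparison_test'[of "\<lambda>n. (1/4) ^ n" 0])
  show "summable (\<lambda>n. (1/4::real) ^ n)" by (rule summable_geometric) simp
  show "norm (of_bool (b n) / 4 ^ Suc n :: real) \<le> (1/4) ^ n" if "0 \<le> n" for n
    by (auto simp: of_bool_def power_one_over divide_simps)
qed

lemma encode_bits_split: "encode_bits b = of_bool (b 0) / 4 + encode_bits (\<lambda>n. b (Suc n)) / 4"
proof -
  have "(\<Sum>n. of_bool (b (Suc n)) / 4 ^ Suc (Suc n) :: real) = encode_bits b - of_bool (b 0) / 4"
    unfolding encode_bits_def using suminf_split_head[OF summable_encode_bits[of b]] by simp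
  moreover have "(\<Sum>n. of_bool (b (Suc n)) / 4 ^ Suc (Suc n) :: real) = encode_bits (\<lambda>n. b (Suc n)) / 4"
    unfolding encode_bits_def using suminf_divide[OF summable_encode_bits[of "\<lambda>n. b (Suc n)"], of 4]
    by (simp add: field_simps)
  ultimately show ?thesis by linarith
qed

lemma encode_bits_bounds: "0 \<le> encode_bits b" "encode_bits b \<le> 1/3"
proof -
  show "0 \<le> encode_bits b" unfolding encode_bits_def by (intro suminf_nonneg summable_encode_bits) auto
  have "(\<lambda>n. (1/4) * (1/4::real) ^ n) sums ((1/4) * (1 / (1 - 1/4)))"
    by (intro sums_mult geometric_sums) simp
  then have s: "(\<lambda>n. 1 / 4 ^ Suc n) sums (1/3 :: real)" by (simp add: power_one_over)
  then have "encode_bits b \<le> (\<Sum>n. 1 / 4 ^ Suc n)"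
    unfolding encode_bits_def by (intro suminf_le summable_encode_bits) (auto simp: sums_iff divide_right_mono)
  then show "encode_bits b \<le> 1/3" using s by (simp add: sums_iff)
qed

lemma digit_rest_encode_bits: "digit_rest n (encode_bits b) = encode_bits (\<lambda>k. b (n + k))"
proof (induction n)
  case (Suc n)
  let ?b = "\<lambda>k. b (n + k)"
  have s: "encode_bits ?b = of_bool (b n) / 4 + encode_bits (\<lambda>k. b (n + Suc k)) / 4"
    using encode_bits_split[of ?b] by simp
  have "1/4 \<le> encode_bits ?b \<longleftrightarrow> b n"
    using s encode_bits_bounds[of "\<lambda>k. b (n + Suc k)"] by auto
  then show ?case using Suc s by auto
qed simp

lemma bit_encode_bits: "1/4 \<le> digit_rest n (encode_bits b) \<longleftrightarrow> b n"
proof -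
  have "digit_rest n (encode_bits b) = of_bool (b n) / 4 + encode_bits (\<lambda>k. b (n + Suc k)) / 4"
    using encode_bits_split[of "\<lambda>k. b (n + k)"] by (simp add: digit_rest_encode_bits)
  then show ?thesis using encode_bits_bounds[of "\<lambda>k. b (n + Suc k)"] by auto
qed

lemma digit_rest_measurable [measurable]: "digit_rest n \<in> borel_measurable borel"
  by (induction n) simp_all

text \<open>
  A point is determined by the bits telling which balls of radius \<open>1 / (k + 1)\<close> around
  the points of a dense sequence contain it. The decoder reads, for every \<open>k\<close>, the
  first centre whose bit is set and takes the limit over \<open>k\<close>.
\<close>

lemma borel_encoding:
  obtains \<sigma> :: "'a::{banach, second_countable_topology} \<Rightarrow> real" and h
  where "\<sigma> \<in> borel_measurable borel" "h \<in> borel_measurable borel"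
    "\<And>y. h (\<sigma> y) = y" "\<And>y. 0 \<le> \<sigma> y" "\<And>y. \<sigma> y \<le> 1"
proof -
  obtain D :: "'a set" where D: "countable D" "\<And>W. open W \<Longrightarrow> W \<noteq> {} \<Longrightarrow> \<exists>d\<in>D. d \<in> W"
    using countable_dense_exists by blast
  have "D \<noteq> {}" using D(2)[of UNIV] by auto
  define d where "d = from_nat_into D"
  have d: "\<exists>n. dist y (d n) < e" if "0 < e" for y e
  proof -
    have "ball y e \<noteq> {}" using that by simp
    then obtain x where "x \<in> D" "x \<in> ball y e" using D(2)[OF open_ball] by blast
    then show ?thesis using from_nat_into_surj[OF D(1), of x] by (auto simp: d_def)
  qed
  define b where "b y m = (dist y (d (snd (prod_decode m))) < 1 / real (Suc (fst (prod_decode m))))" for y m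
  define \<sigma> where "\<sigma> y = encode_bits (b y)" for y
  define idx where "idx k t = (LEAST n. 1/4 \<le> digit_rest (prod_encode (k, n)) t)" for k t
  define h where "h t = lim (\<lambda>k. d (idx k t))" for t
  show thesis
  proof (rule that[of \<sigma> h])
    have [measurable]: "Measurable.pred borel (\<lambda>y. b y m)" for m unfolding b_def by measurable
    have "(\<lambda>y. of_bool (b y n) :: real) \<in> borel_measurable borel" for n
      unfolding of_bool_def by measurable
    then show "\<sigma> \<in> borel_measurable borel"
      unfolding \<sigma>_def encode_bits_def by measurable
    have [measurable]: "idx k \<in> borel \<rightarrow>\<^sub>M count_space UNIV" for k
      unfolding idx_def by measurable
    have [measurable]: "(\<lambda>t. d (idx k t)) \<in> borel_measurable borel" for k
      by (rule measurable_compose[of "idx k" _ "count_space UNIV"]) auto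
    show "h \<in> borel_measurable borel" unfolding h_def by measurable
    show "0 \<le> \<sigma> y" "\<sigma> y \<le> 1" for y using encode_bits_bounds[of "b y"] by (auto simp: \<sigma>_def)
    show "h (\<sigma> y) = y" for y
    proof -
      have near: "dist y (d (idx k (\<sigma> y))) < 1 / real (Suc k)" for k
      proof -
        have eq: "1/4 \<le> digit_rest (prod_encode (k, n)) (\<sigma> y) \<longleftrightarrow> dist y (d n) < 1 / real (Suc k)" for n
          unfolding \<sigma>_def bit_encode_bits by (simp add: b_def)
        obtain n where "dist y (d n) < 1 / real (Suc k)" using d by fastforce
        then show ?thesis unfolding idx_def eq by (rule LeastI)
      qed
      have "(\<lambda>k. d (idx k (\<sigma> y))) \<longlonglongrightarrow> y"
        unfolding tendsto_iff
      proof (intro allI impI)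
        fix e :: real assume "0 < e"
        then obtain k where k: "1 / real (Suc k) < e" using nat_approx_posE by blast
        show "eventually (\<lambda>k. dist (d (idx k (\<sigma> y))) y < e) sequentially"
          using eventually_ge_at_top[of k]
        proof eventually_elim
          case (elim l)
          then have "1 / real (Suc l) \<le> 1 / real (Suc k)" by (simp add: frac_le)
          then show ?case using near[of l] k by (simp add: dist_commute)
        qed
      qed
      then show ?thesis unfolding h_def by (rule limI)
    qed
  qed
qed

lemma AE_le_of_set_nn_integral_le:
  assumes [measurable]: "f \<in> borel_measurable M" "g \<in> borel_measurable M"
    and fin: "(\<integral>\<^sup>+x. g x \<partial>M) \<noteq> \<infinity>"
    and le: "\<And>A. A \<in> sets M \<Longrightarrow> (\<integral>\<^sup>+x\<in>A. f x \<partial>M) \<le> (\<integral>\<^sup>+x\<in>A. g x \<partial>M)"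
  shows "AE x in M. f x \<le> g x"
proof (rule ccontr)
  assume not: "\<not> (AE x in M. f x \<le> g x)"
  define A where "A = {x \<in> space M. g x < f x}"
  have [measurable]: "A \<in> sets M" unfolding A_def by measurable
  have "(\<integral>\<^sup>+x\<in>A. g x \<partial>M) < (\<integral>\<^sup>+x\<in>A. f x \<partial>M)"
  proof (rule nn_integral_less)
    have "(\<integral>\<^sup>+x\<in>A. g x \<partial>M) \<le> (\<integral>\<^sup>+x. g x \<partial>M)"
      by (intro nn_integral_mono) (auto simp: indicator_def)
    then show "(\<integral>\<^sup>+x\<in>A. g x \<partial>M) \<noteq> \<infinity>" using fin by (auto simp: top_unique)
    show "AE x in M. g x * indicator A x \<le> f x * indicator A x"
      by (intro AE_I2) (auto simp: A_def indicator_def)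
    show "\<not> (AE x in M. f x * indicator A x \<le> g x * indicator A x)"
    proof
      assume "AE x in M. f x * indicator A x \<le> g x * indicator A x"
      with AE_space have "AE x in M. f x \<le> g x"
      proof eventually_elim
        case (elim x)
        then show ?case by (cases "g x < f x") (auto simp: A_def)
      qed
      with not show False by simp
    qed
  qed measurable
  with le[of A] show False by simp
qed

lemma emeasure_distr_density_indicator:
  assumes g[measurable]: "g \<in> N \<rightarrow>\<^sub>M K" and f[measurable]: "f \<in> N \<rightarrow>\<^sub>M L"
    and A[measurable]: "A \<in> sets K" and B[measurable]: "B \<in> sets L"
  shows "emeasure (distr (density N (\<lambda>z. indicator A (g z))) L f) B =
    emeasure N {z\<in>space N. g z \<in> A \<and> f z \<in> B}"
proof -
  have fB: "f -` B \<inter> space N \<in> sets N" using f B by (rule measurable_sets)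
  have "emeasure (distr (density N (\<lambda>z. indicator A (g z))) L f) B =
     (\<integral>\<^sup>+z. indicator A (g z) * indicator (f -` B \<inter> space N) z \<partial>N)"
    using fB by (subst emeasure_distr) (auto simp: emeasure_density)
  also have "\<dots> = (\<integral>\<^sup>+z. indicator {z\<in>space N. g z \<in> A \<and> f z \<in> B} z \<partial>N)"
    by (intro nn_integral_cong) (auto simp: indicator_def)
  also have "\<dots> = emeasure N {z\<in>space N. g z \<in> A \<and> f z \<in> B}"
    by (rule nn_integral_indicator) measurable
  finally show ?thesis .
qed

text \<open>
  \<open>G x\<close> is the conditional probability of \<open>E\<close> given the first coordinate,
  obtained as a Radon-Nikodym density.
\<close>

lemma conditional_expectation_on_fst:
  assumes p: "finite_measure p" "sets p = sets (borel_on (X \<times> Y))" and E: "E \<in> sets p"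
  shows "\<exists>G\<in>borel_measurable (marginal1 X p). \<forall>A\<in>sets (borel_on X).
    (\<integral>\<^sup>+x\<in>A. G x \<partial>marginal1 X p) = emeasure p {z\<in>E. fst z \<in> A}"
proof -
  interpret p: finite_measure p by fact
  have sp: "space p = X \<times> Y" using sets_eq_imp_space_eq[OF p(2)] by (simp add: space_restrict_space)
  have fst[measurable]: "fst \<in> p \<rightarrow>\<^sub>M borel_on X"
    using fst_measurable_borel_on measurable_cong_sets[OF p(2) refl] by blast
  let ?m = "marginal1 X p"
  interpret m: finite_measure ?m unfolding marginal1_def by (rule p.finite_measure_distr) measurable
  have sm[measurable_cong]: "sets ?m = sets (borel_on X)" by (simp add: marginal1_def)
  define q where "q = distr (density p (indicator E)) (borel_on X) fst"
  have q: "emeasure q A = emeasure p {z\<in>E. fst z \<in> A}" if A: "A \<in> sets (borel_on X)" for A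
  proof -
    have [measurable]: "A \<in> sets (borel_on X)" "E \<in> sets p" using A E by auto
    have fA: "fst -` A \<inter> space p \<in> sets p" using measurable_sets[OF fst A] .
    have "emeasure q A = emeasure (density p (indicator E)) (fst -` A \<inter> space p)"
      unfolding q_def by (subst emeasure_distr) (auto simp: measurable_cong_sets[OF sets_density refl] fst A)
    also have "\<dots> = emeasure p (E \<inter> (fst -` A \<inter> space p))"
      using fA E by (simp add: emeasure_density nn_integral_indicator flip: indicator_inter_arith)
    also have "E \<inter> (fst -` A \<inter> space p) = {z\<in>E. fst z \<in> A}" using sets.sets_into_space[OF E] by auto
    finally show ?thesis .
  qed
  have "absolutely_continuous ?m q"
    unfolding absolutely_continuous_def
  proof
    fix A assume A: "A \<in> null_sets ?m"
    then have sA: "A \<in> sets (borel_on X)" by (auto simp: marginal1_def)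
    have "emeasure p {z\<in>E. fst z \<in> A} \<le> emeasure p (fst -` A \<inter> space p)"
      using sets.sets_into_space[OF E] measurable_sets[OF fst sA] by (intro emeasure_mono) auto
    also have "\<dots> = emeasure ?m A" unfolding marginal1_def using sA by (subst emeasure_distr) auto
    also have "\<dots> = 0" using A by auto
    finally show "A \<in> null_sets q" using q[OF sA] sA by (auto simp: q_def)
  qed
  then obtain G where G: "G \<in> borel_measurable ?m" "density ?m G = q"
    using m.Radon_Nikodym[of q] sm by (auto simp: q_def)
  have "(\<integral>\<^sup>+x\<in>A. G x \<partial>?m) = emeasure p {z\<in>E. fst z \<in> A}" if "A \<in> sets (borel_on X)" for A
  proof -
    have "emeasure (density ?m G) A = (\<integral>\<^sup>+x\<in>A. G x \<partial>?m)"
      using that G(1) by (intro emeasure_density) (auto simp: sm)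
    then show ?thesis using q[OF that] G(2) by simp
  qed
  with G(1) show ?thesis by blast
qed

text \<open>
  Encode the second coordinate in \<open>[0, 1]\<close> by \<open>\<sigma>\<close> and realise the
  conditional law of the code through its quantile function \<open>Q x t\<close>, built from the
  conditional probabilities of \<open>{r \<le> \<sigma>}\<close> for rational \<open>r\<close>. As a
  supremum of countably many measurable functions \<open>Q\<close> is jointly measurable whichever
  versions of these conditional probabilities are chosen, and the kernel is the image of Lebesgue
  measure on \<open>[0, 1]\<close> under \<open>t \<mapsto> h (Q x t)\<close>.
\<close>

lemma disintegration_exists:
  fixes X :: "'x::metric_space set" and Y :: "'y::{banach, second_countable_topology} set"
  assumes X: "compact X" and Y: "Y \<in> sets borel" and p: "p \<in> borel_probs (X \<times> Y)"
  shows "\<exists>K. disintegration X Y p K"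
proof -
  have setp: "sets p = sets (borel_on (X \<times> Y))" and "prob_space p"
    using p by (auto simp: space_prob_algebra)
  interpret p: prob_space p by fact
  have spp: "space p = X \<times> Y" using sets_eq_imp_space_eq[OF setp] by (simp add: space_restrict_space)
  have setp': "sets p = sets (borel_on X \<Otimes>\<^sub>M borel_on Y)"
    using setp sets_borel_on_Times[OF X] by simp
  have fst_p[measurable]: "fst \<in> p \<rightarrow>\<^sub>M borel_on X" and snd_p[measurable]: "snd \<in> p \<rightarrow>\<^sub>M borel_on Y"
    using fst_measurable_borel_on snd_measurable_borel_on measurable_cong_sets[OF setp refl] by blast+
  have snd_p'[measurable]: "snd \<in> p \<rightarrow>\<^sub>M borel"
    using measurable_compose[OF snd_p, of "\<lambda>y. y" borel] by (simp add: measurable_restrict_space1)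
  obtain y0 where y0: "y0 \<in> Y" using p.not_empty spp by auto
  define m where "m = marginal1 X p"
  have setm[measurable_cong]: "sets m = sets (borel_on X)" by (simp add: m_def marginal1_def)
  interpret m: prob_space m unfolding m_def marginal1_def by (rule p.prob_space_distr) measurable
  have spm: "space m = X" using sets_eq_imp_space_eq[OF setm] by (simp add: space_restrict_space)
  have m_eq: "emeasure m A = emeasure p {z \<in> space p. fst z \<in> A}" if A: "A \<in> sets (borel_on X)" for A
    unfolding m_def marginal1_def using A by (subst emeasure_distr) (auto intro!: arg_cong[of _ _ "emeasure p"])
  obtain \<sigma> :: "'y \<Rightarrow> real" and h where sg[measurable]: "\<sigma> \<in> borel_measurable borel" and h[measurable]: "h \<in> borel_measurable borel"
    and hs: "\<And>y. h (\<sigma> y) = y" and s01: "\<And>y. 0 \<le> \<sigma> y" "\<And>y. \<sigma> y \<le> 1"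
    using borel_encoding by metis
  define hY where "hY v = (if h v \<in> Y then h v else y0)" for v
  have [measurable]: "hY \<in> borel \<rightarrow>\<^sub>M borel_on Y"
    using Y y0 unfolding hY_def by (intro measurable_restrict_space2) auto
  define r where "r = from_nat_into (\<rat> \<inter> {0..1::real})"
  have Qne: "\<rat> \<inter> {0..1::real} \<noteq> {}" and Qc: "countable (\<rat> \<inter> {0..1::real})"
    using countable_rat by (auto intro: Rats_0)
  have r01: "0 \<le> r n" "r n \<le> 1" for n using from_nat_into[OF Qne, of n] by (auto simp: r_def)
  have r_dense: "\<exists>n. s < r n \<and> r n \<le> s'" if "0 \<le> s" "s < s'" "s' \<le> 1" for s s'
  proof -
    obtain q where "q \<in> \<rat>" "s < q" "q < s'" using Rats_dense_in_real \<open>s < s'\<close> by blast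
    then show ?thesis using that from_nat_into_surj[OF Qc, of q] by (force simp: r_def)
  qed
  define E where "E n = {z \<in> space p. r n \<le> \<sigma> (snd z)}" for n
  define E' where "E' s = {z \<in> space p. s < \<sigma> (snd z)}" for s
  have E[measurable]: "E n \<in> sets p" "E' s \<in> sets p" for n s unfolding E_def E'_def by measurable
  have "\<exists>G. \<forall>n. G n \<in> borel_measurable m \<and> (\<forall>A\<in>sets (borel_on X).
    (\<integral>\<^sup>+x\<in>A. G n x \<partial>m) = emeasure p {z\<in>E n. fst z \<in> A})"
    using conditional_expectation_on_fst[OF p.finite_measure_axioms setp E(1)] unfolding m_def
    by (intro choice allI) blast
  then obtain G where G[measurable]: "\<And>n. G n \<in> borel_measurable m"
    and GE: "\<And>n A. A \<in> sets (borel_on X) \<Longrightarrow> (\<integral>\<^sup>+x\<in>A. G n x \<partial>m) = emeasure p {z\<in>E n. fst z \<in> A}"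
    by blast
  have meas_sub: "{z\<in>B. fst z \<in> A} \<in> sets p" if "A \<in> sets (borel_on X)" "B \<in> sets p" for A B
  proof -
    have "{z\<in>B. fst z \<in> A} = B \<inter> (fst -` A \<inter> space p)" using sets.sets_into_space[OF that(2)] by auto
    then show ?thesis using measurable_sets[OF fst_p that(1)] that(2) by simp
  qed
  have G1: "AE x in m. G n x \<le> 1" for n
  proof (rule AE_le_of_set_nn_integral_le)
    fix A assume A: "A \<in> sets m"
    then have "(\<integral>\<^sup>+x\<in>A. G n x \<partial>m) = emeasure p {z\<in>E n. fst z \<in> A}" using GE setm by simp
    also have "\<dots> \<le> emeasure p {z\<in>space p. fst z \<in> A}"
      using A setm by (intro emeasure_mono meas_sub) (auto simp: E_def)
    also have "\<dots> = (\<integral>\<^sup>+x\<in>A. 1 \<partial>m)" using A m_eq setm by simp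
    finally show "(\<integral>\<^sup>+x\<in>A. G n x \<partial>m) \<le> (\<integral>\<^sup>+x\<in>A. 1 \<partial>m)" .
  qed (use m.emeasure_space_1 in auto)
  define g where "g n x = enn2real (min 1 (G n x))" for n x
  have g_meas[measurable]: "g n \<in> borel_measurable m" for n unfolding g_def by measurable
  have gmin: "ennreal (g n x) = min 1 (G n x)" for n x
    unfolding g_def by (intro ennreal_enn2real) (simp add: min_less_iff_disj)
  have g0: "0 \<le> g n x" for n x by (simp add: g_def)
  have g1: "g n x \<le> 1" for n x
  proof -
    have "ennreal (g n x) \<le> ennreal 1" by (simp add: gmin)
    then show ?thesis using ennreal_le_iff[of 1 "g n x"] by simp
  qed
  define Q where "Q x t = (SUP n. if t \<le> g n x then r n else 0)" for x t
  have bdd: "bdd_above (range (\<lambda>n. if t \<le> g n x then r n else 0))" for t x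
    using r01 by (intro bdd_aboveI[of _ 1]) auto
  have Q_less: "s < Q x t \<longleftrightarrow> (\<exists>n. s < r n \<and> t \<le> g n x)" if "0 \<le> s" for s x t
    unfolding Q_def using that by (subst less_cSUP_iff[OF _ bdd]) (auto split: if_splits)
  have Q01: "0 \<le> Q x t" "Q x t \<le> 1" for x t
  proof -
    show "0 \<le> Q x t" unfolding Q_def by (rule cSUP_upper2[OF bdd, of _ 0]) (use r01 in auto)
    show "Q x t \<le> 1" unfolding Q_def by (rule cSUP_least) (use r01 in auto)
  qed
  define U where "U = density lborel (indicator {0..1::real})"
  have setU[measurable_cong]: "sets U = sets borel" by (simp add: U_def)
  have U: "emeasure U A = emeasure lborel (A \<inter> {0..1})" if "A \<in> sets borel" for A
    unfolding U_def using that by (simp add: emeasure_density nn_integral_indicator Int_commute flip: indicator_inter_arith)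
  interpret U: prob_space U
    by (rule prob_spaceI) (subst U, auto simp: U_def)
  have Q_meas[measurable]: "(\<lambda>z. Q (fst z) (snd z)) \<in> borel_measurable (m \<Otimes>\<^sub>M U)"
    unfolding Q_def by (rule borel_measurable_cSUP[OF _ _ bdd]) measurable
  interpret mU: pair_prob_space m U ..
  (* For fixed A, the laws of the quantile and of the true code on the part of the space over A. *)
  define MA where "MA A = distr (density (m \<Otimes>\<^sub>M U) (\<lambda>z. indicator A (fst z))) borel (\<lambda>z. Q (fst z) (snd z))" for A
  define NA where "NA A = distr (density p (\<lambda>z. indicator A (fst z))) borel (\<lambda>z. \<sigma> (snd z))" for A
  have MA_eq: "emeasure (MA A) B = emeasure (m \<Otimes>\<^sub>M U) {z\<in>space (m \<Otimes>\<^sub>M U). fst z \<in> A \<and> Q (fst z) (snd z) \<in> B}"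
    if [measurable]: "A \<in> sets (borel_on X)" "B \<in> sets borel" for A B
    unfolding MA_def by (rule emeasure_distr_density_indicator) measurable
  have NA_eq: "emeasure (NA A) B = emeasure p {z\<in>space p. fst z \<in> A \<and> \<sigma> (snd z) \<in> B}"
    if [measurable]: "A \<in> sets (borel_on X)" "B \<in> sets borel" for A B
    unfolding NA_def by (rule emeasure_distr_density_indicator) measurable
  have MNA: "MA A = NA A" if A: "A \<in> sets (borel_on X)" for A
  proof (rule measure_eqI_lessThan)
    fix s :: real
    note [measurable] = A
    show "emeasure (MA A) {s<..} < \<infinity>" unfolding MA_eq[OF A borel_open[OF open_greaterThan]]
      using mU.P.emeasure_finite by (simp add: less_top[symmetric])
    show "emeasure (MA A) {s<..} = emeasure (NA A) {s<..}"
    proof (cases "0 \<le> s")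
      case False
      have s: "s < Q x t" "s < \<sigma> y" for x t y using False Q01(1)[of x t] s01(1)[of y] by linarith+
      have "{z\<in>space (m \<Otimes>\<^sub>M U). fst z \<in> A \<and> Q (fst z) (snd z) \<in> {s<..}} = A \<times> UNIV"
        using s sets.sets_into_space[OF A] by (auto simp: space_pair_measure spm U_def space_restrict_space)
      then have "emeasure (MA A) {s<..} = emeasure (m \<Otimes>\<^sub>M U) (A \<times> UNIV)"
        unfolding MA_eq[OF A borel_open[OF open_greaterThan]] by simp
      also have "\<dots> = emeasure m A"
        using A setm U.emeasure_space_1 by (subst U.emeasure_pair_measure_Times) (auto simp: U_def)
      also have "\<dots> = emeasure (NA A) {s<..}"
        unfolding NA_eq[OF A borel_open[OF open_greaterThan]] m_eq[OF A] using s by simp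
      finally show ?thesis .
    next
      case True
      obtain G' where G'[measurable]: "G' \<in> borel_measurable m"
        and G'E: "\<And>A. A \<in> sets (borel_on X) \<Longrightarrow> (\<integral>\<^sup>+x\<in>A. G' x \<partial>m) = emeasure p {z\<in>E' s. fst z \<in> A}"
        using conditional_expectation_on_fst[OF p.finite_measure_axioms setp E(2)] unfolding m_def by blast
      have GG': "AE x in m. s < r n \<longrightarrow> G n x \<le> G' x" for n
      proof (cases "s < r n")
        case True
        have "AE x in m. G n x \<le> G' x"
        proof (rule AE_le_of_set_nn_integral_le)
          show "(\<integral>\<^sup>+x. G' x \<partial>m) \<noteq> \<infinity>"
          proof -
            have "X \<in> sets (borel_on X)" using sets.top[of m] setm spm by simp
            moreover have "(\<integral>\<^sup>+x. G' x \<partial>m) = (\<integral>\<^sup>+x\<in>X. G' x \<partial>m)"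
              by (intro nn_integral_cong) (simp add: spm)
            ultimately show ?thesis using G'E[of X] p.emeasure_finite by simp
          qed
          fix A assume "A \<in> sets m"
          then have A: "A \<in> sets (borel_on X)" using setm by simp
          show "(\<integral>\<^sup>+x\<in>A. G n x \<partial>m) \<le> (\<integral>\<^sup>+x\<in>A. G' x \<partial>m)"
            unfolding GE[OF A] G'E[OF A]
            using True by (intro emeasure_mono meas_sub A E) (auto simp: E_def E'_def)
        qed measurable
        then show ?thesis by simp
      qed simp
      have MAH: "emeasure (MA A) {s<..} = (\<integral>\<^sup>+x\<in>A. emeasure U {t. s < Q x t} \<partial>m)"
      proof -
        have [measurable]: "{z\<in>space (m \<Otimes>\<^sub>M U). fst z \<in> A \<and> Q (fst z) (snd z) \<in> {s<..}} \<in> sets (m \<Otimes>\<^sub>M U)"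
          by measurable
        have "emeasure (MA A) {s<..} = (\<integral>\<^sup>+x. emeasure U (Pair x -` {z\<in>space (m \<Otimes>\<^sub>M U). fst z \<in> A \<and> Q (fst z) (snd z) \<in> {s<..}}) \<partial>m)"
          unfolding MA_eq[OF A borel_open[OF open_greaterThan]] by (rule U.emeasure_pair_measure_alt) measurable
        also have "\<dots> = (\<integral>\<^sup>+x\<in>A. emeasure U {t. s < Q x t} \<partial>m)"
        proof (rule nn_integral_cong)
          fix x assume "x \<in> space m"
          then have "Pair x -` {z\<in>space (m \<Otimes>\<^sub>M U). fst z \<in> A \<and> Q (fst z) (snd z) \<in> {s<..}} = (if x \<in> A then {t. s < Q x t} else {})"
            by (auto simp: space_pair_measure U_def)
          then show "emeasure U (Pair x -` {z\<in>space (m \<Otimes>\<^sub>M U). fst z \<in> A \<and> Q (fst z) (snd z) \<in> {s<..}}) = emeasure U {t. s < Q x t} * indicator A x"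
            by simp
        qed
        finally show ?thesis .
      qed
      have setQ: "{t. s < Q x t} \<in> sets borel" for x
      proof -
        have "{t. s < Q x t} = (\<Union>n\<in>{n. s < r n}. {..g n x})" using Q_less[OF True] by auto
        then show ?thesis by auto
      qed
      (* Compare with the conditional probability G' of {s < \<sigma>}, which dominates the rational ones almost
         surely. *)
      have upper: "emeasure (MA A) {s<..} \<le> emeasure (NA A) {s<..}"
      proof -
        have "AE x in m. \<forall>n. s < r n \<longrightarrow> G n x \<le> G' x" using GG' by (simp add: AE_all_countable)
        then have "AE x in m. emeasure U {t. s < Q x t} \<le> G' x"
        proof eventually_elim
          case (elim x)
          show ?case
          proof (cases "G' x \<ge> 1")
            case True
            then show ?thesis using U.emeasure_le_1 order_trans by blast
          next
            case False
            then obtain c where c: "G' x = ennreal c" "0 \<le> c" "c < 1"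
              by (cases "G' x") auto
            have "{t. s < Q x t} \<inter> {0..1} \<subseteq> {0..c}"
            proof
              fix t assume "t \<in> {t. s < Q x t} \<inter> {0..1}"
              then obtain n where n: "s < r n" "t \<le> g n x" "0 \<le> t" using Q_less[OF \<open>0 \<le> s\<close>] by auto
              have "ennreal t \<le> ennreal (g n x)" using n by (intro ennreal_leI)
              also have "\<dots> \<le> G n x" by (simp add: gmin)
              also have "\<dots> \<le> ennreal c" using elim n c by auto
              finally show "t \<in> {0..c}" using n c by (simp add: ennreal_le_iff)
            qed
            then have "emeasure U {t. s < Q x t} \<le> emeasure lborel {0..c}"
              unfolding U[OF setQ] by (intro emeasure_mono) auto
            then show ?thesis using c by simp
          qed
        qed
        then have "emeasure (MA A) {s<..} \<le> (\<integral>\<^sup>+x\<in>A. G' x \<partial>m)"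
          unfolding MAH by (intro nn_integral_mono_AE, elim eventually_mono) (auto intro: mult_right_mono)
        also have "\<dots> = emeasure (NA A) {s<..}"
          unfolding G'E[OF A] NA_eq[OF A borel_open[OF open_greaterThan]]
          by (intro arg_cong[of _ _ "emeasure p"]) (auto simp: E'_def)
        finally show ?thesis .
      qed
      (* Exhaust {s < \<sigma>} by sets that lie inside {r n \<le> \<sigma>} for a rational r n above s. *)
      have lower: "emeasure (NA A) {s<..} \<le> emeasure (MA A) {s<..}"
      proof -
        have step: "emeasure p {z\<in>E n. fst z \<in> A} \<le> emeasure (MA A) {s<..}" if n: "s < r n" for n
        proof -
          have "emeasure p {z\<in>E n. fst z \<in> A} = (\<integral>\<^sup>+x\<in>A. G n x \<partial>m)" using GE[OF A] by simp
          also have "\<dots> = (\<integral>\<^sup>+x\<in>A. ennreal (g n x) \<partial>m)"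
            using G1[of n] by (intro nn_integral_cong_AE) (auto simp: gmin min_def elim!: eventually_mono)
          also have "\<dots> \<le> emeasure (MA A) {s<..}"
            unfolding MAH
          proof (intro nn_integral_mono mult_right_mono)
            fix x
            have "ennreal (g n x) = emeasure lborel {0..g n x}" using g0 by simp
            also have "\<dots> \<le> emeasure lborel ({t. s < Q x t} \<inter> {0..1})"
              using n g1[of n x] setQ Q_less[OF True] by (intro emeasure_mono) (auto intro: order_trans)
            finally show "ennreal (g n x) \<le> emeasure U {t. s < Q x t}" unfolding U[OF setQ] .
          qed auto
          finally show ?thesis .
        qed
        define B where "B k = {z\<in>space p. fst z \<in> A \<and> s + 1 / real (Suc k) \<le> \<sigma> (snd z)}" for k
        have [measurable]: "B k \<in> sets p" for k unfolding B_def by measurable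
        have Bk: "emeasure p (B k) \<le> emeasure (MA A) {s<..}" for k
        proof (cases "s + 1 / real (Suc k) \<le> 1")
          case le: True
          then obtain n where n: "s < r n" "r n \<le> s + 1 / real (Suc k)" using r_dense[OF True _ le] by auto
          have "emeasure p (B k) \<le> emeasure p {z\<in>E n. fst z \<in> A}"
            using n by (intro emeasure_mono meas_sub A E) (auto simp: B_def E_def)
          then show ?thesis using step[OF n(1)] by simp
        next
          case False
          then have "B k = {}" using s01(2) by (auto simp: B_def) (smt (verit))
          then show ?thesis by simp
        qed
        have inc: "incseq B"
        proof (rule monoI)
          fix k l :: nat assume "k \<le> l"
          then have "1 / real (Suc l) \<le> 1 / real (Suc k)" by (simp add: frac_le)
          then show "B k \<subseteq> B l" by (auto simp: B_def)
        qed
        have UB: "(\<Union>k. B k) = {z\<in>space p. fst z \<in> A \<and> \<sigma> (snd z) \<in> {s<..}}"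
        proof (intro set_eqI iffI)
          fix z assume "z \<in> (\<Union>k. B k)"
          then obtain k where "z \<in> B k" by auto
          then have "s + 1 / real (Suc k) \<le> \<sigma> (snd z)" "z \<in> space p" "fst z \<in> A"
            by (auto simp: B_def)
          note zB = this
          moreover have "0 < 1 / real (Suc k)" by simp
          ultimately have "s < \<sigma> (snd z)" by linarith
          then show "z \<in> {z\<in>space p. fst z \<in> A \<and> \<sigma> (snd z) \<in> {s<..}}" using zB by simp
        next
          fix z assume z: "z \<in> {z\<in>space p. fst z \<in> A \<and> \<sigma> (snd z) \<in> {s<..}}"
          then obtain k where "1 / real (Suc k) < \<sigma> (snd z) - s" using nat_approx_posE[of "\<sigma> (snd z) - s"] by auto
          then have "z \<in> B k" using z by (auto simp: B_def)
          then show "z \<in> (\<Union>k. B k)" by blast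
        qed
        have "emeasure (NA A) {s<..} = (SUP k. emeasure p (B k))"
          unfolding NA_eq[OF A borel_open[OF open_greaterThan]] UB[symmetric]
          by (rule SUP_emeasure_incseq[symmetric]) (use inc in auto)
        also have "\<dots> \<le> emeasure (MA A) {s<..}" using Bk by (intro SUP_least)
        finally show ?thesis .
      qed
      show ?thesis using upper lower by (rule antisym)
    qed
  qed (auto simp: MA_def NA_def)
  have step_meas[measurable]: "(\<lambda>z. (fst z, hY (Q (fst z) (snd z)))) \<in> m \<Otimes>\<^sub>M U \<rightarrow>\<^sub>M borel_on X \<Otimes>\<^sub>M borel_on Y"
    by measurable
  define p' where "p' = distr (m \<Otimes>\<^sub>M U) (borel_on X \<Otimes>\<^sub>M borel_on Y) (\<lambda>z. (fst z, hY (Q (fst z) (snd z))))"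
  have "p' = p"
  proof (rule measure_eqI_generator_eq[OF Int_stable_pair_measure_generator[of "borel_on X" "borel_on Y"]])
    show "{a \<times> b |a b. a \<in> sets (borel_on X) \<and> b \<in> sets (borel_on Y)} \<subseteq> Pow (space (borel_on X) \<times> space (borel_on Y))"
      using sets.space_closed[of "borel_on X"] sets.space_closed[of "borel_on Y"] by auto
    show "sets p' = sigma_sets (space (borel_on X) \<times> space (borel_on Y)) {a \<times> b |a b. a \<in> sets (borel_on X) \<and> b \<in> sets (borel_on Y)}"
      by (simp add: p'_def sets_pair_measure)
    show "sets p = sigma_sets (space (borel_on X) \<times> space (borel_on Y)) {a \<times> b |a b. a \<in> sets (borel_on X) \<and> b \<in> sets (borel_on Y)}"
      by (simp add: setp' sets_pair_measure)
    show "range (\<lambda>_::nat. X \<times> Y) \<subseteq> {a \<times> b |a b. a \<in> sets (borel_on X) \<and> b \<in> sets (borel_on Y)}"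
      using sets.top[of "borel_on X"] sets.top[of "borel_on Y"] by (auto simp: space_restrict_space)
    show "(\<Union>i::nat. X \<times> Y) = space (borel_on X) \<times> space (borel_on Y)" by (simp add: space_restrict_space)
    have "prob_space p'" unfolding p'_def by (rule mU.P.prob_space_distr) measurable
    then interpret p': prob_space p' .
    show "emeasure p' (X \<times> Y) \<noteq> \<infinity>" for i :: nat by simp
    fix C assume "C \<in> {a \<times> b |a b. a \<in> sets (borel_on X) \<and> b \<in> sets (borel_on Y)}"
    then obtain A B where C: "C = A \<times> B" and A[measurable]: "A \<in> sets (borel_on X)" and B[measurable]: "B \<in> sets (borel_on Y)" by auto
    have hB[measurable]: "hY -` B \<in> sets borel" using measurable_sets[of hY borel "borel_on Y" B] B by simp
    have "emeasure p' C = emeasure (MA A) (hY -` B)"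
      unfolding MA_eq[OF A hB] p'_def C
      by (subst emeasure_distr) (auto intro!: arg_cong[of _ _ "emeasure (m \<Otimes>\<^sub>M U)"])
    also have "\<dots> = emeasure p C"
      unfolding MNA[OF A] NA_eq[OF A hB] C
      using sets.sets_into_space[OF A] sets.sets_into_space[OF B]
      by (intro arg_cong[of _ _ "emeasure p"]) (auto simp: spp hY_def hs space_restrict_space)
    finally show "emeasure p' C = emeasure p C" .
  qed
  have K: "(\<lambda>x. distr U (borel_on Y) (\<lambda>t. hY (Q x t))) \<in> borel_on X \<rightarrow>\<^sub>M prob_algebra (borel_on Y)"
  proof (rule measurable_distr_prob_space2)
    show "(\<lambda>_. U) \<in> borel_on X \<rightarrow>\<^sub>M prob_algebra U"
      by (rule measurable_const) (simp add: space_prob_algebra U.prob_space_axioms)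
    have "(\<lambda>z. hY (Q (fst z) (snd z))) \<in> m \<Otimes>\<^sub>M U \<rightarrow>\<^sub>M borel_on Y" by measurable
    then show "(\<lambda>(x, y). hY (Q x y)) \<in> borel_on X \<Otimes>\<^sub>M U \<rightarrow>\<^sub>M borel_on Y"
      by (simp add: case_prod_unfold measurable_cong_sets[OF sets_pair_measure_cong[OF setm refl] refl])
  qed
  show ?thesis
  proof (intro exI[of _ "\<lambda>x. distr U (borel_on Y) (\<lambda>t. hY (Q x t))"], unfold disintegration_def m_def[symmetric], intro conjI K ballI)
    fix C assume "C \<in> sets (borel_on (X \<times> Y))"
    then have C[measurable]: "C \<in> sets (borel_on X \<Otimes>\<^sub>M borel_on Y)"
      unfolding sets_borel_on_Times[OF X] .
    have "emeasure p C = emeasure p' C" using \<open>p' = p\<close> by simp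
    also have "\<dots> = emeasure (m \<Otimes>\<^sub>M U) ((\<lambda>z. (fst z, hY (Q (fst z) (snd z)))) -` C \<inter> space (m \<Otimes>\<^sub>M U))"
      unfolding p'_def by (rule emeasure_distr) measurable
    also have "\<dots> = (\<integral>\<^sup>+x. emeasure U (Pair x -` ((\<lambda>z. (fst z, hY (Q (fst z) (snd z)))) -` C \<inter> space (m \<Otimes>\<^sub>M U))) \<partial>m)"
      by (rule U.emeasure_pair_measure_alt) (use measurable_sets[OF step_meas C] in simp)
    also have "\<dots> = (\<integral>\<^sup>+x. emeasure (distr U (borel_on Y) (\<lambda>t. hY (Q x t))) (Pair x -` C) \<partial>m)"
    proof (rule nn_integral_cong)
      fix x assume x: "x \<in> space m"
      have "(\<lambda>t. Q (fst (x, t)) (snd (x, t))) \<in> borel_measurable U"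
        using measurable_compose[OF measurable_Pair1'[OF x] Q_meas] .
      then have [measurable]: "(\<lambda>t. hY (Q x t)) \<in> U \<rightarrow>\<^sub>M borel_on Y" by simp
      have "Pair x -` C \<in> sets (borel_on Y)" using C by (rule sets_Pair1)
      then show "emeasure U (Pair x -` ((\<lambda>z. (fst z, hY (Q (fst z) (snd z)))) -` C \<inter> space (m \<Otimes>\<^sub>M U))) =
        emeasure (distr U (borel_on Y) (\<lambda>t. hY (Q x t))) (Pair x -` C)"
        using x by (subst emeasure_distr) (auto intro!: arg_cong[of _ _ "emeasure U"] simp: space_pair_measure)
    qed
    finally show "emeasure p C = (\<integral>\<^sup>+x. emeasure (distr U (borel_on Y) (\<lambda>t. hY (Q x t))) (Pair x -` C) \<partial>m)" .
  qed
qed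

section \<open>The cone and the growth of the integrand\<close>

text \<open>
  Normalising the coefficients turns a conical combination into a multiple of a convex one.
\<close>

lemma conical_hull_eq:
  assumes "Y \<noteq> {}"
  shows "conical_hull Y = {t *\<^sub>R y | t y. 0 \<le> t \<and> y \<in> convex hull Y}"
proof (intro set_eqI iffI)
  fix z assume "z \<in> conical_hull Y"
  then obtain n l y where z: "z = (\<Sum>i<n. l i *\<^sub>R y i)" "1 \<le> (n::nat)" "\<And>i. i < n \<Longrightarrow> 0 \<le> l i \<and> y i \<in> Y"
    unfolding conical_hull_def by blast
  define s where "s = (\<Sum>i<n. l i)"
  have s0: "0 \<le> s" unfolding s_def using z by (intro sum_nonneg) auto
  show "z \<in> {t *\<^sub>R y | t y. 0 \<le> t \<and> y \<in> convex hull Y}"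
  proof (cases "s = 0")
    case True
    then have "l i = 0" if "i < n" for i
      using sum_nonneg_0[of "{..<n}" l i] z(3) that by (auto simp: s_def)
    then have "z = 0" using z(1) by simp
    moreover obtain y0 where "y0 \<in> convex hull Y" using assms by (metis ex_in_conv hull_inc)
    ultimately show ?thesis by (auto intro!: exI[of _ 0] exI[of _ y0])
  next
    case False
    have "(\<Sum>i<n. (l i / s) *\<^sub>R y i) \<in> convex hull Y"
    proof (rule convex_sum)
      show "(\<Sum>i<n. l i / s) = 1" using False by (simp add: s_def flip: sum_divide_distrib)
    qed (use z s0 in \<open>auto intro: hull_inc\<close>)
    moreover have "z = s *\<^sub>R (\<Sum>i<n. (l i / s) *\<^sub>R y i)"
      using False by (simp add: z(1) scaleR_sum_right)
    ultimately show ?thesis using s0 by blast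
  qed
next
  fix z assume "z \<in> {t *\<^sub>R y | t y. 0 \<le> t \<and> y \<in> convex hull Y}"
  then obtain t y where z: "z = t *\<^sub>R y" "0 \<le> t" "y \<in> convex hull Y" by auto
  then obtain k u x where k: "\<And>i. i \<in> {1::nat..k} \<Longrightarrow> 0 \<le> u i \<and> x i \<in> Y" "sum u {1..k} = 1"
      "(\<Sum>i=1..k. u i *\<^sub>R x i) = y"
    unfolding convex_hull_indexed by blast
  have "1 \<le> k" using k(2) by (cases k) auto
  moreover have "z = (\<Sum>i<k. (t * u (Suc i)) *\<^sub>R x (Suc i))"
    using sum.atLeast1_atMost_eq[of "\<lambda>i. (t * u i) *\<^sub>R x i" k]
    unfolding z(1) k(3)[symmetric] scaleR_sum_right by simp
  moreover have "\<forall>i<k. 0 \<le> t * u (Suc i) \<and> x (Suc i) \<in> Y" using k(1) z(2) by auto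
  ultimately show "z \<in> conical_hull Y" unfolding conical_hull_def
    by (intro CollectI exI[of _ k] exI[of _ "\<lambda>i. t * u (Suc i)"] exI[of _ "\<lambda>i. x (Suc i)"]) auto
qed

locale barycentric_problem =
  fixes X :: "'x::metric_space set" and Y Z :: "'a::euclidean_space set"
    and F :: "'x \<Rightarrow> 'a \<Rightarrow> real" and a :: "nat \<Rightarrow> 'x \<Rightarrow> real" and u :: "nat \<Rightarrow> 'x \<Rightarrow> 'a"
    and \<mu> :: "'x measure" and \<nu> :: "'a measure"
  assumes compact_X: "compact X" and compact_Y: "compact Y"
    and Z_def: "Z = conical_hull Y"
    and convex_F: "\<And>x. x \<in> X \<Longrightarrow> convex_on Z (F x)"
    and zero_notin: "0 \<notin> convex hull Y"
    and F_nonpos: "\<And>x z. x \<in> X \<Longrightarrow> z \<in> Z \<Longrightarrow> F x z \<le> 0"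
    and continuous_F: "continuous_on (X \<times> Z) (\<lambda>(x, z). F x z)"
    and continuous_a: "\<And>k. continuous_on X (a k)"
    and continuous_u: "\<And>k. continuous_on X (u k)"
    and F_sup: "\<And>x z. x \<in> X \<Longrightarrow> z \<in> Z \<Longrightarrow> ereal (F x z) = (SUP k. ereal (u k x \<bullet> z + a k x))"
    and F_recession: "\<And>x z. x \<in> X \<Longrightarrow> z \<in> Z - {0} \<Longrightarrow> ((\<lambda>l. F x (l *\<^sub>R z) / l) \<longlongrightarrow> 0) at_top"
    and F_coercive: "((\<lambda>l. SUP (x, y)\<in>X \<times> Y. ereal (F x (l *\<^sub>R y))) \<longlongrightarrow> - \<infinity>) at_top"
    and mu: "\<mu> \<in> borel_probs X" and nu: "\<nu> \<in> borel_probs Y"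
begin

sublocale mu: prob_space \<mu> using mu by (simp add: space_prob_algebra)
sublocale nu: prob_space \<nu> using nu by (simp add: space_prob_algebra)

lemma sets_mu[measurable_cong]: "sets \<mu> = sets (borel_on X)" using mu by (simp add: space_prob_algebra)
lemma sets_nu[measurable_cong]: "sets \<nu> = sets (borel_on Y)" using nu by (simp add: space_prob_algebra)
lemma measurable_mu: "measurable \<mu> N = measurable (borel_on X) N"
  by (rule measurable_cong_sets[OF sets_mu refl])
lemma measurable_nu: "measurable \<nu> N = measurable (borel_on Y) N"
  by (rule measurable_cong_sets[OF sets_nu refl])
lemma space_mu: "space \<mu> = X" using sets_eq_imp_space_eq[OF sets_mu] by (simp add: space_restrict_space)
lemma space_nu: "space \<nu> = Y" using sets_eq_imp_space_eq[OF sets_nu] by (simp add: space_restrict_space)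
lemma Y_nonempty: "Y \<noteq> {}" using nu.not_empty space_nu by simp

lemma Z_eq: "Z = {t *\<^sub>R y | t y. 0 \<le> t \<and> y \<in> convex hull Y}"
  unfolding Z_def by (rule conical_hull_eq[OF Y_nonempty])

lemma compact_co: "compact (convex hull Y)" using compact_Y by (rule compact_convex_hull)

lemma exists_level: "\<exists>e. \<forall>y\<in>convex hull Y. 1 \<le> e \<bullet> y"
proof -
  obtain w b where w: "0 < b" "\<forall>y\<in>convex hull Y. b < w \<bullet> y"
    using separating_hyperplane_closed_0[OF convex_convex_hull compact_imp_closed[OF compact_co] zero_notin] by blast
  have "1 \<le> ((1 / b) *\<^sub>R w) \<bullet> y" if "y \<in> convex hull Y" for y
    using w(1) w(2)[rule_format, OF that] by (simp add: le_divide_eq)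
  then show ?thesis by blast
qed

text \<open>
  The gauge of the cone: between \<open>1\<close> and \<open>E\<close> on the convex hull of
  \<open>Y\<close>, and comparable to the norm on \<open>Z\<close>.
\<close>

definition e :: 'a where "e = (SOME e. \<forall>y\<in>convex hull Y. 1 \<le> e \<bullet> y)"

lemma e_ge_1_co: "y \<in> convex hull Y \<Longrightarrow> 1 \<le> e \<bullet> y"
  unfolding e_def using someI_ex[OF exists_level] by blast

lemma e_ge_1: "y \<in> Y \<Longrightarrow> 1 \<le> e \<bullet> y"
  by (rule e_ge_1_co[OF hull_inc])

definition R :: real where "R = (SOME R. 0 \<le> R \<and> (\<forall>y\<in>convex hull Y. norm y \<le> R))"

lemma R: "0 \<le> R" "y \<in> convex hull Y \<Longrightarrow> norm y \<le> R"
proof -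
  obtain B where "\<forall>y\<in>convex hull Y. norm y \<le> B" using compact_imp_bounded[OF compact_co] bounded_iff by blast
  then have "0 \<le> max 0 B \<and> (\<forall>y\<in>convex hull Y. norm y \<le> max 0 B)" by auto
  from someI[of "\<lambda>R. 0 \<le> R \<and> (\<forall>y\<in>convex hull Y. norm y \<le> R)", OF this]
  show "0 \<le> R" "y \<in> convex hull Y \<Longrightarrow> norm y \<le> R" unfolding R_def by blast+
qed

definition E :: real where "E = norm e * R"

lemma E_nonneg: "0 \<le> E" using R(1) by (simp add: E_def)

lemma e_le_E_co: "y \<in> convex hull Y \<Longrightarrow> e \<bullet> y \<le> E"
  using norm_cauchy_schwarz[of e y] R(2)[of y] unfolding E_def
  by (meson mult_left_mono norm_ge_zero order_trans)

lemma e_le_E: "y \<in> Y \<Longrightarrow> e \<bullet> y \<le> E" by (rule e_le_E_co[OF hull_inc])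

lemma zero_in_Z: "0 \<in> Z"
proof -
  obtain y where "y \<in> Y" using Y_nonempty by blast
  then have "0 *\<^sub>R y \<in> Z" unfolding Z_eq by (blast intro: hull_inc)
  then show ?thesis by simp
qed

lemma co_subset_Z: "convex hull Y \<subseteq> Z"
proof
  fix y assume "y \<in> convex hull Y"
  then have "1 *\<^sub>R y \<in> Z" unfolding Z_eq using zero_le_one by blast
  then show "y \<in> Z" by simp
qed

lemma Y_subset_Z: "Y \<subseteq> Z" using co_subset_Z hull_subset[of Y convex] by simp

lemma scale_in_Z: "0 \<le> t \<Longrightarrow> z \<in> Z \<Longrightarrow> t *\<^sub>R z \<in> Z"
  unfolding Z_eq by (auto, metis mult_nonneg_nonneg scaleR_scaleR)

lemma add_in_Z:
  assumes "z \<in> Z" "w \<in> Z" shows "z + w \<in> Z"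
proof -
  obtain s y where z: "z = s *\<^sub>R y" "0 \<le> s" "y \<in> convex hull Y" using assms(1) unfolding Z_eq by auto
  obtain t v where w: "w = t *\<^sub>R v" "0 \<le> t" "v \<in> convex hull Y" using assms(2) unfolding Z_eq by auto
  show ?thesis
  proof (cases "s + t = 0")
    case True
    then have "s = 0" "t = 0" using z w by auto
    then show ?thesis using z w zero_in_Z by simp
  next
    case False
    have "(s / (s + t)) *\<^sub>R y + (t / (s + t)) *\<^sub>R v \<in> convex hull Y"
      using z w False by (intro convexD[OF convex_convex_hull]) (auto simp: add_divide_distrib[symmetric])
    then have "(s + t) *\<^sub>R ((s / (s + t)) *\<^sub>R y + (t / (s + t)) *\<^sub>R v) \<in> Z"
      using z w co_subset_Z by (intro scale_in_Z) auto
    then show ?thesis using False z w by (simp add: scaleR_add_right)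
  qed
qed

lemma convex_Z: "convex Z"
  unfolding convex_def by (auto intro!: add_in_Z scale_in_Z)

lemma e_nonneg: assumes "z \<in> Z" shows "0 \<le> e \<bullet> z"
proof -
  obtain s y where "z = s *\<^sub>R y" "0 \<le> s" "y \<in> convex hull Y" using assms unfolding Z_eq by auto
  then show ?thesis using e_ge_1_co[of y] by simp
qed

lemma norm_le_e: assumes "z \<in> Z" shows "norm z \<le> R * (e \<bullet> z)"
proof -
  obtain s y where z: "z = s *\<^sub>R y" "0 \<le> s" "y \<in> convex hull Y" using assms unfolding Z_eq by auto
  have "norm y \<le> R * (e \<bullet> y)" using R(2)[OF z(3)] e_ge_1_co[OF z(3)] R(1)
    by (metis mult.right_neutral mult_left_mono order_trans)
  then show ?thesis using z by (simp add: mult.left_commute mult_left_mono)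
qed

lemma e_pos: "z \<in> Z - {0} \<Longrightarrow> 0 < e \<bullet> z"
  using norm_le_e[of z] e_nonneg[of z] by (cases "e \<bullet> z = 0") auto

text \<open>
  The slice is the image of a compact set of pairs \<open>(t, y)\<close>, since \<open>t * y\<close>
  has gauge at least \<open>t\<close>.
\<close>

lemma compact_slice: "compact {z \<in> Z. e \<bullet> z \<le> L}"
proof -
  have "{z \<in> Z. e \<bullet> z \<le> L} = (\<lambda>(t, y). t *\<^sub>R y) ` ({0..L} \<times> (convex hull Y)) \<inter> {z. e \<bullet> z \<le> L}"
  proof (intro set_eqI iffI)
    fix z assume z: "z \<in> {z \<in> Z. e \<bullet> z \<le> L}"
    then obtain s y where s: "z = s *\<^sub>R y" "0 \<le> s" "y \<in> convex hull Y" unfolding Z_eq by auto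
    have "s * 1 \<le> s * (e \<bullet> y)" using s e_ge_1_co by (intro mult_left_mono) auto
    then have "s \<le> L" using z s by simp
    then show "z \<in> (\<lambda>(t, y). t *\<^sub>R y) ` ({0..L} \<times> (convex hull Y)) \<inter> {z. e \<bullet> z \<le> L}" using s z by force
  next
    fix z assume z: "z \<in> (\<lambda>(t, y). t *\<^sub>R y) ` ({0..L} \<times> (convex hull Y)) \<inter> {z. e \<bullet> z \<le> L}"
    then obtain t y where "z = t *\<^sub>R y" "0 \<le> t" "y \<in> convex hull Y" by auto
    then show "z \<in> {z \<in> Z. e \<bullet> z \<le> L}" using z scale_in_Z co_subset_Z by blast
  qed
  moreover have "compact ((\<lambda>(t, y). t *\<^sub>R y) ` ({0..L} \<times> (convex hull Y)))"
    unfolding case_prod_unfold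
    by (intro compact_continuous_image compact_Times compact_Icc compact_co continuous_intros)
  moreover have "closed {z. e \<bullet> z \<le> L}" by (rule closed_halfspace_le)
  ultimately show ?thesis by (simp add: compact_Int_closed)
qed

lemma closed_Z: "closed Z"
  unfolding closed_sequential_limits
proof (intro allI impI, elim conjE)
  fix s z assume s: "\<forall>n. s n \<in> Z" "s \<longlonglongrightarrow> z"
  have "(\<lambda>n. e \<bullet> s n) \<longlonglongrightarrow> e \<bullet> z" using s by (intro tendsto_intros)
  then have "Bseq (\<lambda>n. e \<bullet> s n)" by (rule convergent_imp_Bseq[OF convergentI])
  then obtain L where "\<And>n. norm (e \<bullet> s n) \<le> L" using BseqE by blast
  then have "\<And>n. s n \<in> {z \<in> Z. e \<bullet> z \<le> L}" using s(1) by (auto simp: abs_le_iff)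
  then have "z \<in> {z \<in> Z. e \<bullet> z \<le> L}"
    using closed_sequentially[OF compact_imp_closed[OF compact_slice] _ s(2)] by blast
  then show "z \<in> Z" by simp
qed

lemma continuous_F_x: assumes "z \<in> Z" shows "continuous_on X (\<lambda>x. F x z)"
proof -
  have "continuous_on X (\<lambda>x. (\<lambda>(x, z). F x z) (x, z))"
    using assms by (intro continuous_on_compose2[OF continuous_F] continuous_intros) auto
  then show ?thesis by simp
qed

lemma tendsto_F:
  assumes "x \<in> X" "z \<in> Z" "\<And>n. s n \<in> X" "\<And>n. w n \<in> Z" "s \<longlonglongrightarrow> x" "w \<longlonglongrightarrow> z"
  shows "(\<lambda>n. F (s n) (w n)) \<longlonglongrightarrow> F x z"
  using continuous_on_tendsto_compose[OF continuous_F tendsto_Pair[OF assms(5,6)]] assms by auto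

lemma affine_minorant: "x \<in> X \<Longrightarrow> z \<in> Z \<Longrightarrow> u k x \<bullet> z + a k x \<le> F x z"
proof -
  assume "x \<in> X" "z \<in> Z"
  then have "ereal (u k x \<bullet> z + a k x) \<le> ereal (F x z)" unfolding F_sup[OF \<open>x \<in> X\<close> \<open>z \<in> Z\<close>] by (intro SUP_upper) auto
  then show ?thesis by simp
qed

text \<open>
  An affine minorant with a positive slope along a ray of the cone would contradict \<open>F \<le>
  0\<close>.
\<close>

lemma u_nonpos: assumes x: "x \<in> X" and z: "z \<in> Z" shows "u k x \<bullet> z \<le> 0"
proof (rule ccontr)
  assume "\<not> u k x \<bullet> z \<le> 0"
  then have pos: "0 < u k x \<bullet> z" by simp
  define t where "t = (\<bar>a k x\<bar> + 1) / (u k x \<bullet> z)"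
  have "0 \<le> t" using pos by (simp add: t_def)
  then have "u k x \<bullet> (t *\<^sub>R z) + a k x \<le> 0"
    using affine_minorant[OF x scale_in_Z[OF _ z]] F_nonpos[OF x scale_in_Z[OF _ z]] by (meson order_trans)
  moreover have "u k x \<bullet> (t *\<^sub>R z) = \<bar>a k x\<bar> + 1" using pos by (simp add: t_def)
  ultimately show False by simp
qed

lemma slope_mono:
  assumes x: "x \<in> X" and z: "z \<in> Z" and st: "0 < s" "s \<le> t"
  shows "(F x (s *\<^sub>R z) - F x 0) / s \<le> (F x (t *\<^sub>R z) - F x 0) / t"
proof -
  have "F x ((1 - s / t) *\<^sub>R 0 + (s / t) *\<^sub>R (t *\<^sub>R z)) \<le> (1 - s / t) * F x 0 + (s / t) * F x (t *\<^sub>R z)"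
    using st z x by (intro convex_onD[OF convex_F]) (auto intro: zero_in_Z scale_in_Z)
  then have "F x (s *\<^sub>R z) - F x 0 \<le> (s / t) * (F x (t *\<^sub>R z) - F x 0)" using st by (simp add: algebra_simps)
  then show ?thesis using st by (simp add: field_simps)
qed

lemma F_lower_slice: "\<exists>M\<ge>0. \<forall>x\<in>X. \<forall>z\<in>Z. e \<bullet> z \<le> L \<longrightarrow> - M \<le> F x z"
proof -
  have "compact ((\<lambda>(x, z). F x z) ` (X \<times> {z \<in> Z. e \<bullet> z \<le> L}))"
    by (intro compact_continuous_image continuous_on_subset[OF continuous_F] compact_Times compact_X compact_slice) auto
  then have "bounded ((\<lambda>(x, z). F x z) ` (X \<times> {z \<in> Z. e \<bullet> z \<le> L}))" by (rule compact_imp_bounded)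
  then obtain B where B: "\<forall>v\<in>(\<lambda>(x, z). F x z) ` (X \<times> {z \<in> Z. e \<bullet> z \<le> L}). norm v \<le> B"
    unfolding bounded_iff by blast
  have "- max 0 B \<le> F x z" if "x \<in> X" "z \<in> Z" "e \<bullet> z \<le> L" for x z
    using B that by (force simp: abs_le_iff)
  then show ?thesis by (intro exI[of _ "max 0 B"]) auto
qed

text \<open>
  By convexity the difference quotients along a ray increase, and by the recession hypothesis their
  limit is \<open>0\<close>; Dini's argument on the compact set of directions makes this uniform in
  \<open>x\<close> and in the direction.
\<close>

lemma sublinear_lower_bound:
  assumes \<eta>: "0 < \<eta>"
  shows "\<exists>M\<ge>0. \<forall>x\<in>X. \<forall>z\<in>Z. - \<eta> * (e \<bullet> z) - M \<le> F x z"
proof -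
  have "\<exists>n>0. \<forall>x\<in>X. \<forall>z\<in>Z. e \<bullet> z = 1 \<longrightarrow> - \<eta> < (F x (real n *\<^sub>R z) - F x 0) / real n"
  proof (rule ccontr)
    assume "\<not> ?thesis"
    then have "\<forall>n. \<exists>x z. x \<in> X \<and> z \<in> Z \<and> e \<bullet> z = 1 \<and> (F x (real (Suc n) *\<^sub>R z) - F x 0) / real (Suc n) \<le> - \<eta>"
      by (metis not_less zero_less_Suc)
    then obtain s w where sw: "\<And>n. s n \<in> X" "\<And>n. w n \<in> Z" "\<And>n. e \<bullet> w n = 1"
      "\<And>n. (F (s n) (real (Suc n) *\<^sub>R w n) - F (s n) 0) / real (Suc n) \<le> - \<eta>" by metis
    have C: "compact (X \<times> {z \<in> Z. e \<bullet> z \<le> 1})" by (intro compact_Times compact_X compact_slice)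
    have C': "\<forall>n. (s n, w n) \<in> X \<times> {z \<in> Z. e \<bullet> z \<le> 1}" using sw by auto
    obtain l r where l: "l \<in> X \<times> {z \<in> Z. e \<bullet> z \<le> 1}" "strict_mono r" "((\<lambda>n. (s n, w n)) \<circ> r) \<longlonglongrightarrow> l"
      by (rule seq_compactE[OF compact_imp_seq_compact[OF C] C'])
    obtain x z where xz: "l = (x, z)" by (cases l)
    have x: "x \<in> X" and z: "z \<in> Z" using l xz by auto
    have lx: "(\<lambda>n. s (r n)) \<longlonglongrightarrow> x" and lz: "(\<lambda>n. w (r n)) \<longlonglongrightarrow> z"
      using tendsto_fst[OF l(3)] tendsto_snd[OF l(3)] xz by (auto simp: o_def)
    have "(\<lambda>n. e \<bullet> w (r n)) \<longlonglongrightarrow> e \<bullet> z" using lz by (intro tendsto_intros)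
    then have "e \<bullet> z = 1" using sw(3) by (simp add: LIMSEQ_const_iff)
    then have "z \<in> Z - {0}" using z by auto
    then have lim: "((\<lambda>l. F x (l *\<^sub>R z) / l) \<longlongrightarrow> 0) at_top" using F_recession x by blast
    have bd: "(F x (m *\<^sub>R z) - F x 0) / m \<le> - \<eta>" if m: "0 < m" for m
    proof (rule LIMSEQ_le_const2)
      show "(\<lambda>n. (F (s (r n)) (m *\<^sub>R w (r n)) - F (s (r n)) 0) / m) \<longlonglongrightarrow> (F x (m *\<^sub>R z) - F x 0) / m"
        using m sw x z by (intro tendsto_intros tendsto_F lx lz scale_in_Z zero_in_Z) auto
      obtain N :: nat where N: "m \<le> real N" using real_arch_simple by blast
      show "\<exists>N. \<forall>n\<ge>N. (F (s (r n)) (m *\<^sub>R w (r n)) - F (s (r n)) 0) / m \<le> - \<eta>"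
      proof (intro exI[of _ N] allI impI)
        fix n assume "N \<le> n"
        then have "m \<le> real (Suc (r n))" using N seq_suble[OF l(2), of n] by linarith
        from order_trans[OF slope_mono[OF sw(1) sw(2) m this] sw(4)[of "r n"]]
        show "(F (s (r n)) (m *\<^sub>R w (r n)) - F (s (r n)) 0) / m \<le> - \<eta>" .
      qed
    qed
    have "((\<lambda>l. F x (l *\<^sub>R z) / l - F x 0 / l) \<longlongrightarrow> 0 - 0) at_top"
      by (intro tendsto_diff lim tendsto_divide_0[OF tendsto_const] filterlim_at_top_imp_at_infinity filterlim_ident)
    moreover have "eventually (\<lambda>l. F x (l *\<^sub>R z) / l - F x 0 / l \<le> - \<eta>) at_top"
      using eventually_gt_at_top[of 0] by eventually_elim (use bd in \<open>simp add: diff_divide_distrib\<close>)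
    ultimately have "0 - 0 \<le> - \<eta>" by (intro tendsto_upperbound) auto
    then show False using \<eta> by simp
  qed
  then obtain n where n: "0 < n" "\<And>x z. x \<in> X \<Longrightarrow> z \<in> Z \<Longrightarrow> e \<bullet> z = 1 \<Longrightarrow> - \<eta> < (F x (real n *\<^sub>R z) - F x 0) / real n"
    by blast
  obtain M where M: "0 \<le> M" "\<And>x z. x \<in> X \<Longrightarrow> z \<in> Z \<Longrightarrow> e \<bullet> z \<le> real n \<Longrightarrow> - M \<le> F x z"
    using F_lower_slice by blast
  show ?thesis
  proof (intro exI[of _ M] conjI ballI M(1))
    fix x z assume x: "x \<in> X" and z: "z \<in> Z"
    show "- \<eta> * (e \<bullet> z) - M \<le> F x z"
    proof (cases "e \<bullet> z \<le> real n")
      case True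
      have "- \<eta> * (e \<bullet> z) \<le> 0" using \<eta> e_nonneg[OF z] by simp
      then show ?thesis using M(2)[OF x z True] by linarith
    next
      case False
      define l where "l = e \<bullet> z"
      define w where "w = (1 / l) *\<^sub>R z"
      have l: "real n < l" "0 < l" using False n(1) by (auto simp: l_def)
      have w: "w \<in> Z" "e \<bullet> w = 1" "z = l *\<^sub>R w" using l z by (auto simp: w_def scale_in_Z l_def[symmetric])
      have "- \<eta> < (F x (l *\<^sub>R w) - F x 0) / l"
        using n(2)[OF x w(1,2)] slope_mono[OF x w(1), of "real n" l] l n(1) by simp
      then have "- \<eta> * l < F x z - F x 0" using l w by (simp add: pos_less_divide_eq)
      moreover have "- M \<le> F x 0" by (rule M(2)[OF x zero_in_Z]) simp
      ultimately show ?thesis by (simp add: l_def)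
    qed
  qed
qed

text \<open>
  On a compact slice this is uniform continuity. Far out in the cone both values lie between \<open>-
  \<eta> * (e \<bullet> z)\<close> and \<open>0\<close>.
\<close>

lemma uniform_modulus:
  assumes \<eta>: "0 < \<eta>"
  shows "\<exists>\<delta>>0. \<forall>x\<in>X. \<forall>x'\<in>X. dist x x' < \<delta> \<longrightarrow> (\<forall>z\<in>Z. F x z \<le> F x' z + \<eta> * (1 + e \<bullet> z))"
proof -
  obtain M where M: "0 \<le> M" "\<And>x z. x \<in> X \<Longrightarrow> z \<in> Z \<Longrightarrow> - (\<eta> / 2) * (e \<bullet> z) - M \<le> F x z"
    using sublinear_lower_bound[of "\<eta> / 2"] \<eta> by auto
  (* Beyond gauge L the constant M is absorbed by half of the allowed error. *)
  define L where "L = 2 * M / \<eta>"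
  have "uniformly_continuous_on (X \<times> {z \<in> Z. e \<bullet> z \<le> L}) (\<lambda>(x, z). F x z)"
    by (intro compact_uniformly_continuous continuous_on_subset[OF continuous_F] compact_Times compact_X compact_slice) auto
  from this[unfolded uniformly_continuous_on_def, rule_format, OF \<eta>]
  obtain \<delta> where \<delta>: "0 < \<delta>" and \<delta>': "\<forall>q\<in>X \<times> {z \<in> Z. e \<bullet> z \<le> L}. \<forall>p\<in>X \<times> {z \<in> Z. e \<bullet> z \<le> L}.
      dist p q < \<delta> \<longrightarrow> dist (case p of (x, z) \<Rightarrow> F x z) (case q of (x, z) \<Rightarrow> F x z) < \<eta>"
    by blast
  show ?thesis
  proof (intro exI[of _ \<delta>] conjI ballI impI \<delta>)
    fix x x' z assume x: "x \<in> X" and x': "x' \<in> X" and d: "dist x x' < \<delta>" and z: "z \<in> Z"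
    show "F x z \<le> F x' z + \<eta> * (1 + e \<bullet> z)"
    proof (cases "e \<bullet> z \<le> L")
      case True
      have "dist (F x z) (F x' z) < \<eta>"
        using \<delta>'[rule_format, of "(x', z)" "(x, z)"] x x' z True d by (simp add: dist_Pair_Pair)
      moreover have "0 \<le> \<eta> * (e \<bullet> z)" using \<eta> e_nonneg[OF z] by simp
      ultimately show ?thesis by (simp add: dist_real_def algebra_simps abs_less_iff)
    next
      case False
      then have "M \<le> (\<eta> / 2) * (e \<bullet> z)" using \<eta> by (simp add: L_def field_simps)
      then show ?thesis using M(2)[OF x' z] F_nonpos[OF x z] \<eta> by (simp add: algebra_simps)
    qed
  qed
qed

text \<open>
  Convexity passes the bound from \<open>Y\<close> to its convex hull, whose positive multiples make
  up \<open>Z\<close>.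
\<close>

lemma coercive: "\<exists>l>0. \<forall>x\<in>X. \<forall>z\<in>Z. l \<le> e \<bullet> z \<longrightarrow> F x z \<le> - A"
proof -
  have "eventually (\<lambda>l. (SUP (x, y)\<in>X \<times> Y. ereal (F x (l *\<^sub>R y))) < ereal (- A)) at_top"
    using F_coercive by (rule order_tendstoD) simp
  then obtain L where L: "\<And>l. L \<le> l \<Longrightarrow> (SUP (x, y)\<in>X \<times> Y. ereal (F x (l *\<^sub>R y))) < ereal (- A)"
    by (auto simp: eventually_at_top_linorder)
  have Y: "F x (l *\<^sub>R y) \<le> - A" if "L \<le> l" "x \<in> X" "y \<in> Y" for l x y
  proof -
    have "ereal (F x (l *\<^sub>R y)) \<le> (SUP (x, y)\<in>X \<times> Y. ereal (F x (l *\<^sub>R y)))"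
      using that by (intro SUP_upper2[of "(x, y)"]) auto
    then show ?thesis using L[OF that(1)] by (meson ereal_less_eq(3) less_imp_le order_trans)
  qed
  define l where "l = max L 1 * (E + 1)"
  have "0 < l" using E_nonneg by (auto simp: l_def intro!: mult_pos_pos)
  moreover have "F x z \<le> - A" if x: "x \<in> X" and z: "z \<in> Z" and le: "l \<le> e \<bullet> z" for x z
  proof -
    obtain t y where t: "z = t *\<^sub>R y" "0 \<le> t" "y \<in> convex hull Y" using z unfolding Z_eq by auto
    have "t * (e \<bullet> y) \<le> t * (E + 1)" using t e_le_E_co[OF t(3)] by (intro mult_left_mono) auto
    then have "max L 1 * (E + 1) \<le> t * (E + 1)" using le t by (simp add: l_def)
    then have tL: "max L 1 \<le> t" using E_nonneg by (simp add: mult_le_cancel_right)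
    have "convex_on (convex hull Y) (\<lambda>y. F x (t *\<^sub>R y))"
    proof (rule convex_onI)
      fix s v w :: real and y' y'' assume s: "0 < s" "s < (1::real)" "y' \<in> convex hull Y" "y'' \<in> convex hull Y"
      have "F x ((1 - s) *\<^sub>R (t *\<^sub>R y') + s *\<^sub>R (t *\<^sub>R y'')) \<le> (1 - s) * F x (t *\<^sub>R y') + s * F x (t *\<^sub>R y'')"
        using s t x co_subset_Z by (intro convex_onD[OF convex_F]) (auto intro!: scale_in_Z)
      then show "F x (t *\<^sub>R ((1 - s) *\<^sub>R y' + s *\<^sub>R y'')) \<le> (1 - s) * F x (t *\<^sub>R y') + s * F x (t *\<^sub>R y'')"
        by (simp add: scaleR_add_right mult.commute)
    qed simp
    then have "F x (t *\<^sub>R y) \<le> - A"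
      using convex_on_convex_hull_bound[of Y "\<lambda>y. F x (t *\<^sub>R y)" "- A"] Y[of t x] tL x t(3) by auto
    then show ?thesis using t by simp
  qed
  ultimately show ?thesis by blast
qed

end

section \<open>Extended integrals and the barycentric map of a plan\<close>

lemma ext_integral_cong_AE:
  assumes "AE x in M. f x = g x"
  shows "ext_integral M f = ext_integral M g"
proof -
  have "(\<integral>\<^sup>+x. e2ennreal (f x) \<partial>M) = (\<integral>\<^sup>+x. e2ennreal (g x) \<partial>M)"
    by (rule nn_integral_cong_AE) (use assms in \<open>auto elim: eventually_mono\<close>)
  moreover have "(\<integral>\<^sup>+x. e2ennreal (- f x) \<partial>M) = (\<integral>\<^sup>+x. e2ennreal (- g x) \<partial>M)"
    by (rule nn_integral_cong_AE) (use assms in \<open>auto elim: eventually_mono\<close>)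
  ultimately show ?thesis by (simp add: ext_integral_def)
qed

lemma ext_integral_nonpos:
  assumes "AE x in M. f x \<le> 0"
  shows "ext_integral M f = - enn2ereal (\<integral>\<^sup>+x. e2ennreal (- f x) \<partial>M)"
proof -
  have "(\<integral>\<^sup>+x. e2ennreal (f x) \<partial>M) = (\<integral>\<^sup>+x. 0 \<partial>M)"
    by (rule nn_integral_cong_AE) (use assms in \<open>auto elim!: eventually_mono simp: e2ennreal_neg\<close>)
  then show ?thesis by (simp add: ext_integral_def zero_ennreal.rep_eq)
qed

lemma ext_integral_nonneg:
  assumes "AE x in M. 0 \<le> f x"
  shows "ext_integral M f = enn2ereal (\<integral>\<^sup>+x. e2ennreal (f x) \<partial>M)"
proof -
  have "(\<integral>\<^sup>+x. e2ennreal (- f x) \<partial>M) = (\<integral>\<^sup>+x. 0 \<partial>M)"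
    by (rule nn_integral_cong_AE) (use assms in \<open>auto elim!: eventually_mono simp: e2ennreal_neg ereal_uminus_le_0_iff\<close>)
  then show ?thesis by (simp add: ext_integral_def zero_ennreal.rep_eq)
qed

lemma ext_integral_real_nonpos:
  assumes "integrable M f" "AE x in M. f x \<le> 0"
  shows "ext_integral M (\<lambda>x. ereal (f x)) = ereal (\<integral>x. f x \<partial>M)"
proof -
  have "(\<integral>\<^sup>+x. e2ennreal (- ereal (f x)) \<partial>M) = (\<integral>\<^sup>+x. ennreal (- f x) \<partial>M)"
    by simp
  also have "\<dots> = ennreal (\<integral>x. - f x \<partial>M)"
    using assms by (intro nn_integral_eq_integral) auto
  finally have "(\<integral>\<^sup>+x. e2ennreal (- ereal (f x)) \<partial>M) = ennreal (\<integral>x. - f x \<partial>M)" .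
  moreover have "(\<integral>x. f x \<partial>M) \<le> 0"
    using assms integral_nonneg_AE[of "\<lambda>x. - f x" M] by simp
  ultimately show ?thesis
    using assms by (subst ext_integral_nonpos) (auto simp: enn2ereal_ennreal)
qed

lemma integral_scale_measure_ennreal:
  fixes f :: "'a \<Rightarrow> 'b::{banach, second_countable_topology}"
  assumes "f \<in> borel_measurable M" "0 \<le> c"
  shows "(\<integral>x. f x \<partial>scale_measure (ennreal c) M) = c *\<^sub>R (\<integral>x. f x \<partial>M)"
proof -
  have "scale_measure (ennreal c) M = density M (\<lambda>_. ennreal c)"
    by (rule measure_eqI) (auto simp: emeasure_density_const)
  then show ?thesis using assms by (simp add: integral_density)
qed

lemma integral_of_Pair:
  fixes f :: "'c \<Rightarrow> 'b::euclidean_space" and g :: "'c \<Rightarrow> 'd::euclidean_space"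
  assumes f: "integrable M f" and g: "integrable M g"
  shows "integrable M (\<lambda>x. (f x, g x))" "(\<integral>x. (f x, g x) \<partial>M) = ((\<integral>x. f x \<partial>M), (\<integral>x. g x \<partial>M))"
proof -
  have l: "bounded_linear (\<lambda>x::'b. (x, 0::'d))" and r: "bounded_linear (\<lambda>x::'d. (0::'b, x))"
    by (intro bounded_linear_Pair bounded_linear_ident bounded_linear_zero)+
  have eq: "(\<lambda>x. (f x, g x)) = (\<lambda>x. (f x, 0) + (0, g x))" by simp
  show "integrable M (\<lambda>x. (f x, g x))"
    unfolding eq using integrable_bounded_linear[OF l f] integrable_bounded_linear[OF r g]
    by (rule Bochner_Integration.integrable_add)
  show "(\<integral>x. (f x, g x) \<partial>M) = ((\<integral>x. f x \<partial>M), (\<integral>x. g x \<partial>M))"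
    unfolding eq using integrable_bounded_linear[OF l f] integrable_bounded_linear[OF r g]
      integral_bounded_linear[OF l f] integral_bounded_linear[OF r g]
    by (subst Bochner_Integration.integral_add) auto
qed

context barycentric_problem
begin

abbreviation dual_candidates :: "('a \<Rightarrow> ereal) set" where
  "dual_candidates \<equiv> Phi_plus Z \<inter> ext_L1 \<nu>"

text \<open>
  An integrable \<open>\<phi>\<close> is finite at some point, so homogeneity with factor
  \<open>0\<close> gives \<open>\<phi> 0 = 0\<close>; the constant \<open>\<infinity>\<close> is
  excluded.
\<close>

lemma dual_candidate:
  assumes "\<phi> \<in> dual_candidates"
  shows "\<And>z. z \<in> Z \<Longrightarrow> 0 \<le> \<phi> z" "lsc_on Z \<phi>" "ext_convex_on Z \<phi>" "pos_homogeneous_on Z \<phi>"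
    "\<phi> \<in> borel_measurable \<nu>" "(\<integral>\<^sup>+y. e2ennreal (\<phi> y) \<partial>\<nu>) < \<infinity>"
    "AE y in \<nu>. \<phi> y < \<infinity>" "\<phi> 0 = 0"
    "ext_integral \<nu> \<phi> = enn2ereal (\<integral>\<^sup>+y. e2ennreal (\<phi> y) \<partial>\<nu>)"
proof -
  show nonneg: "0 \<le> \<phi> z" if "z \<in> Z" for z using assms that by (auto simp: Phi_plus_def)
  show "lsc_on Z \<phi>" "ext_convex_on Z \<phi>" and hom: "pos_homogeneous_on Z \<phi>"
    using assms by (auto simp: Phi_plus_def)
  show meas: "\<phi> \<in> borel_measurable \<nu>" using assms by (auto simp: ext_L1_def)
  have "(\<integral>\<^sup>+y. e2ennreal (\<phi> y) \<partial>\<nu>) = (\<integral>\<^sup>+y. e2ennreal \<bar>\<phi> y\<bar> \<partial>\<nu>)"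
    using nonneg Y_subset_Z by (intro nn_integral_cong) (auto simp: space_nu)
  then show fin: "(\<integral>\<^sup>+y. e2ennreal (\<phi> y) \<partial>\<nu>) < \<infinity>" using assms by (auto simp: ext_L1_def)
  have "AE y in \<nu>. e2ennreal (\<phi> y) \<noteq> \<infinity>"
    using meas fin by (intro nn_integral_PInf_AE) auto
  then show ae: "AE y in \<nu>. \<phi> y < \<infinity>" by eventually_elim (auto simp: less_top)
  have "\<exists>y\<in>Y. \<phi> y < \<infinity>"
  proof (rule ccontr)
    assume not: "\<not> ?thesis"
    have "AE y in \<nu>. False" using ae AE_space by eventually_elim (use not in \<open>auto simp: space_nu\<close>)
    then show False by simp
  qed
  then obtain y where y: "y \<in> Y" "\<phi> y < \<infinity>" by blast
  then have "\<phi> (0 *\<^sub>R y) = ereal 0 * \<phi> y"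
    using hom Y_subset_Z unfolding pos_homogeneous_on_def by blast
  then show "\<phi> 0 = 0" by (simp flip: zero_ereal_def)
  show "ext_integral \<nu> \<phi> = enn2ereal (\<integral>\<^sup>+y. e2ennreal (\<phi> y) \<partial>\<nu>)"
    using nonneg Y_subset_Z by (intro ext_integral_nonneg AE_I2) (auto simp: space_nu)
qed

end

locale barycentric_plan = barycentric_problem +
  fixes p assumes plan: "p \<in> plans_ac X Y \<mu> \<nu>"
begin

abbreviation K where "K \<equiv> disint_kernel X Y p"
abbreviation m1 where "m1 \<equiv> marginal1 X p"
abbreviation \<rho> where "\<rho> \<equiv> RN_deriv \<mu> m1"

text \<open>
  The barycentre of the unnormalised kernel \<open>q\<^sup>x = \<rho> x \<cdot> K x\<close>. Replacing
  \<open>\<rho> x = \<infinity>\<close>, which happens only on a \<open>\<mu>\<close>-null set, by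
  \<open>0\<close> makes \<open>S x\<close> a point of the cone for every \<open>x\<close> in
  \<open>X\<close>.
\<close>

definition S where "S x = enn2real (\<rho> x) *\<^sub>R (\<integral>y. y \<partial>K x)"

lemma sets_p: "sets p = sets (borel_on (X \<times> Y))" and marginal2: "marginal2 Y p = \<nu>"
  and ac: "absolutely_continuous \<mu> m1"
  using plan by (auto simp: plans_ac_def space_prob_algebra)

sublocale p: prob_space p using plan by (auto simp: plans_ac_def space_prob_algebra)

lemma space_p: "space p = X \<times> Y" using sets_eq_imp_space_eq[OF sets_p] by (simp add: space_restrict_space)

lemma measurable_p: "measurable p N = measurable (borel_on (X \<times> Y)) N"
  by (rule measurable_cong_sets[OF sets_p refl])

lemma sets_m1[measurable_cong]: "sets m1 = sets (borel_on X)" by (simp add: marginal1_def)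

sublocale m1: prob_space m1 unfolding marginal1_def
  by (rule p.prob_space_distr) (simp add: measurable_p)

lemma disint: "disintegration X Y p K"
proof -
  have "Y \<in> sets borel" by (intro borel_closed compact_imp_closed compact_Y)
  moreover have "p \<in> borel_probs (X \<times> Y)" using plan by (simp add: plans_ac_def)
  ultimately have "\<exists>K. disintegration X Y p K" by (rule disintegration_exists[OF compact_X])
  from someI_ex[OF this] show ?thesis unfolding disint_kernel_def .
qed

lemma K_measurable[measurable]: "K \<in> borel_on X \<rightarrow>\<^sub>M prob_algebra (borel_on Y)"
  using disint by (simp add: disintegration_def)

lemma K_subprob[measurable]: "K \<in> borel_on X \<rightarrow>\<^sub>M subprob_algebra (borel_on Y)"
  by (rule measurable_prob_algebraD[OF K_measurable])

lemma K_space: assumes "x \<in> X" shows "prob_space (K x)" "sets (K x) = sets (borel_on Y)" "space (K x) = Y"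
proof -
  have "K x \<in> space (prob_algebra (borel_on Y))"
    using measurable_space[OF K_measurable] assms by (simp add: space_restrict_space)
  then show "prob_space (K x)" "sets (K x) = sets (borel_on Y)" by (auto simp: space_prob_algebra)
  then show "space (K x) = Y" using sets_eq_imp_space_eq[of "K x" "borel_on Y"] by (simp add: space_restrict_space)
qed

lemma density_\<rho>: "density \<mu> \<rho> = m1"
  by (rule mu.density_RN_deriv[OF ac]) (simp add: sets_m1 sets_mu)

lemma \<rho>_finite: "AE x in \<mu>. \<rho> x \<noteq> \<infinity>"
  by (rule mu.RN_deriv_finite[OF _ ac]) (auto simp: sets_m1 sets_mu m1.sigma_finite_measure_axioms)

lemma \<rho>_enn2real: "AE x in \<mu>. \<rho> x = ennreal (enn2real (\<rho> x))"
  using \<rho>_finite by eventually_elim (simp add: less_top)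

lemma Pair_measurable: "(\<lambda>z. z) \<in> borel_on X \<Otimes>\<^sub>M borel_on Y \<rightarrow>\<^sub>M borel_on (X \<times> Y)"
  using measurable_ident_sets[OF sets_borel_on_Times[OF compact_X, of Y, symmetric]] by simp

lemma Pair_measurable_x: "x \<in> X \<Longrightarrow> Pair x \<in> K x \<rightarrow>\<^sub>M borel_on (X \<times> Y)"
  using measurable_compose[OF measurable_Pair1'[of x "borel_on X" "borel_on Y"] Pair_measurable] K_space(2)
  by (simp add: space_restrict_space measurable_cong_sets[OF K_space(2) refl])

lemma kernel_graph: "(\<lambda>x. distr (K x) (borel_on (X \<times> Y)) (Pair x)) \<in> borel_on X \<rightarrow>\<^sub>M prob_algebra (borel_on (X \<times> Y))"
  by (rule measurable_distr_prob_space2[OF K_measurable]) (use Pair_measurable in \<open>simp add: case_prod_unfold\<close>)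

lemma p_eq_bind: "p = m1 \<bind> (\<lambda>x. distr (K x) (borel_on (X \<times> Y)) (Pair x))"
proof (rule measure_eqI)
  have g: "(\<lambda>x. distr (K x) (borel_on (X \<times> Y)) (Pair x)) \<in> m1 \<rightarrow>\<^sub>M prob_algebra (borel_on (X \<times> Y))"
    using kernel_graph by (simp add: measurable_cong_sets[OF sets_m1 refl])
  have sp: "m1 \<in> space (prob_algebra m1)" by (simp add: space_prob_algebra m1.prob_space_axioms)
  show "sets p = sets (m1 \<bind> (\<lambda>x. distr (K x) (borel_on (X \<times> Y)) (Pair x)))"
    using sets_bind[of m1 "\<lambda>x. distr (K x) (borel_on (X \<times> Y)) (Pair x)" "borel_on (X \<times> Y)"] m1.not_empty sets_p by simp
  fix C assume "C \<in> sets p"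
  then have C: "C \<in> sets (borel_on (X \<times> Y))" by (simp add: sets_p)
  have "emeasure (m1 \<bind> (\<lambda>x. distr (K x) (borel_on (X \<times> Y)) (Pair x))) C =
      (\<integral>\<^sup>+x. emeasure (distr (K x) (borel_on (X \<times> Y)) (Pair x)) C \<partial>m1)"
    by (rule emeasure_bind_prob_algebra[OF sp g C])
  also have "\<dots> = (\<integral>\<^sup>+x. emeasure (K x) (Pair x -` C) \<partial>m1)"
  proof (rule nn_integral_cong)
    fix x assume "x \<in> space m1"
    then have x: "x \<in> X" using sets_eq_imp_space_eq[OF sets_m1] by (simp add: space_restrict_space)
    have "Pair x -` C \<inter> space (K x) = Pair x -` C"
      using sets.sets_into_space[OF C] K_space(3)[OF x] by (auto simp: space_restrict_space)
    then show "emeasure (distr (K x) (borel_on (X \<times> Y)) (Pair x)) C = emeasure (K x) (Pair x -` C)"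
      using emeasure_distr[OF Pair_measurable_x[OF x] C] by simp
  qed
  also have "\<dots> = emeasure p C" using disint C by (auto simp: disintegration_def)
  finally show "emeasure p C = emeasure (m1 \<bind> (\<lambda>x. distr (K x) (borel_on (X \<times> Y)) (Pair x))) C" by simp
qed

lemma nn_integral_disint_measurable:
  assumes h: "h \<in> borel_measurable (borel_on (X \<times> Y))"
  shows "(\<lambda>x. \<integral>\<^sup>+y. h (x, y) \<partial>K x) \<in> borel_measurable (borel_on X)"
  by (rule nn_integral_measurable_subprob_algebra2[OF _ K_subprob])
     (use measurable_compose[OF Pair_measurable h] in \<open>simp add: case_prod_unfold\<close>)

lemma nn_integral_disint:
  assumes h: "h \<in> borel_measurable (borel_on (X \<times> Y))"
  shows "(\<integral>\<^sup>+z. h z \<partial>p) = (\<integral>\<^sup>+x. \<rho> x * (\<integral>\<^sup>+y. h (x, y) \<partial>K x) \<partial>\<mu>)"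
proof -
  have g: "(\<lambda>x. distr (K x) (borel_on (X \<times> Y)) (Pair x)) \<in> m1 \<rightarrow>\<^sub>M subprob_algebra (borel_on (X \<times> Y))"
    using measurable_prob_algebraD[OF kernel_graph] by (simp add: measurable_cong_sets[OF sets_m1 refl])
  have "(\<integral>\<^sup>+z. h z \<partial>p) = (\<integral>\<^sup>+x. \<integral>\<^sup>+z. h z \<partial>distr (K x) (borel_on (X \<times> Y)) (Pair x) \<partial>m1)"
    by (subst p_eq_bind) (rule nn_integral_bind[OF h g])
  also have "\<dots> = (\<integral>\<^sup>+x. \<integral>\<^sup>+y. h (x, y) \<partial>K x \<partial>m1)"
  proof (rule nn_integral_cong)
    fix x assume "x \<in> space m1"
    then have x: "x \<in> X" using sets_eq_imp_space_eq[OF sets_m1] by (simp add: space_restrict_space)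
    show "(\<integral>\<^sup>+z. h z \<partial>distr (K x) (borel_on (X \<times> Y)) (Pair x)) = (\<integral>\<^sup>+y. h (x, y) \<partial>K x)"
      using h by (subst nn_integral_distr[OF Pair_measurable_x[OF x]]) auto
  qed
  also have "\<dots> = (\<integral>\<^sup>+x. \<integral>\<^sup>+y. h (x, y) \<partial>K x \<partial>density \<mu> \<rho>)" by (simp add: density_\<rho>)
  also have "\<dots> = (\<integral>\<^sup>+x. \<rho> x * (\<integral>\<^sup>+y. h (x, y) \<partial>K x) \<partial>\<mu>)"
    using nn_integral_disint_measurable[OF h]
    by (intro nn_integral_density) (auto simp: measurable_mu)
  finally show ?thesis .
qed

lemma integral_disint_measurable:
  assumes h: "h \<in> borel_measurable (borel_on (X \<times> Y))"
  shows "(\<lambda>x. \<integral>y. h (x, y) \<partial>K x :: real) \<in> borel_measurable (borel_on X)"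
proof -
  have "(\<lambda>x. \<integral>z. h z \<partial>distr (K x) (borel_on (X \<times> Y)) (Pair x)) \<in> borel_measurable (borel_on X)"
    by (rule measurable_compose[OF measurable_prob_algebraD[OF kernel_graph] integral_measurable_subprob_algebra[OF h]])
  also have "?this \<longleftrightarrow> ?thesis"
    by (intro measurable_cong integral_distr Pair_measurable_x h) (simp add: space_restrict_space)
  finally show ?thesis .
qed

lemma \<rho>_integral: "integrable \<mu> (\<lambda>x. enn2real (\<rho> x))" "(\<integral>x. enn2real (\<rho> x) \<partial>\<mu>) = 1"
proof -
  have "(\<integral>\<^sup>+x. ennreal (enn2real (\<rho> x)) \<partial>\<mu>) = (\<integral>\<^sup>+x. \<rho> x \<partial>\<mu>)"
    by (rule nn_integral_cong_AE) (use \<rho>_enn2real in \<open>auto elim: eventually_mono\<close>)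
  also have "\<dots> = emeasure (density \<mu> \<rho>) (space \<mu>)"
    by (subst emeasure_density) (auto intro!: nn_integral_cong)
  also have "\<dots> = emeasure m1 (space m1)"
    using density_\<rho> sets_eq_imp_space_eq[OF sets_mu] sets_eq_imp_space_eq[OF sets_m1] by simp
  also have "\<dots> = 1" by (rule m1.emeasure_space_1)
  finally have *: "(\<integral>\<^sup>+x. ennreal (enn2real (\<rho> x)) \<partial>\<mu>) = 1" .
  then show "integrable \<mu> (\<lambda>x. enn2real (\<rho> x))" by (intro integrableI_nonneg) auto
  show "(\<integral>x. enn2real (\<rho> x) \<partial>\<mu>) = 1" using * by (subst integral_eq_nn_integral) auto
qed

text \<open>
  A bounded function is first treated under a sign condition, where the formula follows from the one
  for nonnegative integrals.
\<close>

lemma integral_disint_nonneg: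
  assumes h: "h \<in> borel_measurable (borel_on (X \<times> Y))" and B: "\<And>z. z \<in> X \<times> Y \<Longrightarrow> 0 \<le> h z" "\<And>z. z \<in> X \<times> Y \<Longrightarrow> h z \<le> (B::real)"
  shows "(\<integral>z. h z \<partial>p) = (\<integral>x. enn2real (\<rho> x) * (\<integral>y. h (x, y) \<partial>K x) \<partial>\<mu>)"
proof -
  have hx: "(\<lambda>y. h (x, y)) \<in> borel_measurable (K x)" if "x \<in> X" for x
    using measurable_compose[OF Pair_measurable_x[OF that] h] .
  have "(\<integral>z. h z \<partial>p) = enn2real (\<integral>\<^sup>+z. ennreal (h z) \<partial>p)"
    using h B by (intro integral_eq_nn_integral) (auto simp: measurable_p space_p intro!: AE_I2)
  also have "(\<integral>\<^sup>+z. ennreal (h z) \<partial>p) = (\<integral>\<^sup>+x. \<rho> x * (\<integral>\<^sup>+y. ennreal (h (x, y)) \<partial>K x) \<partial>\<mu>)"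
    using h by (intro nn_integral_disint) auto
  also have "\<dots> = (\<integral>\<^sup>+x. ennreal (enn2real (\<rho> x) * (\<integral>y. h (x, y) \<partial>K x)) \<partial>\<mu>)"
  proof (rule nn_integral_cong_AE, use \<rho>_enn2real AE_space[of \<mu>] in eventually_elim)
    case (elim x)
    then have x: "x \<in> X" by (simp add: space_mu)
    interpret Kx: prob_space "K x" using K_space(1)[OF x] .
    have "integrable (K x) (\<lambda>y. h (x, y))"
      using hx[OF x] B x by (intro Kx.integrable_const_bound[where B=B]) (auto simp: K_space(3)[OF x] intro!: AE_I2)
    then have "(\<integral>\<^sup>+y. ennreal (h (x, y)) \<partial>K x) = ennreal (\<integral>y. h (x, y) \<partial>K x)"
      using B x by (intro nn_integral_eq_integral) (auto simp: K_space(3)[OF x] intro!: AE_I2)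
    then show ?case
      by (subst elim(1)) (simp add: ennreal_mult')
  qed
  also have "enn2real \<dots> = (\<integral>x. enn2real (\<rho> x) * (\<integral>y. h (x, y) \<partial>K x) \<partial>\<mu>)"
  proof (rule integral_eq_nn_integral[symmetric])
    show "(\<lambda>x. enn2real (\<rho> x) * (\<integral>y. h (x, y) \<partial>K x)) \<in> borel_measurable \<mu>"
      using integral_disint_measurable[OF h] by (simp add: measurable_mu)
    show "AE x in \<mu>. 0 \<le> enn2real (\<rho> x) * (\<integral>y. h (x, y) \<partial>K x)"
      using B by (intro AE_I2 mult_nonneg_nonneg integral_nonneg_AE) (auto simp: K_space(3) space_mu intro!: AE_I2)
  qed
  finally show ?thesis .
qed

lemma integral_disint:
  assumes h: "h \<in> borel_measurable (borel_on (X \<times> Y))" and B: "\<And>z. z \<in> X \<times> Y \<Longrightarrow> \<bar>h z\<bar> \<le> (B::real)"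
  shows "integrable \<mu> (\<lambda>x. enn2real (\<rho> x) * (\<integral>y. h (x, y) \<partial>K x))"
    "(\<integral>z. h z \<partial>p) = (\<integral>x. enn2real (\<rho> x) * (\<integral>y. h (x, y) \<partial>K x) \<partial>\<mu>)"
proof -
  have hx: "integrable (K x) (\<lambda>y. h (x, y))" if x: "x \<in> X" for x
  proof -
    interpret Kx: prob_space "K x" using K_space(1)[OF x] .
    show ?thesis using measurable_compose[OF Pair_measurable_x[OF x] h] B x
      by (intro Kx.integrable_const_bound[where B=B]) (auto simp: K_space(3)[OF x] intro!: AE_I2)
  qed
  have hp: "integrable p h"
    using h B by (intro p.integrable_const_bound[where B=B]) (auto simp: measurable_p space_p intro!: AE_I2)
  have bd: "\<bar>\<integral>y. h (x, y) \<partial>K x\<bar> \<le> B" if x: "x \<in> X" for x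
  proof -
    interpret Kx: prob_space "K x" using K_space(1)[OF x] .
    have "(\<integral>y. h (x, y) \<partial>K x) \<le> B" "- B \<le> (\<integral>y. h (x, y) \<partial>K x)"
      using B x by (auto intro!: Kx.integral_le_const Kx.integral_ge_const hx AE_I2 simp: K_space(3)[OF x] abs_le_iff)
        (smt (verit) B SigmaI)
    then show ?thesis by simp
  qed
  show int: "integrable \<mu> (\<lambda>x. enn2real (\<rho> x) * (\<integral>y. h (x, y) \<partial>K x))"
  proof (rule Bochner_Integration.integrable_bound[OF integrable_mult_left[OF \<rho>_integral(1), of B]])
    show "(\<lambda>x. enn2real (\<rho> x) * (\<integral>y. h (x, y) \<partial>K x)) \<in> borel_measurable \<mu>"
      using integral_disint_measurable[OF h] by (simp add: measurable_mu)
    show "AE x in \<mu>. norm (enn2real (\<rho> x) * (\<integral>y. h (x, y) \<partial>K x)) \<le> norm (enn2real (\<rho> x) * B)"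
      using bd by (intro AE_I2) (force simp: space_mu abs_mult intro!: mult_left_mono)
  qed
  have "(\<integral>z. h z + B \<partial>p) = (\<integral>x. enn2real (\<rho> x) * (\<integral>y. h (x, y) + B \<partial>K x) \<partial>\<mu>)"
  proof (rule integral_disint_nonneg)
    show "0 \<le> h z + B" "h z + B \<le> 2 * B" if "z \<in> X \<times> Y" for z using B[OF that] by (auto simp: abs_le_iff)
  qed (use h in measurable)
  moreover have "(\<integral>z. h z + B \<partial>p) = (\<integral>z. h z \<partial>p) + B" using hp by (simp add: p.prob_space)
  moreover have "(\<integral>x. enn2real (\<rho> x) * (\<integral>y. h (x, y) + B \<partial>K x) \<partial>\<mu>) =
    (\<integral>x. enn2real (\<rho> x) * (\<integral>y. h (x, y) \<partial>K x) + enn2real (\<rho> x) * B \<partial>\<mu>)"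
  proof (rule Bochner_Integration.integral_cong[OF refl])
    fix x assume "x \<in> space \<mu>"
    then have x: "x \<in> X" by (simp add: space_mu)
    interpret Kx: prob_space "K x" using K_space(1)[OF x] .
    show "enn2real (\<rho> x) * (\<integral>y. h (x, y) + B \<partial>K x) = enn2real (\<rho> x) * (\<integral>y. h (x, y) \<partial>K x) + enn2real (\<rho> x) * B"
      using hx[OF x] by (simp add: Kx.prob_space distrib_left)
  qed
  moreover have "\<dots> = (\<integral>x. enn2real (\<rho> x) * (\<integral>y. h (x, y) \<partial>K x) \<partial>\<mu>) + B"
    using int \<rho>_integral by simp
  ultimately show "(\<integral>z. h z \<partial>p) = (\<integral>x. enn2real (\<rho> x) * (\<integral>y. h (x, y) \<partial>K x) \<partial>\<mu>)" by simp
qed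

lemma integrable_K: "x \<in> X \<Longrightarrow> integrable (K x) (\<lambda>y. y)"
proof -
  assume x: "x \<in> X"
  interpret Kx: prob_space "K x" using K_space(1)[OF x] .
  show ?thesis
    using R(2)[OF hull_inc]
    by (intro Kx.integrable_const_bound[where B=R])
       (auto intro!: AE_I2 measurable_restrict_space1 simp: K_space(3)[OF x] measurable_cong_sets[OF K_space(2)[OF x] refl])
qed

lemma bary_in_co: assumes x: "x \<in> X" shows "(\<integral>y. y \<partial>K x) \<in> convex hull Y"
proof -
  interpret Kx: prob_space "K x" using K_space(1)[OF x] .
  show ?thesis
    by (rule Kx.integral_in_closed_convex[OF integrable_K[OF x]])
       (auto intro!: AE_I2 hull_inc simp: K_space(3)[OF x] compact_imp_closed compact_co)
qed

lemma S_in_Z: "x \<in> X \<Longrightarrow> S x \<in> Z"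
  unfolding S_def by (intro scale_in_Z) (use bary_in_co co_subset_Z in auto)

lemma S_measurable[measurable]: "S \<in> borel_measurable \<mu>"
proof -
  have "(\<lambda>y. y) \<in> borel_measurable (borel_on Y)" by (simp add: measurable_restrict_space1)
  from measurable_compose[OF K_subprob integral_measurable_subprob_algebra[OF this]]
  have "(\<lambda>x. \<integral>y. y \<partial>K x) \<in> borel_measurable \<mu>" by (simp add: measurable_mu)
  then show ?thesis unfolding S_def[abs_def] by measurable
qed

lemma S_integrable: "integrable \<mu> S"
proof (rule Bochner_Integration.integrable_bound[OF integrable_mult_left[OF \<rho>_integral(1), of R]])
  show "AE x in \<mu>. norm (S x) \<le> norm (enn2real (\<rho> x) * R)"
    using R(1) by (intro AE_I2) (auto simp: space_mu S_def abs_mult intro!: mult_left_mono R(2) bary_in_co)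
qed measurable

text \<open>
  Testing a plan against functions linear in \<open>y\<close> sees only the barycentric map.
\<close>

lemma integral_inner_S:
  assumes w: "w \<in> borel_measurable (borel_on X)" and B: "\<And>x. x \<in> X \<Longrightarrow> norm (w x) \<le> B"
  shows "integrable \<mu> (\<lambda>x. w x \<bullet> S x)" "(\<integral>z. w (fst z) \<bullet> snd z \<partial>p) = (\<integral>x. w x \<bullet> S x \<partial>\<mu>)"
proof -
  have m: "(\<lambda>z. w (fst z) \<bullet> snd z) \<in> borel_measurable (borel_on (X \<times> Y))"
  proof (rule borel_measurable_inner)
    show "(\<lambda>z. w (fst z)) \<in> borel_measurable (borel_on (X \<times> Y))"
      by (rule measurable_compose[OF fst_measurable_borel_on w])
    show "snd \<in> borel_measurable (borel_on (X \<times> Y))"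
    proof -
      have "(\<lambda>y. y) \<in> borel_measurable (borel_on Y)" by (simp add: measurable_restrict_space1)
      from measurable_compose[OF snd_measurable_borel_on this] show ?thesis .
    qed
  qed
  have b: "\<bar>w (fst z) \<bullet> snd z\<bar> \<le> B * R" if "z \<in> X \<times> Y" for z
  proof -
    have "\<bar>w (fst z) \<bullet> snd z\<bar> \<le> norm (w (fst z)) * norm (snd z)" by (rule Cauchy_Schwarz_ineq2)
    also have "\<dots> \<le> B * R" using that B[of "fst z"] R(2)[OF hull_inc, of "snd z"]
        order_trans[OF norm_ge_zero B[of "fst z"]]
      by (intro mult_mono) auto
    finally show ?thesis .
  qed
  have eq: "enn2real (\<rho> x) * (\<integral>y. w x \<bullet> y \<partial>K x) = w x \<bullet> S x" if "x \<in> X" for x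
    using integrable_K[OF that] by (simp add: S_def)
  have "integrable \<mu> (\<lambda>x. enn2real (\<rho> x) * (\<integral>y. w x \<bullet> y \<partial>K x))"
    using integral_disint(1)[OF m b] by simp
  then show "integrable \<mu> (\<lambda>x. w x \<bullet> S x)"
    using eq by (subst (asm) Bochner_Integration.integrable_cong[OF refl, of _ _ "\<lambda>x. w x \<bullet> S x"]) (auto simp: space_mu)
  have "(\<integral>z. w (fst z) \<bullet> snd z \<partial>p) = (\<integral>x. enn2real (\<rho> x) * (\<integral>y. w x \<bullet> y \<partial>K x) \<partial>\<mu>)"
    using integral_disint(2)[OF m b] by simp
  also have "\<dots> = (\<integral>x. w x \<bullet> S x \<partial>\<mu>)"
    using eq by (intro Bochner_Integration.integral_cong) (auto simp: space_mu)
  finally show "(\<integral>z. w (fst z) \<bullet> snd z \<partial>p) = (\<integral>x. w x \<bullet> S x \<partial>\<mu>)" .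
qed


text \<open>
  \<open>F\<close> is nonpositive and bounded below by \<open>- (e \<bullet> z) - M\<close>, and
  \<open>S\<close> is integrable.
\<close>

lemma cost_integrable: "integrable \<mu> (\<lambda>x. F x (S x))"
proof -
  obtain M where M: "\<And>x z. x \<in> X \<Longrightarrow> z \<in> Z \<Longrightarrow> - 1 * (e \<bullet> z) - M \<le> F x z"
    using sublinear_lower_bound[of 1] by auto
  show ?thesis
  proof (rule Bochner_Integration.integrable_bound[of _ "\<lambda>x. e \<bullet> S x + M"])
    show "integrable \<mu> (\<lambda>x. e \<bullet> S x + M)" using S_integrable by simp
    have S': "S \<in> borel_on X \<rightarrow>\<^sub>M borel_on Z"
      using S_measurable S_in_Z
      by (intro measurable_restrict_space2) (auto simp: measurable_mu space_restrict_space)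
    have "(\<lambda>x. (x, S x)) \<in> borel_on X \<rightarrow>\<^sub>M borel_on (X \<times> Z)"
      using measurable_Pair[OF measurable_ident S']
      by (simp add: measurable_cong_sets[OF refl sets_borel_on_Times[OF compact_X]])
    from measurable_compose[OF this borel_measurable_continuous_on_restrict[OF continuous_F]]
    show "(\<lambda>x. F x (S x)) \<in> borel_measurable \<mu>" by (simp add: measurable_mu)
    have "norm (F x (S x)) \<le> norm (e \<bullet> S x + M)" if "x \<in> X" for x
      using M[OF that S_in_Z[OF that]] F_nonpos[OF that S_in_Z[OF that]] by simp
    then show "AE x in \<mu>. norm (F x (S x)) \<le> norm (e \<bullet> S x + M)" by (auto simp: space_mu)
  qed
qed

lemma transport_cost_eq: "transport_cost X Y (barycentric_cost F) \<mu> p = ereal (\<integral>x. F x (S x) \<partial>\<mu>)"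
proof -
  have "AE x in \<mu>. barycentric_cost F x (scale_measure (\<rho> x) (K x)) = ereal (F x (S x))"
    using \<rho>_enn2real AE_space
  proof eventually_elim
    case (elim x)
    then have x: "x \<in> X" by (simp add: space_mu)
    have "(\<lambda>y. y) \<in> borel_measurable (K x)" using integrable_K[OF x] by auto
    then have "(\<integral>y. y \<partial>scale_measure (\<rho> x) (K x)) = S x"
      unfolding S_def by (subst elim(1)) (rule integral_scale_measure_ennreal, auto)
    then show ?case by (simp add: barycentric_cost_def)
  qed
  then have "transport_cost X Y (barycentric_cost F) \<mu> p = ext_integral \<mu> (\<lambda>x. ereal (F x (S x)))"
    unfolding transport_cost_def by (rule ext_integral_cong_AE)
  also have "\<dots> = ereal (\<integral>x. F x (S x) \<partial>\<mu>)"
    using F_nonpos S_in_Z by (intro ext_integral_real_nonpos cost_integrable AE_I2) (auto simp: space_mu)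
  finally show ?thesis .
qed

text \<open>
  The epigraph of \<open>\<phi>\<close> over \<open>Z\<close> is closed by lower semicontinuity and
  convex, so it contains the barycentre of the law of \<open>(y, \<phi> y)\<close> under \<open>K
  x\<close>. Homogeneity then reintroduces the factor \<open>\<rho> x\<close>. The function \<open>g
  x = \<integral>y. \<phi> y \<partial>q\<^sup>x\<close> replaces \<open>\<phi> \<circ> S\<close>
  because its integral is computed from the second marginal.
\<close>

lemma jensen:
  assumes \<phi>: "\<phi> \<in> dual_candidates"
  shows "\<exists>g. integrable \<mu> g \<and> (\<integral>x. g x \<partial>\<mu>) = enn2real (\<integral>\<^sup>+y. e2ennreal (\<phi> y) \<partial>\<nu>) \<and>
    (AE x in \<mu>. \<phi> (S x) \<le> ereal (g x) \<and> 0 \<le> g x)"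
proof -
  note \<phi>_props = dual_candidate[OF \<phi>]
  have \<phi>m: "(\<lambda>y. e2ennreal (\<phi> y)) \<in> borel_measurable (borel_on Y)"
    using \<phi>_props(5) by (simp add: measurable_nu)
  have hm: "(\<lambda>z. e2ennreal (\<phi> (snd z))) \<in> borel_measurable (borel_on (X \<times> Y))"
    by (rule measurable_compose[OF snd_measurable_borel_on \<phi>m])
  define G where "G x = \<rho> x * (\<integral>\<^sup>+y. e2ennreal (\<phi> y) \<partial>K x)" for x
  have Gm: "G \<in> borel_measurable \<mu>"
    unfolding G_def using nn_integral_disint_measurable[OF hm]
    by (simp add: measurable_mu)
  have GI: "(\<integral>\<^sup>+x. G x \<partial>\<mu>) = (\<integral>\<^sup>+y. e2ennreal (\<phi> y) \<partial>\<nu>)"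
  proof -
    have "(\<integral>\<^sup>+x. G x \<partial>\<mu>) = (\<integral>\<^sup>+z. e2ennreal (\<phi> (snd z)) \<partial>p)"
      unfolding G_def using nn_integral_disint[OF hm] by simp
    also have "\<dots> = (\<integral>\<^sup>+y. e2ennreal (\<phi> y) \<partial>marginal2 Y p)"
      unfolding marginal2_def using \<phi>m by (subst nn_integral_distr) (auto simp: measurable_p)
    finally show ?thesis by (simp add: marginal2)
  qed
  have Gfin: "AE x in \<mu>. G x \<noteq> \<infinity>"
    using GI \<phi>_props(6) Gm by (intro nn_integral_PInf_AE) auto
  define g where "g x = enn2real (G x)" for x
  have gG: "AE x in \<mu>. ennreal (g x) = G x" using Gfin by eventually_elim (simp add: g_def less_top)
  have gm: "g \<in> borel_measurable \<mu>" unfolding g_def using Gm by measurable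
  have gI: "(\<integral>\<^sup>+x. ennreal (g x) \<partial>\<mu>) = (\<integral>\<^sup>+y. e2ennreal (\<phi> y) \<partial>\<nu>)"
    unfolding GI[symmetric] using gG by (intro nn_integral_cong_AE) auto
  have "AE x in \<mu>. \<phi> (S x) \<le> ereal (g x)"
    using gG \<rho>_enn2real AE_space
  proof eventually_elim
    case (elim x)
    then have x: "x \<in> X" by (simp add: space_mu)
    interpret Kx: prob_space "K x" using K_space(1)[OF x] .
    show ?case
    proof (cases "enn2real (\<rho> x) = 0")
      case True
      then show ?thesis by (simp add: S_def \<phi>_props(8) g_def)
    next
      case False
      define t where "t = enn2real (\<rho> x)"
      have t: "0 < t" using False enn2real_nonneg[of "\<rho> x"] unfolding t_def by linarith
      define I where "I = (\<integral>\<^sup>+y. e2ennreal (\<phi> y) \<partial>K x)"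
      have tI: "ennreal (g x) = ennreal t * I" using elim(1,2) by (simp add: G_def t_def I_def)
      then have Ifin: "I < \<infinity>" using t
        by (metis ennreal_mult_eq_top_iff ennreal_neq_top ennreal_eq_0_iff infinity_ennreal_def less_top not_le)
      have \<phi>Km: "\<phi> \<in> borel_measurable (K x)"
        using \<phi>_props(5) by (simp add: measurable_nu measurable_cong_sets[OF K_space(2)[OF x] refl])
      have "AE y in K x. e2ennreal (\<phi> y) \<noteq> \<infinity>"
        using Ifin \<phi>Km unfolding I_def by (intro nn_integral_PInf_AE) auto
      then have fin: "AE y in K x. \<phi> y < \<infinity> \<and> y \<in> Y"
        using AE_space by eventually_elim (auto simp: less_top K_space(3)[OF x])
      define f where "f y = real_of_ereal (\<phi> y)" for y
      have f: "AE y in K x. \<phi> y = ereal (f y) \<and> 0 \<le> f y \<and> y \<in> Y"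
        using fin
      proof eventually_elim
        case (elim y)
        then have "0 \<le> \<phi> y" using \<phi>_props(1) Y_subset_Z by auto
        then show ?case using elim by (cases "\<phi> y") (auto simp: f_def)
      qed
      have fm: "f \<in> borel_measurable (K x)" unfolding f_def using \<phi>Km by measurable
      have fI: "(\<integral>\<^sup>+y. ennreal (f y) \<partial>K x) = I"
        unfolding I_def using f by (intro nn_integral_cong_AE) (auto elim!: eventually_mono)
      have fi: "integrable (K x) f"
        using fm f fI Ifin by (intro integrableI_nonneg) (auto elim: eventually_mono)
      have fval: "ennreal (\<integral>y. f y \<partial>K x) = I"
        using fI f fi by (subst nn_integral_eq_integral[symmetric]) (auto elim: eventually_mono)
      define Epi where "Epi = {(z, r). z \<in> Z \<and> \<phi> z \<le> ereal r}"
      have "convex Epi"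
        unfolding convex_def
      proof (intro ballI allI impI)
        fix v w :: "'b \<times> real" and s t :: real
        assume v: "v \<in> Epi" and w: "w \<in> Epi" and st: "0 \<le> s" "0 \<le> t" "s + t = 1"
        have "\<phi> (s *\<^sub>R fst v + t *\<^sub>R fst w) \<le> ereal s * \<phi> (fst v) + ereal t * \<phi> (fst w)"
          using \<phi>_props(3) v w st unfolding ext_convex_on_def Epi_def by auto
        also have "\<dots> \<le> ereal s * ereal (snd v) + ereal t * ereal (snd w)"
          using v w st unfolding Epi_def by (intro add_mono ereal_mult_left_mono) auto
        finally show "s *\<^sub>R v + t *\<^sub>R w \<in> Epi"
          using v w st convex_Z unfolding Epi_def convex_def by auto
      qed
      moreover have "closed Epi"
        unfolding closed_sequential_limits
      proof (intro allI impI, elim conjE)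
        fix q l assume q: "\<forall>n. q n \<in> Epi" "q \<longlonglongrightarrow> l"
        have l1: "(\<lambda>n. fst (q n)) \<longlonglongrightarrow> fst l" and l2: "(\<lambda>n. snd (q n)) \<longlonglongrightarrow> snd l"
          using q(2) by (auto intro: tendsto_fst tendsto_snd)
        have qn: "fst (q n) \<in> Z" "\<phi> (fst (q n)) \<le> ereal (snd (q n))" for n
          using q(1)[rule_format, of n] by (simp_all add: Epi_def case_prod_unfold)
        have lZ: "fst l \<in> Z" using closed_sequentially[OF closed_Z qn(1) l1] .
        have "\<phi> (fst l) \<le> ereal (snd l)"
        proof (rule ccontr)
          assume "\<not> \<phi> (fst l) \<le> ereal (snd l)"
          then obtain r where r: "ereal (snd l) < ereal r" "ereal r < \<phi> (fst l)"
            using ereal_dense2[of "ereal (snd l)" "\<phi> (fst l)"] by (auto simp: not_le)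
          have "ereal r < Liminf (at (fst l) within Z) \<phi>"
            using \<phi>_props(2) lZ r(2) unfolding lsc_on_def by (meson less_le_trans)
          then have "eventually (\<lambda>z. ereal r < \<phi> z) (at (fst l) within Z)" by (rule less_LiminfD)
          then obtain W where W: "open W" "fst l \<in> W" "\<And>z. z \<in> W \<Longrightarrow> z \<noteq> fst l \<Longrightarrow> z \<in> Z \<Longrightarrow> ereal r < \<phi> z"
            unfolding eventually_at_topological by blast
          have "eventually (\<lambda>n. fst (q n) \<in> W) sequentially"
            using l1 W(1,2) by (rule topological_tendstoD)
          moreover have "eventually (\<lambda>n. snd (q n) < r) sequentially"
            using l2 r(1) by (intro order_tendstoD) auto
          ultimately have "eventually (\<lambda>n. False) sequentially"
          proof eventually_elim
            case (elim n)
            have "ereal r < \<phi> (fst (q n))" using W(3)[OF elim(1) _ qn(1)] r(2) by (cases "fst (q n) = fst l") auto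
            also have "\<dots> < ereal r" using qn(2)[of n] elim(2) by (meson ereal_less(2) less_ereal.simps(1) le_less_trans)
            finally have "ereal r < ereal r" .
            then show ?case by simp
          qed
          then show False by simp
        qed
        then show "l \<in> Epi" using lZ by (auto simp: Epi_def case_prod_unfold)
      qed
      moreover have "integrable (K x) (\<lambda>y. (y, f y))"
        using integrable_K[OF x] fi by (rule integral_of_Pair)
      moreover have "AE y in K x. (y, f y) \<in> Epi"
        using f by eventually_elim (use Y_subset_Z in \<open>auto simp: Epi_def\<close>)
      ultimately have "(\<integral>y. (y, f y) \<partial>K x) \<in> Epi" by (intro Kx.integral_in_closed_convex)
      moreover have "(\<integral>y. (y, f y) \<partial>K x) = ((\<integral>y. y \<partial>K x), (\<integral>y. f y \<partial>K x))"
        using integrable_K[OF x] fi by (rule integral_of_Pair)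
      ultimately have b: "(\<integral>y. y \<partial>K x) \<in> Z" "\<phi> (\<integral>y. y \<partial>K x) \<le> ereal (\<integral>y. f y \<partial>K x)"
        by (auto simp: Epi_def)
      have "\<phi> (S x) = ereal t * \<phi> (\<integral>y. y \<partial>K x)"
        unfolding S_def t_def[symmetric] using \<phi>_props(4) b t unfolding pos_homogeneous_on_def
        by (metis ereal_infty_less(1) ereal_less_eq(1) less_imp_le not_le ereal_less(2) ereal_infty_less_eq(1) PInfty_neq_ereal(1))
      also have "\<dots> \<le> ereal t * ereal (\<integral>y. f y \<partial>K x)"
        using b t by (intro ereal_mult_left_mono) auto
      also have "\<dots> = ereal (g x)"
      proof -
        have f0: "0 \<le> (\<integral>y. f y \<partial>K x)" using f by (intro integral_nonneg_AE) (auto elim: eventually_mono)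
        have "ennreal (g x) = ennreal (t * (\<integral>y. f y \<partial>K x))"
          using tI fval t f0 by (simp add: ennreal_mult)
        then have "g x = t * (\<integral>y. f y \<partial>K x)" using t f0 by (simp add: g_def)
        then show ?thesis by simp
      qed
      finally show ?thesis .
    qed
  qed
  moreover have "integrable \<mu> g"
    using gm gI \<phi>_props(6) by (intro integrableI_nonneg) (auto simp: g_def)
  moreover have "(\<integral>x. g x \<partial>\<mu>) = enn2real (\<integral>\<^sup>+y. e2ennreal (\<phi> y) \<partial>\<nu>)"
    using gm gI by (subst integral_eq_nn_integral) (auto simp: g_def)
  ultimately show ?thesis by (intro exI[of _ g]) (auto simp: g_def)
qed

lemma e_inner_integral: "(\<integral>x. e \<bullet> S x \<partial>\<mu>) \<le> E"
proof -
  have "(\<integral>x. e \<bullet> S x \<partial>\<mu>) = (\<integral>z. e \<bullet> snd z \<partial>p)"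
    using integral_inner_S(2)[of "\<lambda>_. e" "norm e"] by simp
  also have "\<dots> \<le> E"
  proof (rule p.integral_le_const)
    have "(\<lambda>y. y) \<in> borel_measurable (borel_on Y)" by (simp add: measurable_restrict_space1)
    from measurable_compose[OF snd_measurable_borel_on this] have "snd \<in> borel_measurable p" by (simp add: measurable_p)
    then show "integrable p (\<lambda>z. e \<bullet> snd z)"
      using e_le_E e_ge_1 by (intro p.integrable_const_bound[where B=E] AE_I2) (force simp: space_p abs_le_iff)+
    show "AE z in p. e \<bullet> snd z \<le> E" using e_le_E by (intro AE_I2) (auto simp: space_p)
  qed
  finally show ?thesis .
qed

end

section \<open>Weak duality and plans given by a density\<close>

context barycentric_problem
begin

abbreviation cost where "cost \<equiv> transport_cost X Y (barycentric_cost F) \<mu>"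
abbreviation plans where "plans \<equiv> plans_ac X Y \<mu> \<nu>"
abbreviation Q where "Q \<equiv> Q_trans Z F"

lemma Q_le: "z \<in> Z \<Longrightarrow> Q \<phi> x \<le> \<phi> z + ereal (F x z)"
  unfolding Q_trans_def by (rule INF_lower)

lemma Q_nonpos: assumes "\<phi> 0 = 0" "x \<in> X" shows "Q \<phi> x \<le> 0"
  using Q_le[OF zero_in_Z, of \<phi> x] F_nonpos[OF assms(2) zero_in_Z] assms(1) order_trans by fastforce

text \<open>
  An arbitrary infimum of functions that are continuous in \<open>x\<close> is upper semicontinuous.
\<close>

lemma Q_measurable:
  assumes nonneg: "\<And>z. z \<in> Z \<Longrightarrow> 0 \<le> \<phi> z"
  shows "Q \<phi> \<in> borel_measurable \<mu>"
proof (rule borel_measurableI_less)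
  fix y :: ereal
  have op: "openin (top_of_set X) {x \<in> X. \<phi> z + ereal (F x z) < y}" if z: "z \<in> Z" for z
  proof (cases "\<phi> z")
    case (real r)
    have "continuous_on X (\<lambda>x. ereal (r + F x z))"
      using continuous_F_x[OF z] by (intro continuous_on_ereal continuous_intros)
    from continuous_openin_preimage_gen[OF this open_lessThan[of y]]
    show ?thesis using real by (simp add: vimage_def Int_def)
  next
    case PInf
    then show ?thesis by simp
  next
    case MInf
    then show ?thesis using nonneg[OF z] by simp
  qed
  have "{x \<in> space \<mu>. Q \<phi> x < y} = (\<Union>z\<in>Z. {x \<in> X. \<phi> z + ereal (F x z) < y})"
    by (auto simp: Q_trans_def INF_less_iff space_mu)
  moreover have "openin (top_of_set X) (\<Union>z\<in>Z. {x \<in> X. \<phi> z + ereal (F x z) < y})"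
    using op by (intro openin_Union) auto
  ultimately obtain T where "open T" "{x \<in> space \<mu>. Q \<phi> x < y} = X \<inter> T"
    by (auto simp: openin_open)
  then show "{x \<in> space \<mu>. Q \<phi> x < y} \<in> sets \<mu>"
    by (auto simp: sets_mu sets_restrict_space)
qed

text \<open>
  For a dual candidate both terms of the dual objective are nonpositive; their absolute values are
  kept as extended nonnegative numbers, so that no difference of infinities can arise.
\<close>

definition Q_loss where "Q_loss \<phi> = (\<integral>\<^sup>+x. e2ennreal (- Q \<phi> x) \<partial>\<mu>)"
definition price where "price \<phi> = (\<integral>\<^sup>+y. e2ennreal (\<phi> y) \<partial>\<nu>)"

lemma dual_objective_eq:
  assumes "\<phi> \<in> dual_candidates"
  shows "dual_objective Z F \<mu> \<nu> \<phi> = - enn2ereal (Q_loss \<phi> + price \<phi>)"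
proof -
  have "ext_integral \<mu> (Q \<phi>) = - enn2ereal (Q_loss \<phi>)"
    unfolding Q_loss_def using Q_nonpos[of \<phi>] dual_candidate(8)[OF assms]
    by (intro ext_integral_nonpos AE_I2) (simp add: space_mu)
  moreover have "ext_integral \<nu> \<phi> = enn2ereal (price \<phi>)"
    unfolding price_def by (rule dual_candidate(9)[OF assms])
  ultimately show ?thesis
    unfolding dual_objective_def plus_ennreal.rep_eq
    by (cases "enn2ereal (Q_loss \<phi>)"; cases "enn2ereal (price \<phi>)") auto
qed

text \<open>
  By Jensen, \<open>Q \<phi> x \<le> g x + F x (S x)\<close> almost everywhere, where \<open>g\<close>
  integrates to the price of \<open>\<phi>\<close>. Only the truncated difference \<open>- F -
  g\<close> may be compared with \<open>- Q \<phi>\<close> in the extended nonnegative numbers.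
\<close>

lemma weak_duality:
  assumes \<phi>: "\<phi> \<in> dual_candidates" and p: "p \<in> plans"
  shows "dual_objective Z F \<mu> \<nu> \<phi> \<le> cost p"
proof -
  interpret P: barycentric_plan X Y Z F a u \<mu> \<nu> p by unfold_locales (rule p)
  obtain g where g: "integrable \<mu> g" "(\<integral>x. g x \<partial>\<mu>) = enn2real (price \<phi>)"
      "AE x in \<mu>. \<phi> (P.S x) \<le> ereal (g x) \<and> 0 \<le> g x"
    using P.jensen[OF \<phi>] unfolding price_def by blast
  have pf: "price \<phi> < \<infinity>" using dual_candidate(6)[OF \<phi>] by (simp add: price_def)
  have F0: "AE x in \<mu>. F x (P.S x) \<le> 0" using F_nonpos P.S_in_Z by (intro AE_I2) (auto simp: space_mu)
  have [measurable]: "(\<lambda>x. e2ennreal (- Q \<phi> x)) \<in> borel_measurable \<mu>" "g \<in> borel_measurable \<mu>"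
    using Q_measurable[OF dual_candidate(1)[OF \<phi>]] g by auto
  have "ennreal (- (\<integral>x. F x (P.S x) \<partial>\<mu>)) = (\<integral>\<^sup>+x. ennreal (- F x (P.S x)) \<partial>\<mu>)"
    using P.cost_integrable F0 by (subst nn_integral_eq_integral) auto
  also have "\<dots> \<le> (\<integral>\<^sup>+x. e2ennreal (- Q \<phi> x) + ennreal (g x) \<partial>\<mu>)"
  proof (rule nn_integral_mono_AE, use g(3) AE_space in eventually_elim)
    case (elim x)
    have "Q \<phi> x \<le> \<phi> (P.S x) + ereal (F x (P.S x))" using elim by (intro Q_le P.S_in_Z) (simp add: space_mu)
    also have "\<dots> \<le> ereal (g x + F x (P.S x))" using elim by (simp add: add_right_mono flip: plus_ereal.simps(1))
    finally have "ereal (- F x (P.S x) - g x) \<le> - Q \<phi> x"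
      by (cases "Q \<phi> x") auto
    from e2ennreal_mono[OF this] have "ennreal (- F x (P.S x) - g x) \<le> e2ennreal (- Q \<phi> x)"
      by simp
    then have "ennreal (- F x (P.S x) - g x) + ennreal (g x) \<le> e2ennreal (- Q \<phi> x) + ennreal (g x)"
      by (rule add_right_mono)
    moreover have "ennreal (- F x (P.S x)) \<le> ennreal (- F x (P.S x) - g x) + ennreal (g x)"
    proof (cases "0 \<le> - F x (P.S x) - g x")
      case True
      then show ?thesis using elim by (subst ennreal_plus[symmetric]) auto
    next
      case False
      then have "ennreal (- F x (P.S x)) \<le> ennreal (g x)" by (intro ennreal_leI) simp
      also have "\<dots> \<le> ennreal (- F x (P.S x) - g x) + ennreal (g x)" by (simp add: add_increasing)
      finally show ?thesis .
    qed
    ultimately show ?case by (rule order_trans[rotated])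
  qed
  also have "\<dots> = Q_loss \<phi> + (\<integral>\<^sup>+x. ennreal (g x) \<partial>\<mu>)"
    unfolding Q_loss_def by (rule nn_integral_add) measurable
  also have "(\<integral>\<^sup>+x. ennreal (g x) \<partial>\<mu>) = price \<phi>"
    using g pf by (subst nn_integral_eq_integral) (auto simp: less_top)
  finally have "ennreal (- (\<integral>x. F x (P.S x) \<partial>\<mu>)) \<le> Q_loss \<phi> + price \<phi>" .
  then have "enn2ereal (ennreal (- (\<integral>x. F x (P.S x) \<partial>\<mu>))) \<le> enn2ereal (Q_loss \<phi> + price \<phi>)"
    by (simp add: less_eq_ennreal.rep_eq)
  moreover have "(\<integral>x. F x (P.S x) \<partial>\<mu>) \<le> 0"
    using integral_nonneg_AE[of "\<lambda>x. - F x (P.S x)" \<mu>] F0 by simp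
  ultimately have "ereal (- (\<integral>x. F x (P.S x) \<partial>\<mu>)) \<le> enn2ereal (Q_loss \<phi> + price \<phi>)"
    by (simp add: enn2ereal_ennreal)
  then show ?thesis
    unfolding dual_objective_eq[OF \<phi>] P.transport_cost_eq
    by (cases "enn2ereal (Q_loss \<phi> + price \<phi>)") auto
qed

text \<open>
  Continuity on the compact \<open>Y\<close> supplies integrability.
\<close>

lemma sublinear_candidate:
  assumes cont: "continuous_on Z f" and nonneg: "\<And>z. z \<in> Z \<Longrightarrow> 0 \<le> f z"
    and conv: "\<And>s t y z. y \<in> Z \<Longrightarrow> z \<in> Z \<Longrightarrow> 0 \<le> s \<Longrightarrow> 0 \<le> t \<Longrightarrow> f (s *\<^sub>R y + t *\<^sub>R z) \<le> s * f y + t * f z"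
    and hom: "\<And>t z. z \<in> Z \<Longrightarrow> 0 \<le> t \<Longrightarrow> f (t *\<^sub>R z) = t * f z"
  shows "(\<lambda>z. ereal (f z)) \<in> dual_candidates" "price (\<lambda>z. ereal (f z)) = ennreal (\<integral>y. f y \<partial>\<nu>)"
    "integrable \<nu> f"
proof -
  have fm: "f \<in> borel_measurable \<nu>"
    using borel_measurable_continuous_on_restrict[OF continuous_on_subset[OF cont Y_subset_Z]]
    by (simp add: measurable_nu)
  have "bounded (f ` Y)"
    by (intro compact_imp_bounded compact_continuous_image continuous_on_subset[OF cont Y_subset_Z] compact_Y)
  then obtain B where B: "\<And>y. y \<in> Y \<Longrightarrow> norm (f y) \<le> B" by (auto simp: bounded_iff)
  show fi: "integrable \<nu> f"
    using B by (intro nu.integrable_const_bound[OF _ fm, of B] AE_I2) (auto simp: space_nu)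
  have f0: "AE y in \<nu>. 0 \<le> f y" using nonneg Y_subset_Z by (intro AE_I2) (auto simp: space_nu)
  show pr: "price (\<lambda>z. ereal (f z)) = ennreal (\<integral>y. f y \<partial>\<nu>)"
    unfolding price_def using nn_integral_eq_integral[OF fi f0] by simp
  have "(\<integral>\<^sup>+y. e2ennreal \<bar>ereal (f y)\<bar> \<partial>\<nu>) = ennreal (\<integral>y. f y \<partial>\<nu>)"
    unfolding nn_integral_eq_integral[OF fi f0, symmetric]
    by (intro nn_integral_cong_AE) (use f0 in \<open>auto elim: eventually_mono\<close>)
  then have "(\<lambda>z. ereal (f z)) \<in> ext_L1 \<nu>"
    unfolding ext_L1_def using fm by simp
  moreover have "lsc_on Z (\<lambda>z. ereal (f z))"
    unfolding lsc_on_def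
  proof
    fix z assume z: "z \<in> Z"
    show "ereal (f z) \<le> Liminf (at z within Z) (\<lambda>z. ereal (f z))"
    proof (cases "at z within Z = bot")
      case False
      have "((\<lambda>z. ereal (f z)) \<longlongrightarrow> ereal (f z)) (at z within Z)"
        using cont z by (auto simp: continuous_on_def)
      from lim_imp_Liminf[OF False this] show ?thesis by simp
    qed (simp add: Liminf_bot)
  qed
  moreover have "ext_convex_on Z (\<lambda>z. ereal (f z))"
    unfolding ext_convex_on_def using convex_Z conv by simp
  moreover have "pos_homogeneous_on Z (\<lambda>z. ereal (f z))"
    unfolding pos_homogeneous_on_def using hom by simp
  ultimately show "(\<lambda>z. ereal (f z)) \<in> dual_candidates"
    using nonneg by (simp add: Phi_plus_def)
qed

text \<open>
  Dini's theorem for the increasing maxima of finitely many affine minorants on a compact slice.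
\<close>

lemma finite_affine_approx:
  assumes x: "x \<in> X" and \<eta>: "0 < \<eta>"
  shows "\<exists>N. \<forall>z\<in>Z. e \<bullet> z \<le> L \<longrightarrow> (\<exists>k\<le>N. F x z - \<eta> \<le> u k x \<bullet> z + a k x)"
proof (rule ccontr)
  assume "\<not> ?thesis"
  then have "\<forall>N. \<exists>z. z \<in> Z \<and> e \<bullet> z \<le> L \<and> \<not> (\<exists>k\<le>N. F x z - \<eta> \<le> u k x \<bullet> z + a k x)" by blast
  then have "\<forall>N. \<exists>z. z \<in> Z \<and> e \<bullet> z \<le> L \<and> (\<forall>k\<le>N. u k x \<bullet> z + a k x < F x z - \<eta>)"
    by (intro allI) (metis (no_types, lifting) not_le)
  then obtain s where "\<forall>N. s N \<in> Z \<and> e \<bullet> s N \<le> L \<and> (\<forall>k\<le>N. u k x \<bullet> s N + a k x < F x (s N) - \<eta>)"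
    by (rule choice[THEN exE])
  then have s: "\<And>N. s N \<in> Z" "\<And>N. e \<bullet> s N \<le> L" "\<And>N k. k \<le> N \<Longrightarrow> u k x \<bullet> s N + a k x < F x (s N) - \<eta>"
    by auto
  have "\<forall>n. s n \<in> {z \<in> Z. e \<bullet> z \<le> L}" using s by auto
  then obtain z r where z: "z \<in> {z \<in> Z. e \<bullet> z \<le> L}" "strict_mono r" "(s \<circ> r) \<longlonglongrightarrow> z"
    by (rule seq_compactE[OF compact_imp_seq_compact[OF compact_slice]])
  have lim: "(\<lambda>n. s (r n)) \<longlonglongrightarrow> z" using z(3) by (simp add: o_def)
  have "u k x \<bullet> z + a k x \<le> F x z - \<eta>" for k
  proof (rule LIMSEQ_le)
    show "(\<lambda>n. u k x \<bullet> s (r n) + a k x) \<longlonglongrightarrow> u k x \<bullet> z + a k x" by (intro tendsto_intros lim)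
    show "(\<lambda>n. F x (s (r n)) - \<eta>) \<longlonglongrightarrow> F x z - \<eta>"
      using z s x by (intro tendsto_intros tendsto_F lim) auto
    have "u k x \<bullet> s (r n) + a k x \<le> F x (s (r n)) - \<eta>" if "k \<le> n" for n
      using s(3)[of k "r n"] seq_suble[OF z(2), of n] that by simp
    then show "\<exists>N. \<forall>n\<ge>N. u k x \<bullet> s (r n) + a k x \<le> F x (s (r n)) - \<eta>" by blast
  qed
  then have "(SUP k. ereal (u k x \<bullet> z + a k x)) \<le> ereal (F x z - \<eta>)" by (intro SUP_least) simp
  then have "ereal (F x z) \<le> ereal (F x z - \<eta>)" using F_sup[OF x, of z] z by simp
  then show False using \<eta> by simp
qed

text \<open>
  The barycentric map of the plan with density \<open>q\<close> is determined almost everywhere by its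
  integrals over Borel sets, which Fubini's theorem computes. So the chosen disintegration never has
  to be identified.
\<close>

lemma plan_of_density:
  fixes q :: "'x \<times> 'a \<Rightarrow> real"
  assumes q: "q \<in> borel_measurable (borel_on X \<Otimes>\<^sub>M borel_on Y)"
    and q0: "\<And>z. 0 \<le> q z" and qB: "\<And>z. q z \<le> B"
    and q1: "\<And>y. y \<in> Y \<Longrightarrow> (\<integral>x. q (x, y) \<partial>\<mu>) = 1"
  shows "\<exists>p\<in>plans. \<exists>S. integrable \<mu> (\<lambda>x. F x (S x)) \<and> cost p = ereal (\<integral>x. F x (S x) \<partial>\<mu>) \<and>
    (AE x in \<mu>. S x = (\<integral>y. q (x, y) *\<^sub>R y \<partial>\<nu>))"
proof -
  interpret mn: pair_prob_space \<mu> \<nu> ..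
  have sets_mn: "sets (\<mu> \<Otimes>\<^sub>M \<nu>) = sets (borel_on X \<Otimes>\<^sub>M borel_on Y)"
    by (rule sets_pair_measure_cong[OF sets_mu sets_nu])
  have space_mn: "space (\<mu> \<Otimes>\<^sub>M \<nu>) = X \<times> Y" by (simp add: space_pair_measure space_mu space_nu)
  have qm[measurable]: "q \<in> borel_measurable (\<mu> \<Otimes>\<^sub>M \<nu>)" using q by (simp add: measurable_cong_sets[OF sets_mn refl])
  define p where "p = density (\<mu> \<Otimes>\<^sub>M \<nu>) (\<lambda>z. ennreal (q z))"
  have sets_p: "sets p = sets (borel_on (X \<times> Y))" using sets_mn sets_borel_on_Times[OF compact_X, of Y] by (simp add: p_def)
  have mp: "measurable p N = measurable (borel_on (X \<times> Y)) N" for N :: "'n measure"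
    by (rule measurable_cong_sets[OF sets_p refl])
  have mp': "measurable (\<mu> \<Otimes>\<^sub>M \<nu>) N = measurable (borel_on (X \<times> Y)) N" for N :: "'n measure"
    using sets_p by (intro measurable_cong_sets) (auto simp: p_def)
  have fm[measurable]: "fst \<in> \<mu> \<Otimes>\<^sub>M \<nu> \<rightarrow>\<^sub>M borel_on X" and sm[measurable]: "snd \<in> \<mu> \<Otimes>\<^sub>M \<nu> \<rightarrow>\<^sub>M borel_on Y"
    by (simp_all add: mp')
  have q1': "(\<integral>\<^sup>+x. ennreal (q (x, y)) \<partial>\<mu>) = 1" if "y \<in> Y" for y
  proof -
    have "(\<lambda>x. q (x, y)) \<in> borel_measurable \<mu>"
      using measurable_compose[OF measurable_Pair2'[of y \<nu> \<mu>] qm] that by (simp add: space_nu)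
    then have "integrable \<mu> (\<lambda>x. q (x, y))"
      using q0 qB by (intro mu.integrable_const_bound[where B=B] AE_I2) auto
    then show ?thesis using q1[OF that] q0 by (subst nn_integral_eq_integral) auto
  qed
  have m2: "emeasure p {z \<in> X \<times> Y. snd z \<in> B} = emeasure \<nu> B" if B: "B \<in> sets \<nu>" for B
  proof -
    have [measurable]: "{z \<in> X \<times> Y. snd z \<in> B} \<in> sets (\<mu> \<Otimes>\<^sub>M \<nu>)"
    proof -
      have "{z \<in> X \<times> Y. snd z \<in> B} = space \<mu> \<times> B" using sets.sets_into_space[OF B] by (auto simp: space_mu space_nu)
      then show ?thesis using B by auto
    qed
    have "emeasure p {z \<in> X \<times> Y. snd z \<in> B} = (\<integral>\<^sup>+z. ennreal (q z) * indicator {z \<in> X \<times> Y. snd z \<in> B} z \<partial>(\<mu> \<Otimes>\<^sub>M \<nu>))"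
      unfolding p_def by (subst emeasure_density) auto
    also have "\<dots> = (\<integral>\<^sup>+y. \<integral>\<^sup>+x. ennreal (q (x, y)) * indicator {z \<in> X \<times> Y. snd z \<in> B} (x, y) \<partial>\<mu> \<partial>\<nu>)"
      by (rule mn.nn_integral_snd[symmetric]) measurable
    also have "\<dots> = (\<integral>\<^sup>+y. indicator B y \<partial>\<nu>)"
    proof (rule nn_integral_cong)
      fix y assume "y \<in> space \<nu>"
      then have y: "y \<in> Y" by (simp add: space_nu)
      have "(\<integral>\<^sup>+x. ennreal (q (x, y)) * indicator {z \<in> X \<times> Y. snd z \<in> B} (x, y) \<partial>\<mu>) = (\<integral>\<^sup>+x. ennreal (q (x, y)) * indicator B y \<partial>\<mu>)"
        using y by (intro nn_integral_cong) (auto simp: space_mu indicator_def)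
      also have "\<dots> = (\<integral>\<^sup>+x. ennreal (q (x, y)) \<partial>\<mu>) * indicator B y"
        using measurable_compose[OF measurable_Pair2'[of y \<nu> \<mu>] qm] y by (intro nn_integral_multc) (auto simp: space_nu)
      finally show "(\<integral>\<^sup>+x. ennreal (q (x, y)) * indicator {z \<in> X \<times> Y. snd z \<in> B} (x, y) \<partial>\<mu>) = indicator B y"
        using q1'[OF y] by simp
    qed
    finally show ?thesis using B by simp
  qed
  have space_p: "space p = X \<times> Y" by (simp add: p_def space_mn)
  have "emeasure p (space p) = emeasure \<nu> Y"
  proof -
    have "{z \<in> X \<times> Y. snd z \<in> Y} = X \<times> Y" by auto
    then show ?thesis using m2[of Y] sets.top[of \<nu>] by (simp add: space_p space_nu)
  qed
  then have "emeasure p (space p) = 1" using nu.emeasure_space_1 by (simp add: space_nu)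
  then interpret p: prob_space p by (rule prob_spaceI)
  have "p \<in> borel_probs (X \<times> Y)" using sets_p p.prob_space_axioms by (simp add: space_prob_algebra)
  moreover have "absolutely_continuous \<mu> (marginal1 X p)"
    unfolding absolutely_continuous_def
  proof
    fix A assume A: "A \<in> null_sets \<mu>"
    then have As: "A \<in> sets (borel_on X)" by (auto simp: sets_mu)
    have "A \<times> Y \<in> null_sets (\<mu> \<Otimes>\<^sub>M \<nu>)"
      using A sets.top[of \<nu>] by (auto simp: null_sets_def space_nu nu.emeasure_pair_measure_Times)
    then have "A \<times> Y \<in> null_sets p"
      unfolding p_def by (subst null_sets_density_iff) (auto dest: AE_not_in elim: eventually_mono)
    moreover have "fst -` A \<inter> space p = A \<times> Y" using sets.sets_into_space[OF As] by (auto simp: space_p space_restrict_space)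
    ultimately show "A \<in> null_sets (marginal1 X p)"
      unfolding marginal1_def using As by (subst null_sets_distr_iff) (auto simp: mp)
  qed
  moreover have "marginal2 Y p = \<nu>"
  proof (rule measure_eqI)
    show "sets (marginal2 Y p) = sets \<nu>" by (simp add: marginal2_def sets_nu)
    fix B assume "B \<in> sets (marginal2 Y p)"
    then have B: "B \<in> sets (borel_on Y)" by (simp add: marginal2_def)
    have "emeasure (marginal2 Y p) B = emeasure p (snd -` B \<inter> space p)"
      unfolding marginal2_def using B by (intro emeasure_distr) (simp_all add: mp)
    also have "snd -` B \<inter> space p = {z \<in> X \<times> Y. snd z \<in> B}" by (auto simp: space_p)
    finally show "emeasure (marginal2 Y p) B = emeasure \<nu> B" using m2 B by (simp add: sets_nu)
  qed
  ultimately have plan: "p \<in> plans" by (simp add: plans_ac_def)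
  interpret P: barycentric_plan X Y Z F a u \<mu> \<nu> p by unfold_locales (rule plan)
  define T where "T x = (\<integral>y. q (x, y) *\<^sub>R y \<partial>\<nu>)" for x
  have idY: "(\<lambda>y. y) \<in> borel_measurable (borel_on Y)" by (simp add: measurable_restrict_space1)
  have idm[measurable]: "snd \<in> borel_measurable (\<mu> \<Otimes>\<^sub>M \<nu>)" using measurable_compose[OF sm idY] .
  have B0: "0 \<le> B" using q0 qB order_trans by blast
  have nb: "norm (q z *\<^sub>R snd z) \<le> B * R" if "z \<in> X \<times> Y" for z
    using q0[of z] qB[of z] B0 R(2)[OF hull_inc, of "snd z"] that by (auto intro!: mult_mono)
  have iT: "integrable (\<mu> \<Otimes>\<^sub>M \<nu>) (\<lambda>z. q z *\<^sub>R snd z)"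
    using nb by (intro mn.P.integrable_const_bound[where B="B * R"] AE_I2) (auto simp: space_mn)
  have iTx: "integrable \<nu> (\<lambda>y. q (x, y) *\<^sub>R y)" if "x \<in> X" for x
  proof -
    have "(\<lambda>y. q (x, y) *\<^sub>R snd (x, y)) \<in> borel_measurable \<nu>"
      using that by (intro measurable_compose[OF measurable_Pair1'[of x \<mu> \<nu>], of "\<lambda>z. q z *\<^sub>R snd z"]) (auto simp: space_mu)
    then show ?thesis
      using nb[of "(x, _)"] that by (intro nu.integrable_const_bound[where B="B * R"] AE_I2) (auto simp: space_nu)
  qed
  have Ti: "integrable \<mu> T"
    using mn.integrable_fst'[OF iT] by (simp add: T_def[abs_def])
  have "AE x in \<mu>. P.S x = T x"
  proof (rule mu.density_unique_banach[OF P.S_integrable Ti])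
    fix A assume A: "A \<in> sets \<mu>"
    then have As[measurable]: "A \<in> sets (borel_on X)" by (simp add: sets_mu)
    have "w \<bullet> (\<integral>x\<in>A. P.S x \<partial>\<mu>) = w \<bullet> (\<integral>x\<in>A. T x \<partial>\<mu>)" for w
    proof -
      have wm: "(\<lambda>x. indicator A x *\<^sub>R w) \<in> borel_measurable (borel_on X)" by measurable
      have wb: "norm (indicator A x *\<^sub>R w) \<le> norm w" for x by (auto simp: indicator_def)
      have iS: "integrable \<mu> (\<lambda>x. indicator A x *\<^sub>R P.S x)" and iT': "integrable \<mu> (\<lambda>x. indicator A x *\<^sub>R T x)"
        using A P.S_integrable Ti integrable_mult_indicator by blast+
      have "w \<bullet> (\<integral>x\<in>A. P.S x \<partial>\<mu>) = (\<integral>x. w \<bullet> (indicator A x *\<^sub>R P.S x) \<partial>\<mu>)"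
        unfolding set_lebesgue_integral_def by (rule integral_inner_right[symmetric]) (rule iS)
      also have "\<dots> = (\<integral>x. (indicator A x *\<^sub>R w) \<bullet> P.S x \<partial>\<mu>)" by simp
      also have "\<dots> = (\<integral>z. (indicator A (fst z) *\<^sub>R w) \<bullet> snd z \<partial>p)"
        using P.integral_inner_S(2)[OF wm wb] by simp
      also have "\<dots> = (\<integral>z. q z *\<^sub>R ((indicator A (fst z) *\<^sub>R w) \<bullet> snd z) \<partial>(\<mu> \<Otimes>\<^sub>M \<nu>))"
        unfolding p_def using q0 by (intro integral_density) auto
      also have "\<dots> = (\<integral>x. \<integral>y. q (x, y) * (indicator A x * (w \<bullet> y)) \<partial>\<nu> \<partial>\<mu>)"
      proof -
        have "integrable (\<mu> \<Otimes>\<^sub>M \<nu>) (\<lambda>z. (indicator A (fst z) *\<^sub>R w) \<bullet> (q z *\<^sub>R snd z))"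
        proof (rule Bochner_Integration.integrable_bound[OF integrable_mult_left[OF integrable_norm[OF iT], of "norm w"]])
          show "AE z in \<mu> \<Otimes>\<^sub>M \<nu>. norm ((indicator A (fst z) *\<^sub>R w) \<bullet> (q z *\<^sub>R snd z)) \<le> norm (norm (q z *\<^sub>R snd z) * norm w)"
          proof (rule AE_I2)
            fix z
            have "norm ((indicator A (fst z) *\<^sub>R w) \<bullet> (q z *\<^sub>R snd z)) \<le> norm (indicator A (fst z) *\<^sub>R w) * norm (q z *\<^sub>R snd z)"
              unfolding real_norm_def by (rule Cauchy_Schwarz_ineq2)
            also have "\<dots> \<le> norm w * norm (q z *\<^sub>R snd z)" by (intro mult_right_mono wb) auto
            finally show "norm ((indicator A (fst z) *\<^sub>R w) \<bullet> (q z *\<^sub>R snd z)) \<le> norm (norm (q z *\<^sub>R snd z) * norm w)"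
              by (simp add: mult.commute)
          qed
        qed measurable
        then have "integrable (\<mu> \<Otimes>\<^sub>M \<nu>) (\<lambda>z. q z *\<^sub>R ((indicator A (fst z) *\<^sub>R w) \<bullet> snd z))" by (simp add: mult.left_commute)
        from mn.integral_fst'[OF this] show ?thesis by simp
      qed
      also have "\<dots> = (\<integral>x. w \<bullet> (indicator A x *\<^sub>R T x) \<partial>\<mu>)"
      proof (rule Bochner_Integration.integral_cong[OF refl])
        fix x assume "x \<in> space \<mu>"
        then have x: "x \<in> X" by (simp add: space_mu)
        have "(\<integral>y. q (x, y) * (indicator A x * (w \<bullet> y)) \<partial>\<nu>) = (\<integral>y. indicator A x * (w \<bullet> (q (x, y) *\<^sub>R y)) \<partial>\<nu>)"
          by (intro Bochner_Integration.integral_cong) auto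
        also have "\<dots> = indicator A x * (w \<bullet> T x)"
        proof -
          have "(\<integral>y. w \<bullet> (q (x, y) *\<^sub>R y) \<partial>\<nu>) = w \<bullet> T x"
            unfolding T_def by (rule integral_inner_right) (rule iTx[OF x])
          then show ?thesis by (simp only: integral_mult_right_zero)
        qed
        finally show "(\<integral>y. q (x, y) * (indicator A x * (w \<bullet> y)) \<partial>\<nu>) = w \<bullet> (indicator A x *\<^sub>R T x)" by simp
      qed
      also have "\<dots> = w \<bullet> (\<integral>x\<in>A. T x \<partial>\<mu>)"
        unfolding set_lebesgue_integral_def by (rule integral_inner_right) (rule iT')
      finally show ?thesis .
    qed
    then show "(\<integral>x\<in>A. P.S x \<partial>\<mu>) = (\<integral>x\<in>A. T x \<partial>\<mu>)" using vector_eq_ldot by blast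
  qed
  then show ?thesis
    using plan P.cost_integrable P.transport_cost_eq unfolding T_def by blast
qed

end

section \<open>Absence of a duality gap\<close>

context barycentric_problem
begin

lemma measurable_net:
  assumes \<delta>: "0 < \<delta>"
  shows "\<exists>(n::nat) c idx. (\<forall>i<n. c i \<in> X) \<and> idx \<in> borel_on X \<rightarrow>\<^sub>M count_space UNIV \<and>
    (\<forall>x\<in>X. idx x < n \<and> dist (c (idx x)) x < \<delta>)"
proof -
  obtain k where k: "finite k" "k \<subseteq> X" "X \<subseteq> (\<Union>x\<in>k. ball x \<delta>)"
    using seq_compact_imp_totally_bounded[OF compact_imp_seq_compact[OF compact_X], rule_format, OF \<delta>] by blast
  obtain c and n :: nat where c: "k = c ` {i. i < n}" using finite_imp_nat_seg_image_inj_on[OF k(1)] by blast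
  define idx where "idx x = (LEAST i. dist (c i) x < \<delta> \<and> i < n)" for x
  show ?thesis
  proof (intro exI[of _ n] exI[of _ c] exI[of _ idx] conjI allI impI ballI)
    show "c i \<in> X" if "i < n" for i using k(2) c that by auto
    have "Measurable.pred borel (\<lambda>x. dist (c i) x < \<delta>)" for i
    proof -
      have "open {x. dist (c i) x < \<delta>}" by (intro open_Collect_less continuous_intros)
      then show ?thesis by (simp add: pred_def)
    qed
    then have [measurable]: "Measurable.pred (borel_on X) (\<lambda>x. dist (c i) x < \<delta>)" for i
      by (rule measurable_restrict_space1)
    show "idx \<in> borel_on X \<rightarrow>\<^sub>M count_space UNIV" unfolding idx_def by measurable
    fix x assume "x \<in> X"
    then obtain y where "y \<in> k" "dist y x < \<delta>" using k(3) by auto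
    then obtain i where "dist (c i) x < \<delta> \<and> i < n" using c by auto
    from LeastI[of "\<lambda>i. dist (c i) x < \<delta> \<and> i < n", OF this]
    show "idx x < n" "dist (c (idx x)) x < \<delta>" by (auto simp: idx_def)
  qed
qed

text \<open>
  The bound \<open>v\<close> is any lower bound of all costs. The loss \<open>\<eta> * (3 + 2 *
  E)\<close> collects the two exchanges of \<open>x\<close> for the centre of its cell
  (\<open>\<eta> * (1 + E)\<close> on the primal side, \<open>\<eta>\<close> and \<open>\<eta> *
  E\<close> on the dual side) and the replacement of \<open>F\<close> by finitely many affine
  functions (\<open>\<eta>\<close>).
\<close>

lemma approximate_duality:
  assumes v: "\<And>p. p \<in> plans \<Longrightarrow> ereal v \<le> cost p" and \<eta>: "0 < \<eta>"
  shows "\<exists>\<phi>\<in>dual_candidates. ereal (v - \<eta> * (3 + 2 * E)) \<le> dual_objective Z F \<mu> \<nu> \<phi>"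
proof -
  obtain \<delta> where \<delta>: "0 < \<delta>" and mod: "\<And>x x' z. x \<in> X \<Longrightarrow> x' \<in> X \<Longrightarrow> dist x x' < \<delta> \<Longrightarrow> z \<in> Z \<Longrightarrow>
      F x z \<le> F x' z + \<eta> * (1 + e \<bullet> z)"
    using uniform_modulus[OF \<eta>] by blast
  obtain n :: nat and c idx where net: "(\<forall>i<n. c i \<in> X) \<and> idx \<in> borel_on X \<rightarrow>\<^sub>M count_space UNIV \<and>
      (\<forall>x\<in>X. idx x < n \<and> dist (c (idx x)) x < \<delta>)"
    using measurable_net[OF \<delta>] by (elim exE)
  have c: "\<And>i. i < n \<Longrightarrow> c i \<in> X" and idx_meas: "idx \<in> borel_on X \<rightarrow>\<^sub>M count_space UNIV"
    and idx: "\<And>x. x \<in> X \<Longrightarrow> idx x < n \<and> dist (c (idx x)) x < \<delta>"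
    using net by (simp_all only: simp_thms)
  define A where "A i = {x \<in> X. idx x = i}" for i
  have A[measurable]: "A i \<in> sets \<mu>" for i
    using measurable_sets[OF idx_meas, of "{i}"] by (simp add: A_def sets_mu space_restrict_space vimage_def Int_def conj_commute)
  define m where "m i = measure \<mu> (A i)" for i
  (* Cells of measure zero are dropped, so that division by their mass is legitimate. *)
  define I where "I = {i. i < n \<and> 0 < m i}"
  have I: "finite I" "\<And>i. i \<in> I \<Longrightarrow> c i \<in> X" "\<And>i. i \<in> I \<Longrightarrow> 0 < m i" using c by (auto simp: I_def)
  have I0: "\<And>i. i \<in> I \<Longrightarrow> m i \<noteq> 0" using I(3) by force
  have idxI: "AE x in \<mu>. idx x \<in> I"
  proof -
    have "AE x in \<mu>. x \<notin> A i" if "i < n" "i \<notin> I" for i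
    proof (rule AE_not_in)
      have "\<not> 0 < m i" using that by (simp add: I_def)
      moreover have "0 \<le> m i" by (simp add: m_def)
      ultimately have "m i = 0" by simp
      then show "A i \<in> null_sets \<mu>" by (simp add: null_sets_def m_def mu.emeasure_eq_measure)
    qed
    then have "AE x in \<mu>. \<forall>i\<in>{i. i < n \<and> i \<notin> I}. x \<notin> A i" by (intro AE_finite_allI) auto
    then show ?thesis using AE_space by eventually_elim (use idx in \<open>auto simp: A_def space_mu\<close>)
  qed
  have step: "AE x in \<mu>. (h (idx x) :: real) = (\<Sum>i\<in>I. h i * indicator (A i) x)" for h
    using idxI AE_space
  proof eventually_elim
    case (elim x)
    have "(\<Sum>i\<in>I. h i * indicator (A i) x) = (\<Sum>i\<in>I. if i = idx x then h i else 0)"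
      using elim by (intro sum.cong) (auto simp: A_def space_mu)
    then show ?case using elim I(1) by simp
  qed
  have step_int: "integrable \<mu> (\<lambda>x. h (idx x))" "(\<integral>x. h (idx x) \<partial>\<mu>) = (\<Sum>i\<in>I. m i * h i)" for h :: "nat \<Rightarrow> real"
  proof -
    have hm: "(\<lambda>x. h (idx x)) \<in> borel_measurable \<mu>"
      using measurable_compose[OF idx_meas, of h] by (simp add: measurable_mu)
    have i: "integrable \<mu> (\<lambda>x. \<Sum>i\<in>I. h i * indicator (A i) x)"
      by (intro Bochner_Integration.integrable_sum integrable_mult_right integrable_real_indicator A) (simp add: less_top[symmetric])
    then show "integrable \<mu> (\<lambda>x. h (idx x))" using step[of h] hm by (subst integrable_cong_AE) auto
    have "(\<integral>x. h (idx x) \<partial>\<mu>) = (\<integral>x. (\<Sum>i\<in>I. h i * indicator (A i) x) \<partial>\<mu>)"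
      using step[of h] hm i by (intro integral_cong_AE) auto
    also have "\<dots> = (\<Sum>i\<in>I. (\<integral>x. h i * indicator (A i) x \<partial>\<mu>))"
      by (intro Bochner_Integration.integral_sum integrable_mult_right integrable_real_indicator A) (simp add: less_top[symmetric])
    also have "\<dots> = (\<Sum>i\<in>I. m i * h i)"
      using sets.sets_into_space[OF A] by (intro sum.cong) (auto simp: m_def Int_absorb2 mult.commute)
    finally show "(\<integral>x. h (idx x) \<partial>\<mu>) = (\<Sum>i\<in>I. m i * h i)" .
  qed
  have sum_m: "(\<Sum>i\<in>I. m i) = 1" using step_int(2)[of "\<lambda>_. 1"] mu.prob_space by simp
  then have I_ne: "I \<noteq> {}" by auto
  (* Partitions of unity on Y: r i y is the share of y that is sent to cell i. *)
  define C where "C = {r :: nat \<Rightarrow> 'a \<Rightarrow> real. (\<forall>i. r i \<in> borel_measurable (borel_on Y)) \<and> (\<forall>i y. 0 \<le> r i y \<and> r i y \<le> 1) \<and>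
     (\<forall>y\<in>Y. (\<Sum>i\<in>I. r i y) = 1)}"
  define t where "t r i = (\<integral>y. r i y *\<^sub>R y \<partial>\<nu>)" for r :: "nat \<Rightarrow> 'a \<Rightarrow> real" and i
  have idY: "(\<lambda>y. y) \<in> borel_measurable \<nu>"
    by (simp add: measurable_restrict_space1 measurable_nu)
  have ry: "integrable \<nu> (\<lambda>y. r i y *\<^sub>R y)" if "r \<in> C" for r i
  proof -
    have [measurable]: "r i \<in> borel_measurable \<nu>" using that by (simp add: C_def measurable_nu)
    have "norm (r i y *\<^sub>R y) \<le> R" if "y \<in> Y" for y
      using \<open>r \<in> C\<close> R(2)[OF hull_inc[OF that]] mult_mono[of "r i y" 1 "norm y" R] by (auto simp: C_def)
    then show ?thesis
      using idY by (intro nu.integrable_const_bound[where B=R] AE_I2) (auto simp: space_nu)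
  qed
  have tZ: "t r i \<in> Z" if "r \<in> C" for r i
    unfolding t_def
    using that Y_subset_Z by (intro nu.integral_in_closed_convex ry AE_I2 closed_Z convex_Z) (auto simp: space_nu C_def intro!: scale_in_Z)
  have sum_t: "(\<Sum>i\<in>I. w i \<bullet> t r i) = (\<integral>y. (\<Sum>i\<in>I. r i y * (w i \<bullet> y)) \<partial>\<nu>)" if "r \<in> C" for r w
  proof -
    have "(\<integral>y. (\<Sum>i\<in>I. r i y * (w i \<bullet> y)) \<partial>\<nu>) = (\<integral>y. (\<Sum>i\<in>I. w i \<bullet> (r i y *\<^sub>R y)) \<partial>\<nu>)" by simp
    also have "\<dots> = (\<Sum>i\<in>I. (\<integral>y. w i \<bullet> (r i y *\<^sub>R y) \<partial>\<nu>))"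
      by (intro Bochner_Integration.integral_sum integrable_inner_right ry that)
    also have "\<dots> = (\<Sum>i\<in>I. w i \<bullet> t r i)"
      unfolding t_def by (intro sum.cong refl integral_inner_right ry that)
    finally show ?thesis by simp
  qed
  have e_t: "(\<Sum>i\<in>I. e \<bullet> t r i) \<le> E" if r: "r \<in> C" for r
  proof -
    have "(\<Sum>i\<in>I. e \<bullet> t r i) = (\<integral>y. (\<Sum>i\<in>I. r i y * (e \<bullet> y)) \<partial>\<nu>)" by (rule sum_t[OF r])
    also have "\<dots> = (\<integral>y. e \<bullet> y \<partial>\<nu>)"
      using r by (intro Bochner_Integration.integral_cong) (auto simp: C_def space_nu simp flip: sum_distrib_right)
    also have "\<dots> \<le> E"
    proof (rule nu.integral_le_const)
      show "integrable \<nu> (\<lambda>y. e \<bullet> y)"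
        using idY e_le_E e_ge_1 by (intro nu.integrable_const_bound[where B=E] AE_I2) (force simp: space_nu abs_le_iff)+
      show "AE y in \<nu>. e \<bullet> y \<le> E" using e_le_E by (intro AE_I2) (auto simp: space_nu)
    qed
    finally show ?thesis .
  qed
  have et1: "e \<bullet> t r i \<le> E" if "r \<in> C" "i \<in> I" for r i
  proof -
    have "e \<bullet> t r i \<le> (\<Sum>i\<in>I. e \<bullet> t r i)"
      using I(1) that by (intro member_le_sum) (auto intro: e_nonneg tZ)
    then show ?thesis using e_t[OF that(1)] by simp
  qed
  define s where "s r i = (1 / m i) *\<^sub>R t r i" for r i
  have sZ: "s r i \<in> Z" if "r \<in> C" "i \<in> I" for r i
    unfolding s_def using I(3)[OF that(2)] by (intro scale_in_Z tZ that) auto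
  (* The plan that spreads the share r i uniformly, relative to \<mu>, over cell i. *)
  have primal: "v - \<eta> * (1 + E) \<le> (\<Sum>i\<in>I. m i * F (c i) (s r i))" if r: "r \<in> C" for r
  proof -
    define q where "q z = (\<Sum>i\<in>I. indicator (A i) (fst z) * (r i (snd z) / m i))" for z
    have q0: "0 \<le> q z" for z unfolding q_def using r I(3) by (intro sum_nonneg) (auto simp: C_def less_imp_le)
    have qB: "q z \<le> (\<Sum>i\<in>I. 1 / m i)" for z
      unfolding q_def
    proof (rule sum_mono)
      fix i assume "i \<in> I"
      then have "0 < m i" "0 \<le> r i (snd z)" "r i (snd z) \<le> 1" using I(3) r by (auto simp: C_def)
      then show "indicator (A i) (fst z) * (r i (snd z) / m i) \<le> 1 / m i"
        by (auto simp: indicator_def divide_right_mono)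
    qed
    have As: "A i \<in> sets (borel_on X)" for i using A by (simp add: sets_mu)
    have qm: "q \<in> borel_measurable (borel_on X \<Otimes>\<^sub>M borel_on Y)"
      unfolding q_def
    proof (intro borel_measurable_sum borel_measurable_times borel_measurable_divide borel_measurable_const)
      fix i
      show "(\<lambda>z. indicator (A i) (fst z) :: real) \<in> borel_measurable (borel_on X \<Otimes>\<^sub>M borel_on Y)"
        by (rule measurable_compose[OF measurable_fst borel_measurable_indicator[OF As]])
      have "r i \<in> borel_measurable (borel_on Y)" using r by (auto simp: C_def)
      from measurable_compose[OF measurable_snd this]
      show "(\<lambda>z. r i (snd z)) \<in> borel_measurable (borel_on X \<Otimes>\<^sub>M borel_on Y)" .
    qed
    have ind: "integrable \<mu> (indicator (A i) :: 'x \<Rightarrow> real)" "(\<integral>x. indicator (A i) x \<partial>\<mu>) = m i" for i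
      using A[of i] sets.sets_into_space[OF A[of i]]
      by (auto intro!: integrable_real_indicator simp: m_def Int_absorb2 less_top[symmetric])
    have q1: "(\<integral>x. q (x, y) \<partial>\<mu>) = 1" if "y \<in> Y" for y
    proof -
      have "(\<integral>x. q (x, y) \<partial>\<mu>) = (\<Sum>i\<in>I. (\<integral>x. indicator (A i) x * (r i y / m i) \<partial>\<mu>))"
        unfolding q_def fst_conv snd_conv
        by (intro Bochner_Integration.integral_sum integrable_mult_left ind)
      also have "\<dots> = (\<Sum>i\<in>I. r i y)"
      proof (rule sum.cong[OF refl])
        fix i assume i: "i \<in> I"
        have "(\<integral>x. indicator (A i) x * (r i y / m i) \<partial>\<mu>) = m i * (r i y / m i)"
          by (simp only: integral_mult_left_zero ind(2))
        then show "(\<integral>x. indicator (A i) x * (r i y / m i) \<partial>\<mu>) = r i y" using I(3)[OF i] by simp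
      qed
      finally show ?thesis using r that by (auto simp: C_def)
    qed
    obtain p S where p: "p \<in> plans" and Sint: "integrable \<mu> (\<lambda>x. F x (S x))"
      and Scost: "cost p = ereal (\<integral>x. F x (S x) \<partial>\<mu>)" and SAE: "AE x in \<mu>. S x = (\<integral>y. q (x, y) *\<^sub>R y \<partial>\<nu>)"
      using plan_of_density[OF qm q0 qB q1] by blast
    have S_idx: "AE x in \<mu>. S x = s r (idx x) \<and> idx x \<in> I \<and> x \<in> X"
      using SAE idxI AE_space
    proof eventually_elim
      case (elim x)
      have "q (x, y) = r (idx x) y / m (idx x)" for y
      proof -
        have "q (x, y) = (\<Sum>i\<in>I. if i = idx x then r i y / m i else 0)"
          unfolding q_def using elim by (intro sum.cong) (auto simp: A_def space_mu)
        then show ?thesis using elim I(1) by simp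
      qed
      then have "S x = (\<integral>y. (1 / m (idx x)) *\<^sub>R (r (idx x) y *\<^sub>R y) \<partial>\<nu>)" using elim by simp
      also have "\<dots> = s r (idx x)" unfolding s_def t_def by (rule integral_scaleR_right)
      finally show ?case using elim by (simp add: space_mu)
    qed
    have "v \<le> (\<integral>x. F x (S x) \<partial>\<mu>)" using v[OF p] Scost by simp
    also have "\<dots> \<le> (\<integral>x. F (c (idx x)) (s r (idx x)) + \<eta> * (1 + e \<bullet> s r (idx x)) \<partial>\<mu>)"
    proof (rule integral_mono_AE[OF Sint])
      show "integrable \<mu> (\<lambda>x. F (c (idx x)) (s r (idx x)) + \<eta> * (1 + e \<bullet> s r (idx x)))"
        using step_int(1)[of "\<lambda>i. F (c i) (s r i) + \<eta> * (1 + e \<bullet> s r i)"] .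
      show "AE x in \<mu>. F x (S x) \<le> F (c (idx x)) (s r (idx x)) + \<eta> * (1 + e \<bullet> s r (idx x))"
        using S_idx
      proof eventually_elim
        case (elim x)
        then show ?case using mod[of x "c (idx x)" "S x"] idx[of x] c[of "idx x"] sZ[OF r, of "idx x"]
          by (simp add: dist_commute)
      qed
    qed
    also have "\<dots> = (\<Sum>i\<in>I. m i * (F (c i) (s r i) + \<eta> * (1 + e \<bullet> s r i)))"
      using step_int(2)[of "\<lambda>i. F (c i) (s r i) + \<eta> * (1 + e \<bullet> s r i)"] .
    also have "\<dots> = (\<Sum>i\<in>I. m i * F (c i) (s r i) + \<eta> * m i + \<eta> * (e \<bullet> t r i))"
      using I(3) by (intro sum.cong) (auto simp: s_def field_simps I0)
    also have "\<dots> = (\<Sum>i\<in>I. m i * F (c i) (s r i)) + \<eta> * (\<Sum>i\<in>I. m i) + \<eta> * (\<Sum>i\<in>I. e \<bullet> t r i)"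
      by (simp add: sum.distrib sum_distrib_left)
    also have "\<dots> \<le> (\<Sum>i\<in>I. m i * F (c i) (s r i)) + \<eta> + \<eta> * E"
      using sum_m e_t[OF r] \<eta> by (simp add: mult_left_mono)
    finally show ?thesis by (simp add: algebra_simps)
  qed
  have "\<exists>N. \<forall>z\<in>Z. e \<bullet> z \<le> E / m i \<longrightarrow> (\<exists>k\<le>N. F (c i) z - \<eta> \<le> u k (c i) \<bullet> z + a k (c i))" if "i \<in> I" for i
    using finite_affine_approx[OF I(2)[OF that] \<eta>] .
  then obtain Ni where Ni: "\<And>i z. i \<in> I \<Longrightarrow> z \<in> Z \<Longrightarrow> e \<bullet> z \<le> E / m i \<Longrightarrow> \<exists>k\<le>Ni i. F (c i) z - \<eta> \<le> u k (c i) \<bullet> z + a k (c i)"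
    by metis
  (* One affine minorant is selected per cell; a maximum of sums over cells is the sum of the maxima. *)
  define Kap where "Kap = PiE I (\<lambda>i. {..Ni i})"
  have Kap: "finite Kap" "Kap \<noteq> {}" unfolding Kap_def using I(1) by (auto intro!: finite_PiE simp: PiE_eq_empty_iff)
  define v' where "v' = v - \<eta> * (1 + E) - \<eta>"
  define f where "f \<kappa> r = (\<Sum>i\<in>I. u (\<kappa> i) (c i) \<bullet> t r i + m i * a (\<kappa> i) (c i)) - v'" for \<kappa> r
  have "\<exists>l. (\<forall>\<kappa>\<in>Kap. 0 \<le> l \<kappa>) \<and> sum l Kap = 1 \<and> (\<forall>r\<in>C. 0 \<le> (\<Sum>\<kappa>\<in>Kap. l \<kappa> * f \<kappa> r))"
  proof (rule convexlike_alternative[OF Kap])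
    fix r r' \<tau> assume r: "r \<in> C" "r' \<in> C" and \<tau>: "0 \<le> \<tau>" "\<tau> \<le> (1::real)"
    define h where "h i y = (1 - \<tau>) * r i y + \<tau> * r' i y" for i y
    have "h \<in> C"
      unfolding C_def
    proof (intro CollectI conjI allI ballI)
      fix i y
      have ri: "0 \<le> r i y" "r i y \<le> 1" "0 \<le> r' i y" "r' i y \<le> 1" using r by (auto simp: C_def)
      have "r i \<in> borel_measurable (borel_on Y)" "r' i \<in> borel_measurable (borel_on Y)"
        using r by (simp_all add: C_def)
      then show "h i \<in> borel_measurable (borel_on Y)"
        unfolding h_def by (intro borel_measurable_add borel_measurable_times borel_measurable_const)
      show "0 \<le> h i y" using ri \<tau> by (simp add: h_def)
      show "h i y \<le> 1" unfolding h_def using ri \<tau> by (intro convex_bound_le) auto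
    next
      fix y assume "y \<in> Y"
      then show "(\<Sum>i\<in>I. h i y) = 1" using r by (simp add: h_def sum.distrib C_def flip: sum_distrib_left)
    qed
    moreover have th: "t h i = (1 - \<tau>) *\<^sub>R t r i + \<tau> *\<^sub>R t r' i" for i
    proof -
      have "t h i = (\<integral>y. (1 - \<tau>) *\<^sub>R (r i y *\<^sub>R y) + \<tau> *\<^sub>R (r' i y *\<^sub>R y) \<partial>\<nu>)"
        unfolding t_def h_def by (intro Bochner_Integration.integral_cong) (auto simp: scaleR_add_left)
      also have "\<dots> = (1 - \<tau>) *\<^sub>R t r i + \<tau> *\<^sub>R t r' i"
        unfolding t_def by (subst Bochner_Integration.integral_add)
          (simp_all only: integral_scaleR_right integrable_scaleR_right ry r)
      finally show ?thesis .
    qed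
    moreover have "f \<kappa> h = (1 - \<tau>) * f \<kappa> r + \<tau> * f \<kappa> r'" for \<kappa>
    proof -
      have "(\<Sum>i\<in>I. u (\<kappa> i) (c i) \<bullet> t h i + m i * a (\<kappa> i) (c i)) =
        (\<Sum>i\<in>I. (1 - \<tau>) * (u (\<kappa> i) (c i) \<bullet> t r i + m i * a (\<kappa> i) (c i)) + \<tau> * (u (\<kappa> i) (c i) \<bullet> t r' i + m i * a (\<kappa> i) (c i)))"
        by (intro sum.cong) (auto simp: th inner_add_right algebra_simps)
      also have "\<dots> = (1 - \<tau>) * (\<Sum>i\<in>I. u (\<kappa> i) (c i) \<bullet> t r i + m i * a (\<kappa> i) (c i)) + \<tau> * (\<Sum>i\<in>I. u (\<kappa> i) (c i) \<bullet> t r' i + m i * a (\<kappa> i) (c i))"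
        by (subst sum.distrib) (simp only: sum_distrib_left)
      finally show ?thesis unfolding f_def by (simp add: algebra_simps)
    qed
    ultimately show "\<exists>h\<in>C. \<forall>\<kappa>\<in>Kap. f \<kappa> h \<le> (1 - \<tau>) * f \<kappa> r + \<tau> * f \<kappa> r'" by (intro bexI[of _ h]) auto
  next
    fix r assume r: "r \<in> C"
    have "\<exists>k\<le>Ni i. F (c i) (s r i) - \<eta> \<le> u k (c i) \<bullet> s r i + a k (c i)" if i: "i \<in> I" for i
    proof (rule Ni[OF i sZ[OF r i]])
      show "e \<bullet> s r i \<le> E / m i" using et1[OF r i] I(3)[OF i] by (simp add: s_def divide_right_mono)
    qed
    then obtain \<kappa> where \<kappa>: "\<And>i. i \<in> I \<Longrightarrow> \<kappa> i \<le> Ni i \<and> F (c i) (s r i) - \<eta> \<le> u (\<kappa> i) (c i) \<bullet> s r i + a (\<kappa> i) (c i)"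
      by metis
    define \<kappa>' where "\<kappa>' = restrict \<kappa> I"
    have "\<kappa>' \<in> Kap" using \<kappa> by (auto simp: Kap_def \<kappa>'_def)
    moreover have "0 \<le> f \<kappa>' r"
    proof -
      have "v - \<eta> * (1 + E) - \<eta> \<le> (\<Sum>i\<in>I. m i * F (c i) (s r i)) - \<eta> * (\<Sum>i\<in>I. m i)" using primal[OF r] sum_m by simp
      also have "\<dots> = (\<Sum>i\<in>I. m i * (F (c i) (s r i) - \<eta>))"
        by (simp add: sum_distrib_left right_diff_distrib sum_subtractf mult.commute)
      also have "\<dots> \<le> (\<Sum>i\<in>I. m i * (u (\<kappa> i) (c i) \<bullet> s r i + a (\<kappa> i) (c i)))"
        using \<kappa> I(3) by (intro sum_mono mult_left_mono) (auto simp: less_imp_le)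
      also have "\<dots> = (\<Sum>i\<in>I. u (\<kappa>' i) (c i) \<bullet> t r i + m i * a (\<kappa>' i) (c i))"
        using I(3) by (intro sum.cong) (auto simp: \<kappa>'_def s_def field_simps I0)
      finally show ?thesis by (simp add: f_def v'_def)
    qed
    ultimately show "\<exists>\<kappa>\<in>Kap. 0 \<le> f \<kappa> r" by blast
  qed
  then obtain l where l: "\<And>\<kappa>. \<kappa> \<in> Kap \<Longrightarrow> 0 \<le> l \<kappa>" "sum l Kap = 1" and lf: "\<And>r. r \<in> C \<Longrightarrow> 0 \<le> (\<Sum>\<kappa>\<in>Kap. l \<kappa> * f \<kappa> r)"
    by blast
  define w where "w i = (\<Sum>\<kappa>\<in>Kap. l \<kappa> *\<^sub>R u (\<kappa> i) (c i))" for i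
  define b where "b i = (\<Sum>\<kappa>\<in>Kap. l \<kappa> * a (\<kappa> i) (c i))" for i
  have minor: "w i \<bullet> z + b i \<le> F (c i) z" if i: "i \<in> I" and z: "z \<in> Z" for i z
  proof -
    have "w i \<bullet> z + b i = (\<Sum>\<kappa>\<in>Kap. l \<kappa> * (u (\<kappa> i) (c i) \<bullet> z + a (\<kappa> i) (c i)))"
      by (simp add: w_def b_def inner_sum_left distrib_left sum.distrib)
    also have "\<dots> \<le> (\<Sum>\<kappa>\<in>Kap. l \<kappa> * F (c i) z)"
      using l I(2)[OF i] z by (intro sum_mono mult_left_mono affine_minorant) auto
    also have "\<dots> = F (c i) z" using l(2) by (simp flip: sum_distrib_right)
    finally show ?thesis .
  qed
  have w_nonpos: "w i \<bullet> z \<le> 0" if i: "i \<in> I" and z: "z \<in> Z" for i z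
    unfolding w_def inner_sum_left
    using l(1) u_nonpos[OF I(2)[OF i] z] by (intro sum_nonpos) (auto intro!: mult_nonneg_nonpos)
  have dual_ineq: "v' \<le> (\<Sum>i\<in>I. w i \<bullet> t r i) + (\<Sum>i\<in>I. m i * b i)" if "r \<in> C" for r
  proof -
    have "0 \<le> (\<Sum>\<kappa>\<in>Kap. l \<kappa> * f \<kappa> r)" by (rule lf[OF that])
    also have "\<dots> = (\<Sum>\<kappa>\<in>Kap. \<Sum>i\<in>I. l \<kappa> * (u (\<kappa> i) (c i) \<bullet> t r i + m i * a (\<kappa> i) (c i))) - v'"
      using l(2) by (simp add: f_def right_diff_distrib sum_subtractf sum_distrib_left flip: sum_distrib_right)
    also have "(\<Sum>\<kappa>\<in>Kap. \<Sum>i\<in>I. l \<kappa> * (u (\<kappa> i) (c i) \<bullet> t r i + m i * a (\<kappa> i) (c i))) =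
        (\<Sum>i\<in>I. \<Sum>\<kappa>\<in>Kap. l \<kappa> * (u (\<kappa> i) (c i) \<bullet> t r i + m i * a (\<kappa> i) (c i)))" by (rule sum.swap)
    also have "\<dots> = (\<Sum>i\<in>I. w i \<bullet> t r i + m i * b i)"
      by (intro sum.cong) (auto simp: w_def b_def inner_sum_left distrib_left sum.distrib sum_distrib_left mult.left_commute)
    finally show ?thesis by (simp add: sum.distrib)
  qed
  define \<phi>0 where "\<phi>0 z = Max ((\<lambda>i. - (w i \<bullet> z)) ` I)" for z
  have \<phi>0_ge: "- (w i \<bullet> z) \<le> \<phi>0 z" if "i \<in> I" for i z
    unfolding \<phi>0_def using I(1) that by (intro Max_ge) auto
  have \<phi>0_le: "\<phi>0 z \<le> B" if "\<And>i. i \<in> I \<Longrightarrow> - (w i \<bullet> z) \<le> B" for z B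
    unfolding \<phi>0_def using I(1) I_ne that by (subst Max_le_iff) auto
  have \<phi>0_ex: "\<exists>i\<in>I. - (w i \<bullet> z) = \<phi>0 z" for z
  proof -
    have "\<phi>0 z \<in> (\<lambda>i. - (w i \<bullet> z)) ` I" unfolding \<phi>0_def using I(1) I_ne by (intro Max_in) auto
    then show ?thesis by auto
  qed
  have \<phi>0_cont: "continuous_on S \<phi>0" for S
    unfolding \<phi>0_def using I(1) I_ne
  proof (induction rule: finite_ne_induct)
    case (insert i J)
    then show ?case by (simp add: Max_insert) (intro continuous_on_max continuous_intros)
  qed (simp, intro continuous_intros)
  (* The linear term compensates the part of the modulus of F that grows with z. *)
  define \<phi> where "\<phi> z = \<phi>0 z + \<eta> * (e \<bullet> z)" for z
  have \<phi>0_nonneg: "0 \<le> \<phi>0 z" if "z \<in> Z" for z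
    using \<phi>0_ex[of z] w_nonpos[OF _ that] by fastforce
  have \<phi>0_sub: "\<phi>0 (x *\<^sub>R y + x' *\<^sub>R z) \<le> x * \<phi>0 y + x' * \<phi>0 z" if "0 \<le> x" "0 \<le> x'" for x x' y z
  proof (rule \<phi>0_le)
    fix i assume i: "i \<in> I"
    have "x * - (w i \<bullet> y) + x' * - (w i \<bullet> z) \<le> x * \<phi>0 y + x' * \<phi>0 z"
      using that i by (intro add_mono mult_left_mono \<phi>0_ge)
    then show "- (w i \<bullet> (x *\<^sub>R y + x' *\<^sub>R z)) \<le> x * \<phi>0 y + x' * \<phi>0 z" by (simp add: inner_add_right)
  qed
  have \<phi>0_hom: "\<phi>0 (x *\<^sub>R z) = x * \<phi>0 z" if x: "0 \<le> x" for x z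
  proof (rule antisym)
    show "\<phi>0 (x *\<^sub>R z) \<le> x * \<phi>0 z" using \<phi>0_sub[OF x order_refl, of z z] by simp
    obtain i where i: "i \<in> I" "- (w i \<bullet> z) = \<phi>0 z" using \<phi>0_ex by blast
    show "x * \<phi>0 z \<le> \<phi>0 (x *\<^sub>R z)"
      unfolding i(2)[symmetric] using \<phi>0_ge[OF i(1), of "x *\<^sub>R z"] by simp
  qed
  have cand: "(\<lambda>z. ereal (\<phi> z)) \<in> dual_candidates" and price: "price (\<lambda>z. ereal (\<phi> z)) = ennreal (\<integral>y. \<phi> y \<partial>\<nu>)"
    and \<phi>_int: "integrable \<nu> \<phi>"
  proof -
    have 1: "continuous_on Z \<phi>" unfolding \<phi>_def by (intro continuous_intros \<phi>0_cont)
    have 2: "0 \<le> \<phi> z" if "z \<in> Z" for z using \<phi>0_nonneg[OF that] e_nonneg[OF that] \<eta> by (simp add: \<phi>_def)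
    have 3: "\<phi> (x *\<^sub>R y + x' *\<^sub>R z) \<le> x * \<phi> y + x' * \<phi> z" if "y \<in> Z" "z \<in> Z" "0 \<le> x" "0 \<le> x'" for x x' y z
      using \<phi>0_sub[OF that(3,4), of y z] by (simp add: \<phi>_def inner_add_right algebra_simps)
    have 4: "\<phi> (x *\<^sub>R z) = x * \<phi> z" if "z \<in> Z" "0 \<le> x" for x z
      using \<phi>0_hom[OF that(2)] by (simp add: \<phi>_def algebra_simps)
    note S = sublinear_candidate[of \<phi>, OF 1 2 3 4]
    show "(\<lambda>z. ereal (\<phi> z)) \<in> dual_candidates" "price (\<lambda>z. ereal (\<phi> z)) = ennreal (\<integral>y. \<phi> y \<partial>\<nu>)" "integrable \<nu> \<phi>"
      using S by blast+
  qed
  have \<phi>0_meas[measurable]: "\<phi>0 \<in> borel_measurable borel" by (rule borel_measurable_continuous_onI[OF \<phi>0_cont])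
  have e_int: "integrable \<nu> (\<lambda>y. e \<bullet> y)" "(\<integral>y. e \<bullet> y \<partial>\<nu>) \<le> E"
  proof -
    show 1: "integrable \<nu> (\<lambda>y. e \<bullet> y)"
      using idY e_le_E e_ge_1 by (intro nu.integrable_const_bound[where B=E] AE_I2) (force simp: space_nu abs_le_iff)+
    show "(\<integral>y. e \<bullet> y \<partial>\<nu>) \<le> E"
      by (rule nu.integral_le_const[OF 1]) (use e_le_E in \<open>auto simp: space_nu intro!: AE_I2\<close>)
  qed
  have \<phi>0_int: "integrable \<nu> \<phi>0"
  proof -
    have "integrable \<nu> (\<lambda>y. \<phi> y - \<eta> * (e \<bullet> y))" using \<phi>_int e_int by simp
    then show ?thesis by (simp add: \<phi>_def)
  qed
  (* The optimal partition of unity for the linear problem; LEAST makes the choice among minimisers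
     measurable. *)
  define r where "r i y = (if i = (LEAST j. j \<in> I \<and> - (w j \<bullet> y) = \<phi>0 y) then 1 else 0 :: real)" for i y
  have least: "(LEAST j. j \<in> I \<and> - (w j \<bullet> y) = \<phi>0 y) \<in> I" "- (w (LEAST j. j \<in> I \<and> - (w j \<bullet> y) = \<phi>0 y) \<bullet> y) = \<phi>0 y" for y
    using LeastI_ex[of "\<lambda>j. j \<in> I \<and> - (w j \<bullet> y) = \<phi>0 y"] \<phi>0_ex[of y] by auto
  have rC: "r \<in> C"
    unfolding C_def
  proof (intro CollectI conjI allI ballI)
    fix i
    have "r i \<in> borel_measurable borel" unfolding r_def by measurable
    then show "r i \<in> borel_measurable (borel_on Y)" by (rule measurable_restrict_space1)
    fix y show "0 \<le> r i y" "r i y \<le> 1" by (auto simp: r_def)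
  next
    fix y show "(\<Sum>i\<in>I. r i y) = 1" using least I(1) by (simp add: r_def)
  qed
  have "(\<Sum>i\<in>I. w i \<bullet> t r i) = (\<integral>y. - \<phi>0 y \<partial>\<nu>)"
    unfolding sum_t[OF rC]
  proof (rule Bochner_Integration.integral_cong[OF refl])
    fix y
    have "(\<Sum>i\<in>I. r i y * (w i \<bullet> y)) = (\<Sum>i\<in>I. if i = (LEAST j. j \<in> I \<and> - (w j \<bullet> y) = \<phi>0 y) then w i \<bullet> y else 0)"
      by (intro sum.cong) (auto simp: r_def)
    also have "\<dots> = w (LEAST j. j \<in> I \<and> - (w j \<bullet> y) = \<phi>0 y) \<bullet> y" using least(1) I(1) by simp
    finally show "(\<Sum>i\<in>I. r i y * (w i \<bullet> y)) = - \<phi>0 y" using least(2)[of y] by simp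
  qed
  then have v'_le: "v' \<le> - (\<integral>y. \<phi>0 y \<partial>\<nu>) + (\<Sum>i\<in>I. m i * b i)"
    using dual_ineq[OF rC] by simp
  have b_nonpos: "b i \<le> 0" if "i \<in> I" for i
    using minor[OF that zero_in_Z] F_nonpos[OF I(2)[OF that] zero_in_Z] by simp
  have Qge: "AE x in \<mu>. ereal (b (idx x) - \<eta>) \<le> Q (\<lambda>z. ereal (\<phi> z)) x"
    using idxI AE_space
  proof eventually_elim
    case (elim x)
    then have x: "x \<in> X" "idx x \<in> I" by (auto simp: space_mu)
    show ?case
      unfolding Q_trans_def
    proof (rule INF_greatest)
      fix z assume z: "z \<in> Z"
      have "w (idx x) \<bullet> z + b (idx x) \<le> F x z + \<eta> * (1 + e \<bullet> z)"
        using minor[OF x(2) z] mod[of "c (idx x)" x z] idx[OF x(1)] I(2)[OF x(2)] x(1) z by linarith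
      moreover have "- (w (idx x) \<bullet> z) \<le> \<phi>0 z" by (rule \<phi>0_ge[OF x(2)])
      ultimately have "b (idx x) - \<eta> \<le> \<phi> z + F x z" by (simp add: \<phi>_def algebra_simps)
      then show "ereal (b (idx x) - \<eta>) \<le> ereal (\<phi> z) + ereal (F x z)" by simp
    qed
  qed
  have "Q_loss (\<lambda>z. ereal (\<phi> z)) \<le> (\<integral>\<^sup>+x. ennreal (\<eta> - b (idx x)) \<partial>\<mu>)"
    unfolding Q_loss_def
  proof (rule nn_integral_mono_AE, use Qge in eventually_elim)
    case (elim x)
    then have "- Q (\<lambda>z. ereal (\<phi> z)) x \<le> ereal (\<eta> - b (idx x))"
      by (cases "Q (\<lambda>z. ereal (\<phi> z)) x") auto
    from e2ennreal_mono[OF this] show ?case by simp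
  qed
  also have "\<dots> = ennreal (\<Sum>i\<in>I. m i * (\<eta> - b i))"
  proof -
    have "AE x in \<mu>. 0 \<le> \<eta> - b (idx x)"
      using idxI
    proof eventually_elim
      case (elim x)
      show ?case using b_nonpos[OF elim] \<eta> by linarith
    qed
    from nn_integral_eq_integral[OF step_int(1) this] show ?thesis
      using step_int(2)[of "\<lambda>i. \<eta> - b i"] by simp
  qed
  finally have loss: "Q_loss (\<lambda>z. ereal (\<phi> z)) \<le> ennreal (\<eta> - (\<Sum>i\<in>I. m i * b i))"
    using sum_m by (simp add: right_diff_distrib sum_subtractf flip: sum_distrib_right)
  have "(\<integral>y. \<phi> y \<partial>\<nu>) = (\<integral>y. \<phi>0 y \<partial>\<nu>) + \<eta> * (\<integral>y. e \<bullet> y \<partial>\<nu>)"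
    unfolding \<phi>_def using \<phi>0_int e_int by simp
  then have pr: "(\<integral>y. \<phi> y \<partial>\<nu>) \<le> (\<integral>y. \<phi>0 y \<partial>\<nu>) + \<eta> * E" using e_int(2) \<eta> by simp
  have pr0: "0 \<le> (\<integral>y. \<phi> y \<partial>\<nu>)"
    using \<phi>0_nonneg e_nonneg Y_subset_Z \<eta> by (intro integral_nonneg_AE AE_I2) (auto simp: \<phi>_def space_nu subset_iff)
  have mb: "(\<Sum>i\<in>I. m i * b i) \<le> 0" using b_nonpos I(3) by (intro sum_nonpos mult_nonneg_nonpos) (auto simp: less_imp_le)
  define D where "D = (\<eta> - (\<Sum>i\<in>I. m i * b i)) + (\<integral>y. \<phi> y \<partial>\<nu>)"
  have "Q_loss (\<lambda>z. ereal (\<phi> z)) + price (\<lambda>z. ereal (\<phi> z)) \<le> ennreal (\<eta> - (\<Sum>i\<in>I. m i * b i)) + ennreal (\<integral>y. \<phi> y \<partial>\<nu>)"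
    unfolding price using loss by (rule add_right_mono)
  also have "\<dots> = ennreal D" unfolding D_def using mb \<eta> pr0 by (intro ennreal_plus[symmetric]) auto
  finally have leD: "Q_loss (\<lambda>z. ereal (\<phi> z)) + price (\<lambda>z. ereal (\<phi> z)) \<le> ennreal D" .
  have "0 \<le> D" using mb \<eta> pr0 by (simp add: D_def)
  with leD have "enn2ereal (Q_loss (\<lambda>z. ereal (\<phi> z)) + price (\<lambda>z. ereal (\<phi> z))) \<le> ereal D"
    by (simp add: less_eq_ennreal.rep_eq enn2ereal_ennreal)
  moreover have "D \<le> - (v - \<eta> * (3 + 2 * E))"
    using v'_le pr unfolding D_def v'_def by (simp add: algebra_simps)
  ultimately have "ereal (v - \<eta> * (3 + 2 * E)) \<le> dual_objective Z F \<mu> \<nu> (\<lambda>z. ereal (\<phi> z))"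
    unfolding dual_objective_eq[OF cand]
    by (cases "enn2ereal (Q_loss (\<lambda>z. ereal (\<phi> z)) + price (\<lambda>z. ereal (\<phi> z)))") auto
  then show ?thesis using cand by blast
qed

end

section \<open>Attainment of the dual supremum\<close>

text \<open>
  Tail infima increase, so their suprema add up.
\<close>

lemma ennreal_liminf_add_le:
  fixes f g :: "nat \<Rightarrow> ennreal"
  shows "liminf f + liminf g \<le> liminf (\<lambda>n. f n + g n)"
proof -
  have inc: "incseq (\<lambda>n. INF m\<in>{n..}. h m)" for h :: "nat \<Rightarrow> ennreal"
    by (auto simp: incseq_def intro!: INF_superset_mono)
  have "liminf f + liminf g = (SUP n. (INF m\<in>{n..}. f m) + (INF m\<in>{n..}. g m))"
    unfolding liminf_SUP_INF by (rule ennreal_SUP_add[symmetric]) (rule inc)+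
  also have "\<dots> \<le> liminf (\<lambda>n. f n + g n)"
    unfolding liminf_SUP_INF
    by (intro SUP_mono' INF_greatest add_mono INF_lower) auto
  finally show ?thesis .
qed

context barycentric_problem
begin

text \<open>
  The common value of the primal and the dual problem.
\<close>

definition V :: real where "V = real_of_ereal (transport_value X Y (barycentric_cost F) \<mu> \<nu>)"

lemma plan_exists: "plans \<noteq> {}"
proof -
  have "(\<lambda>_. 1) \<in> borel_measurable (borel_on X \<Otimes>\<^sub>M borel_on Y)" by simp
  from plan_of_density[OF this, of 1] show ?thesis using mu.prob_space by auto
qed

lemma cost_real: assumes "p \<in> plans" shows "\<exists>r. cost p = ereal r \<and> r \<le> 0"
proof -
  interpret P: barycentric_plan X Y Z F a u \<mu> \<nu> p by unfold_locales (rule assms)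
  have "(\<integral>x. F x (P.S x) \<partial>\<mu>) \<le> 0"
  proof -
    have "AE x in \<mu>. 0 \<le> - F x (P.S x)"
      using F_nonpos P.S_in_Z by (intro AE_I2) (simp add: space_mu)
    from integral_nonneg_AE[OF this] show ?thesis by simp
  qed
  then show ?thesis using P.transport_cost_eq by blast
qed

lemma cost_lower: "\<exists>B. \<forall>p\<in>plans. ereal B \<le> cost p"
proof -
  obtain M where M: "\<And>x z. x \<in> X \<Longrightarrow> z \<in> Z \<Longrightarrow> - 1 * (e \<bullet> z) - M \<le> F x z"
    using sublinear_lower_bound[of 1] by auto
  have "ereal (- E - M) \<le> cost p" if "p \<in> plans" for p
  proof -
    interpret P: barycentric_plan X Y Z F a u \<mu> \<nu> p by unfold_locales (rule that)
    have "- E - M \<le> (\<integral>x. - (e \<bullet> P.S x) - M \<partial>\<mu>)"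
      using P.e_inner_integral P.S_integrable mu.prob_space by simp
    also have "\<dots> \<le> (\<integral>x. F x (P.S x) \<partial>\<mu>)"
      using P.S_integrable P.cost_integrable M P.S_in_Z by (intro integral_mono_AE AE_I2) (auto simp: space_mu)
    finally show ?thesis using P.transport_cost_eq by simp
  qed
  then show ?thesis by blast
qed

lemma transport_value_eq: "transport_value X Y (barycentric_cost F) \<mu> \<nu> = ereal V" and V_nonpos: "V \<le> 0"
proof -
  let ?T = "transport_value X Y (barycentric_cost F) \<mu> \<nu>"
  obtain B where "\<forall>p\<in>plans. ereal B \<le> cost p" using cost_lower by blast
  then have "ereal B \<le> ?T" unfolding transport_value_def by (intro INF_greatest) auto
  moreover obtain p where p: "p \<in> plans" using plan_exists by blast
  then obtain r where r: "cost p = ereal r" "r \<le> 0" using cost_real by blast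
  have "?T \<le> ereal r" unfolding transport_value_def using p r by (intro INF_lower2[of p]) auto
  ultimately show "?T = ereal V" "V \<le> 0" using r(2) unfolding V_def by (cases ?T; auto)+
qed

lemma V_le_cost: "p \<in> plans \<Longrightarrow> ereal V \<le> cost p"
  unfolding transport_value_eq[symmetric] transport_value_def by (rule INF_lower)

lemma dual_le_V: "\<phi> \<in> dual_candidates \<Longrightarrow> dual_objective Z F \<mu> \<nu> \<phi> \<le> ereal V"
  unfolding transport_value_eq[symmetric] transport_value_def by (rule INF_greatest) (rule weak_duality)

lemma dual_near_V:
  assumes \<epsilon>: "0 < \<epsilon>"
  shows "\<exists>\<phi>\<in>dual_candidates. Q_loss \<phi> + price \<phi> \<le> ennreal (- V + \<epsilon>)"
proof -
  define \<eta> where "\<eta> = \<epsilon> / (3 + 2 * E)"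
  have \<eta>: "0 < \<eta>" "\<eta> * (3 + 2 * E) = \<epsilon>" using \<epsilon> E_nonneg by (auto simp: \<eta>_def intro!: divide_pos_pos)
  obtain \<phi> where \<phi>: "\<phi> \<in> dual_candidates" "ereal (V - \<epsilon>) \<le> dual_objective Z F \<mu> \<nu> \<phi>"
    using approximate_duality[OF V_le_cost \<eta>(1)] \<eta>(2) by auto
  have "enn2ereal (Q_loss \<phi> + price \<phi>) \<le> ereal (- V + \<epsilon>)"
    using \<phi>(2) unfolding dual_objective_eq[OF \<phi>(1)] by (cases "enn2ereal (Q_loss \<phi> + price \<phi>)") auto
  also have "\<dots> = enn2ereal (ennreal (- V + \<epsilon>))" using V_nonpos \<epsilon> by (simp add: enn2ereal_ennreal)
  finally show ?thesis using \<phi>(1) by (auto simp: less_eq_ennreal.rep_eq)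
qed

lemma lsc_on_measurable:
  assumes lsc: "lsc_on Z g"
  shows "g \<in> borel_measurable \<nu>"
proof (rule borel_measurableI_greater)
  fix y
  have "\<exists>W. open W \<and> z \<in> W \<and> (\<forall>x\<in>W \<inter> Z. y < g x)" if "z \<in> Z" "y < g z" for z
  proof -
    have "y < Liminf (at z within Z) g" using lsc that unfolding lsc_on_def by (meson less_le_trans)
    then have "eventually (\<lambda>z. y < g z) (at z within Z)" by (rule less_LiminfD)
    then obtain W where "open W" "z \<in> W" "\<And>x. x \<in> W \<Longrightarrow> x \<noteq> z \<Longrightarrow> x \<in> Z \<Longrightarrow> y < g x"
      unfolding eventually_at_topological by blast
    then show ?thesis using that(2) by blast
  qed
  then have "\<forall>z\<in>{z\<in>Z. y < g z}. \<exists>W. open W \<and> z \<in> W \<and> (\<forall>x\<in>W \<inter> Z. y < g x)" by blast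
  then obtain W where W: "\<forall>z\<in>{z\<in>Z. y < g z}. open (W z) \<and> z \<in> W z \<and> (\<forall>x\<in>W z \<inter> Z. y < g x)"
    by (rule bchoice[THEN exE])
  have "{x \<in> space \<nu>. y < g x} = Y \<inter> (\<Union>z\<in>{z\<in>Z. y < g z}. W z)"
    using W Y_subset_Z unfolding space_nu by blast
  moreover have "open (\<Union>z\<in>{z\<in>Z. y < g z}. W z)" using W by auto
  ultimately show "{x \<in> space \<nu>. y < g x} \<in> sets \<nu>"
    by (auto simp: sets_nu sets_restrict_space)
qed

text \<open>
  The limit \<open>g\<close> lies below the pointwise lower limit of the sequence, which bounds its
  price by Fatou's lemma. Recovery sequences give that \<open>Q g x\<close> is at least the upper
  limit of \<open>Q (f n) x\<close>, and Fatou's lemma applies again because all these functions are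
  nonpositive.
\<close>

lemma dual_attained: "\<exists>\<phi>\<in>dual_candidates. dual_objective Z F \<mu> \<nu> \<phi> = ereal V"
proof -
  have "\<forall>n. \<exists>\<phi>. \<phi> \<in> dual_candidates \<and> Q_loss \<phi> + price \<phi> \<le> ennreal (- V + 1 / real (Suc n))"
  proof
    fix n
    have "0 < 1 / real (Suc n)" by simp
    from dual_near_V[OF this]
    show "\<exists>\<phi>. \<phi> \<in> dual_candidates \<and> Q_loss \<phi> + price \<phi> \<le> ennreal (- V + 1 / real (Suc n))" by blast
  qed
  then obtain f where "\<forall>n. f n \<in> dual_candidates \<and> Q_loss (f n) + price (f n) \<le> ennreal (- V + 1 / real (Suc n))"
    by (rule choice[THEN exE])
  then have f: "\<And>n. f n \<in> dual_candidates" and fV: "\<And>n. Q_loss (f n) + price (f n) \<le> ennreal (- V + 1 / real (Suc n))"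
    by auto
  obtain r g where r: "strict_mono r" and lsc: "lsc_on Z g"
    and lower: "\<And>z s. z \<in> Z \<Longrightarrow> (\<And>n. s n \<in> Z) \<Longrightarrow> s \<longlonglongrightarrow> z \<Longrightarrow> g z \<le> liminf (\<lambda>n. f (r n) (s n))"
    and recov: "\<And>z. z \<in> Z \<Longrightarrow> \<exists>s. (\<forall>n. s n \<in> Z) \<and> s \<longlonglongrightarrow> z \<and> (\<lambda>n. f (r n) (s n)) \<longlonglongrightarrow> g z"
    using epi_convergent_subsequence[of Z f] by blast
  note f_props = dual_candidate[OF f]
  have nonneg: "0 \<le> g z" if z: "z \<in> Z" for z
  proof -
    obtain s where s: "\<forall>n. s n \<in> Z" "(\<lambda>n. f (r n) (s n)) \<longlonglongrightarrow> g z" using recov[OF z] by blast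
    show ?thesis by (rule LIMSEQ_le_const[OF s(2)]) (use f_props(1) s(1) in auto)
  qed
  have le_liminf: "g z \<le> liminf (\<lambda>n. f (r n) z)" if "z \<in> Z" for z
    using lower[of z "\<lambda>_. z"] that by simp
  have g0: "g 0 = 0"
    using le_liminf[OF zero_in_Z] nonneg[OF zero_in_Z] f_props(8) by (simp add: Liminf_const)
  (* Positive weights only: with a weight 0 at an infinite value the products would not converge. *)
  have convex: "g (s *\<^sub>R y + t *\<^sub>R z) \<le> ereal s * g y + ereal t * g z"
    if yz: "y \<in> Z" "z \<in> Z" and st: "0 < s" "0 < t" "s + t = 1" for s t y z
  proof -
    obtain v where v: "\<And>n. v n \<in> Z" "v \<longlonglongrightarrow> y" "(\<lambda>n. f (r n) (v n)) \<longlonglongrightarrow> g y" using recov[OF yz(1)] by blast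
    obtain w where w: "\<And>n. w n \<in> Z" "w \<longlonglongrightarrow> z" "(\<lambda>n. f (r n) (w n)) \<longlonglongrightarrow> g z" using recov[OF yz(2)] by blast
    have "g (s *\<^sub>R y + t *\<^sub>R z) \<le> liminf (\<lambda>n. f (r n) (s *\<^sub>R v n + t *\<^sub>R w n))"
      using yz v w st by (intro lower add_in_Z scale_in_Z tendsto_intros) auto
    also have "\<dots> \<le> liminf (\<lambda>n. ereal s * f (r n) (v n) + ereal t * f (r n) (w n))"
      using f_props(3) v(1) w(1) st unfolding ext_convex_on_def
      by (intro Liminf_mono always_eventually allI) auto
    also have "\<dots> = ereal s * g y + ereal t * g z"
    proof (rule lim_imp_Liminf)
      have "(\<lambda>n. ereal s * f (r n) (v n)) \<longlonglongrightarrow> ereal s * g y" "(\<lambda>n. ereal t * f (r n) (w n)) \<longlonglongrightarrow> ereal t * g z"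
        by (intro tendsto_cmult_ereal v w; simp)+
      then show "(\<lambda>n. ereal s * f (r n) (v n) + ereal t * f (r n) (w n)) \<longlonglongrightarrow> ereal s * g y + ereal t * g z"
        using nonneg yz f_props(1) v w st by (intro tendsto_add_ereal_nonneg) (auto intro!: always_eventually)
    qed simp
    finally show ?thesis .
  qed
  have scale_le: "g (t *\<^sub>R z) \<le> ereal t * g z" if z: "z \<in> Z" and t: "0 < t" for t z
  proof -
    obtain v where v: "\<And>n. v n \<in> Z" "v \<longlonglongrightarrow> z" "(\<lambda>n. f (r n) (v n)) \<longlonglongrightarrow> g z" using recov[OF z] by blast
    have "g (t *\<^sub>R z) \<le> liminf (\<lambda>n. f (r n) (t *\<^sub>R v n))"
      using z v t by (intro lower scale_in_Z tendsto_intros) auto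
    also have "\<dots> \<le> liminf (\<lambda>n. ereal t * f (r n) (v n))"
    proof (intro Liminf_mono always_eventually allI)
      fix n
      show "f (r n) (t *\<^sub>R v n) \<le> ereal t * f (r n) (v n)"
      proof (cases "f (r n) (v n) < \<infinity>")
        case True
        then have "f (r n) (t *\<^sub>R v n) = ereal t * f (r n) (v n)"
          using f_props(4)[of "r n"] v(1)[of n] t unfolding pos_homogeneous_on_def by auto
        then show ?thesis by simp
      next
        case False
        then show ?thesis using t by simp
      qed
    qed
    also have "\<dots> = ereal t * g z"
      by (rule lim_imp_Liminf) (auto intro!: tendsto_cmult_ereal v)
    finally show ?thesis .
  qed
  have "ext_convex_on Z g"
    unfolding ext_convex_on_def
  proof (intro conjI convex_Z ballI allI impI)
    fix y z and s t :: real assume h: "y \<in> Z" "z \<in> Z" "0 \<le> s" "0 \<le> t" "s + t = 1"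
    consider "s = 0" "t = 1" | "t = 0" "s = 1" | "0 < s" "0 < t" using h by linarith
    then show "g (s *\<^sub>R y + t *\<^sub>R z) \<le> ereal s * g y + ereal t * g z"
      by cases (use convex h in \<open>auto simp flip: zero_ereal_def one_ereal_def\<close>)
  qed
  moreover have "pos_homogeneous_on Z g"
    unfolding pos_homogeneous_on_def
  proof (intro allI ballI impI)
    fix t :: real and z assume t: "0 \<le> t" and z: "z \<in> Z" and fin: "g z < \<infinity>"
    show "g (t *\<^sub>R z) = ereal t * g z"
    proof (cases "t = 0")
      case True
      then show ?thesis using g0 by (simp flip: zero_ereal_def)
    next
      case False
      then have t: "0 < t" using t by simp
      have "g ((1 / t) *\<^sub>R (t *\<^sub>R z)) \<le> ereal (1 / t) * g (t *\<^sub>R z)"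
        using t z by (intro scale_le scale_in_Z) auto
      then have "g z \<le> ereal (1 / t) * g (t *\<^sub>R z)" using t by simp
      then have "ereal t * g z \<le> ereal t * (ereal (1 / t) * g (t *\<^sub>R z))" using t by (intro ereal_mult_left_mono) auto
      also have "\<dots> = g (t *\<^sub>R z)" using t by (simp add: mult.assoc[symmetric] one_ereal_def[symmetric])
      finally show ?thesis using scale_le[OF z t] by (rule antisym[rotated])
    qed
  qed
  ultimately have Phi: "g \<in> Phi_plus Z" using lsc nonneg by (simp add: Phi_plus_def)
  have gm: "g \<in> borel_measurable \<nu>" by (rule lsc_on_measurable[OF lsc])
  have fm: "f n \<in> borel_measurable \<nu>" for n by (rule f_props(5))
  have price_le: "price g \<le> liminf (\<lambda>n. price (f (r n)))"
  proof -
    have "price g \<le> (\<integral>\<^sup>+y. liminf (\<lambda>n. e2ennreal (f (r n) y)) \<partial>\<nu>)"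
      unfolding price_def
    proof (rule nn_integral_mono)
      fix y assume "y \<in> space \<nu>"
      then have y: "y \<in> Z" using Y_subset_Z by (auto simp: space_nu)
      show "e2ennreal (g y) \<le> liminf (\<lambda>n. e2ennreal (f (r n) y))"
        unfolding le_Liminf_iff
      proof (intro allI impI)
        fix c assume c: "c < e2ennreal (g y)"
        have "enn2ereal c < g y"
          using c nonneg[OF y] by (simp add: less_ennreal.rep_eq enn2ereal_e2ennreal)
        then have "eventually (\<lambda>n. enn2ereal c < f (r n) y) sequentially"
          using less_LiminfD le_liminf[OF y] less_le_trans by blast
        then show "eventually (\<lambda>n. c < e2ennreal (f (r n) y)) sequentially"
          by eventually_elim (simp add: less_ennreal.rep_eq enn2ereal_e2ennreal f_props(1) y)
      qed
    qed
    also have "\<dots> \<le> liminf (\<lambda>n. \<integral>\<^sup>+y. e2ennreal (f (r n) y) \<partial>\<nu>)"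
      using fm by (intro nn_integral_liminf) auto
    finally show ?thesis unfolding price_def .
  qed
  have loss_le: "Q_loss g \<le> liminf (\<lambda>n. Q_loss (f (r n)))"
  proof -
    have "Q_loss g \<le> (\<integral>\<^sup>+x. liminf (\<lambda>n. e2ennreal (- Q (f (r n)) x)) \<partial>\<mu>)"
      unfolding Q_loss_def
    proof (rule nn_integral_mono)
      fix x assume "x \<in> space \<mu>"
      then have x: "x \<in> X" by (simp add: space_mu)
      show "e2ennreal (- Q g x) \<le> liminf (\<lambda>n. e2ennreal (- Q (f (r n)) x))"
        unfolding le_Liminf_iff
      proof (intro allI impI)
        fix c assume c: "c < e2ennreal (- Q g x)"
        have nQ: "0 \<le> - Q g x" "0 \<le> - Q (f n) x" for n
          using Q_nonpos[where \<phi>=g, OF g0 x] Q_nonpos[where \<phi>="f n", OF f_props(8) x] by (auto simp: ereal_0_le_uminus_iff)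
        have "enn2ereal c < - Q g x"
          using c nQ by (simp add: less_ennreal.rep_eq enn2ereal_e2ennreal)
        then have "Q g x < - enn2ereal c" by (simp add: ereal_less_uminus_reorder)
        then obtain z where z: "z \<in> Z" "g z + ereal (F x z) < - enn2ereal c"
          unfolding Q_trans_def by (auto simp: INF_less_iff)
        obtain s where s: "\<And>n. s n \<in> Z" "s \<longlonglongrightarrow> z" "(\<lambda>n. f (r n) (s n)) \<longlonglongrightarrow> g z" using recov[OF z(1)] by blast
        have "g z \<noteq> \<infinity>" using z(2) by auto
        then have fin: "\<bar>g z\<bar> \<noteq> \<infinity>" using nonneg[OF z(1)] by auto
        have "(\<lambda>n. f (r n) (s n) + ereal (F x (s n))) \<longlonglongrightarrow> g z + ereal (F x z)"
          using fin x z s by (intro tendsto_add_ereal tendsto_ereal tendsto_F) auto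
        then have "eventually (\<lambda>n. f (r n) (s n) + ereal (F x (s n)) < - enn2ereal c) sequentially"
          using z(2) by (rule order_tendstoD)
        then show "eventually (\<lambda>n. c < e2ennreal (- Q (f (r n)) x)) sequentially"
        proof eventually_elim
          case (elim n)
          have "Q (f (r n)) x < - enn2ereal c" using Q_le[OF s(1)] elim by (rule le_less_trans)
          then have "enn2ereal c < - Q (f (r n)) x" by (simp add: ereal_less_uminus_reorder)
          then show ?case using nQ by (simp add: less_ennreal.rep_eq enn2ereal_e2ennreal)
        qed
      qed
    qed
    also have "\<dots> \<le> liminf (\<lambda>n. \<integral>\<^sup>+x. e2ennreal (- Q (f (r n)) x) \<partial>\<mu>)"
      using Q_measurable[OF f_props(1)] by (intro nn_integral_liminf) auto
    finally show ?thesis unfolding Q_loss_def .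
  qed
  have "Q_loss g + price g \<le> liminf (\<lambda>n. Q_loss (f (r n))) + liminf (\<lambda>n. price (f (r n)))"
    using loss_le price_le by (rule add_mono)
  also have "\<dots> \<le> liminf (\<lambda>n. Q_loss (f (r n)) + price (f (r n)))"
    by (rule ennreal_liminf_add_le)
  also have "\<dots> \<le> liminf (\<lambda>n. ennreal (- V + 1 / real (Suc (r n))))"
    by (intro Liminf_mono always_eventually allI fV)
  also have "\<dots> = ennreal (- V + 0)"
  proof (rule lim_imp_Liminf)
    have "(\<lambda>n. 1 / real (Suc (r n))) \<longlonglongrightarrow> 0"
      using LIMSEQ_subseq_LIMSEQ[OF LIMSEQ_inverse_real_of_nat r] by (simp add: o_def inverse_eq_divide)
    then show "(\<lambda>n. ennreal (- V + 1 / real (Suc (r n)))) \<longlonglongrightarrow> ennreal (- V + 0)"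
      by (intro tendsto_ennrealI tendsto_add tendsto_const)
  qed simp
  finally have le: "Q_loss g + price g \<le> ennreal (- V)" by simp
  have "price g < \<infinity>" using le by (auto simp: less_top[symmetric] top_unique)
  moreover have "price g = (\<integral>\<^sup>+y. e2ennreal \<bar>g y\<bar> \<partial>\<nu>)"
    unfolding price_def using nonneg Y_subset_Z by (intro nn_integral_cong) (auto simp: space_nu)
  ultimately have cand: "g \<in> dual_candidates" using Phi gm by (simp add: ext_L1_def)
  have "enn2ereal (Q_loss g + price g) \<le> ereal (- V)"
    using le V_nonpos by (simp add: less_eq_ennreal.rep_eq enn2ereal_ennreal)
  then have "ereal V \<le> dual_objective Z F \<mu> \<nu> g"
    unfolding dual_objective_eq[OF cand] by (cases "enn2ereal (Q_loss g + price g)") auto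
  then show ?thesis using dual_le_V[OF cand] cand antisym by blast
qed

text \<open>
  If \<open>\<phi>\<close> were below \<open>(e \<bullet> z) / l\<close> at some \<open>z\<close>,
  then at the multiple of \<open>z\<close> with gauge \<open>l\<close> it would be at most
  \<open>1\<close> while \<open>F\<close> is at most \<open>V - 2\<close> there for all
  \<open>x\<close>. That forces \<open>Q \<phi> \<le> V - 1\<close>, which is too low for an optimal
  \<open>\<phi>\<close>.
\<close>

lemma dual_optimal_coercive:
  assumes \<phi>: "\<phi> \<in> dual_candidates" and opt: "dual_objective Z F \<mu> \<nu> \<phi> = ereal V"
  shows "\<exists>\<delta>>0. \<forall>z\<in>Z. ereal (\<delta> * (e \<bullet> z)) \<le> \<phi> z"
proof -
  obtain l where l: "0 < l" "\<And>x z. x \<in> X \<Longrightarrow> z \<in> Z \<Longrightarrow> l \<le> e \<bullet> z \<Longrightarrow> F x z \<le> - (2 - V)"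
    using coercive[of "2 - V"] by auto
  define \<delta> where "\<delta> = 1 / l"
  have "ereal (\<delta> * (e \<bullet> z)) \<le> \<phi> z" if z: "z \<in> Z" for z
  proof (rule ccontr)
    assume not: "\<not> ereal (\<delta> * (e \<bullet> z)) \<le> \<phi> z"
    then have small: "\<phi> z < ereal (\<delta> * (e \<bullet> z))" by simp
    then have fin: "\<phi> z < \<infinity>" by (cases "\<phi> z") auto
    have "z \<noteq> 0" using not dual_candidate(8)[OF \<phi>] by auto
    then have ez: "0 < e \<bullet> z" using e_pos z by auto
    define k where "k = l / (e \<bullet> z)"
    have k: "0 < k" using l ez by (simp add: k_def)
    have kz: "k *\<^sub>R z \<in> Z" "e \<bullet> (k *\<^sub>R z) = l" using scale_in_Z z k ez by (auto simp: k_def)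
    have "\<phi> (k *\<^sub>R z) = ereal k * \<phi> z"
      using dual_candidate(4)[OF \<phi>] z k fin unfolding pos_homogeneous_on_def by auto
    also have "\<dots> \<le> ereal k * ereal (\<delta> * (e \<bullet> z))" using small k by (intro ereal_mult_left_mono) auto
    also have "\<dots> = ereal 1" using ez l by (simp add: k_def \<delta>_def)
    finally have \<phi>k: "\<phi> (k *\<^sub>R z) \<le> ereal 1" .
    have "ennreal (1 - V) = (\<integral>\<^sup>+x. ennreal (1 - V) \<partial>\<mu>)" by (simp add: mu.emeasure_space_1)
    also have "\<dots> \<le> Q_loss \<phi>"
      unfolding Q_loss_def
    proof (rule nn_integral_mono)
      fix x assume "x \<in> space \<mu>"
      then have x: "x \<in> X" by (simp add: space_mu)
      have "Q \<phi> x \<le> \<phi> (k *\<^sub>R z) + ereal (F x (k *\<^sub>R z))" by (rule Q_le[OF kz(1)])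
      also have "\<dots> \<le> ereal 1 + ereal (- (2 - V))"
        using \<phi>k l(2)[OF x kz(1)] kz(2) by (intro add_mono) auto
      finally have "ereal (1 - V) \<le> - Q \<phi> x" by (cases "Q \<phi> x") auto
      from e2ennreal_mono[OF this] show "ennreal (1 - V) \<le> e2ennreal (- Q \<phi> x)" by simp
    qed
    also have "\<dots> \<le> Q_loss \<phi> + price \<phi>" by simp
    finally have "ereal (1 - V) \<le> enn2ereal (Q_loss \<phi> + price \<phi>)"
      using V_nonpos by (simp add: less_eq_ennreal.rep_eq enn2ereal_ennreal)
    then show False using opt unfolding dual_objective_eq[OF \<phi>]
      by (cases "enn2ereal (Q_loss \<phi> + price \<phi>)") auto
  qed
  then show ?thesis using l by (intro exI[of _ \<delta>]) (auto simp: \<delta>_def)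
qed

end

section \<open>Weak solutions are strong\<close>

context barycentric_problem
begin

text \<open>
  The slack \<open>h x = F x (S x) + g x - Q \<phi> x\<close> in weak duality is nonnegative and
  integrates to the cost of the plan minus \<open>V\<close>. Since \<open>g x \<ge> \<delta> * (e
  \<bullet> S x)\<close> while \<open>F\<close> loses, up to a constant, at most half of this
  growth, the slack dominates a multiple of \<open>e \<bullet> S x\<close> as soon as this exceeds
  \<open>C\<close>. Because \<open>e \<ge> 1\<close> on \<open>Y\<close>, the mass of the first
  marginal is controlled by \<open>e \<bullet> S\<close>.
\<close>

lemma excess_mass:
  assumes \<phi>: "\<phi> \<in> dual_candidates" and opt: "dual_objective Z F \<mu> \<nu> \<phi> = ereal V"
  shows "\<exists>C\<ge>0. \<exists>k\<ge>0. \<forall>p\<in>plans. \<forall>f. f \<in> borel_measurable (borel_on X) \<longrightarrow> (\<forall>x\<in>X. 0 \<le> f x \<and> f x \<le> 1) \<longrightarrow>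
    (\<integral>z. f (fst z) \<partial>p) \<le> C * (\<integral>x. f x \<partial>\<mu>) + k * (real_of_ereal (cost p) - V)"
proof -
  obtain \<delta> where \<delta>: "0 < \<delta>" "\<And>z. z \<in> Z \<Longrightarrow> ereal (\<delta> * (e \<bullet> z)) \<le> \<phi> z"
    using dual_optimal_coercive[OF \<phi> opt] by blast
  obtain M where M: "0 \<le> M" "\<And>x z. x \<in> X \<Longrightarrow> z \<in> Z \<Longrightarrow> - (\<delta> / 2) * (e \<bullet> z) - M \<le> F x z"
    using sublinear_lower_bound[of "\<delta> / 2"] \<delta> by auto
  have total: "Q_loss \<phi> + price \<phi> = ennreal (- V)"
  proof -
    have "enn2ereal (Q_loss \<phi> + price \<phi>) = ereal (- V)"
      using opt unfolding dual_objective_eq[OF \<phi>] by (cases "enn2ereal (Q_loss \<phi> + price \<phi>)") auto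
    then have "e2ennreal (enn2ereal (Q_loss \<phi> + price \<phi>)) = e2ennreal (ereal (- V))" by (rule arg_cong)
    then show ?thesis by simp
  qed
  have fin: "Q_loss \<phi> < \<infinity>" "price \<phi> < \<infinity>" using total by (auto simp: less_top[symmetric] ennreal_add_eq_top dest: sym)
  define \<kappa> where "\<kappa> x = enn2real (e2ennreal (- Q \<phi> x))" for x
  have Qm: "(\<lambda>x. e2ennreal (- Q \<phi> x)) \<in> borel_measurable \<mu>"
    using Q_measurable[OF dual_candidate(1)[OF \<phi>]] by auto
  have \<kappa>_eq: "AE x in \<mu>. ennreal (\<kappa> x) = e2ennreal (- Q \<phi> x) \<and> Q \<phi> x = ereal (- \<kappa> x)"
  proof -
    have "AE x in \<mu>. e2ennreal (- Q \<phi> x) \<noteq> \<infinity>" using Qm fin(1) unfolding Q_loss_def by (intro nn_integral_PInf_AE) auto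
    then show ?thesis using AE_space
    proof eventually_elim
      case (elim x)
      then have "Q \<phi> x \<le> 0" using Q_nonpos[where \<phi>=\<phi>, OF dual_candidate(8)[OF \<phi>], of x] by (simp add: space_mu)
      then show ?case using elim by (cases "Q \<phi> x") (auto simp: \<kappa>_def less_top)
    qed
  qed
  have \<kappa>m: "\<kappa> \<in> borel_measurable \<mu>" unfolding \<kappa>_def using Qm by measurable
  have "(\<integral>\<^sup>+x. ennreal (\<kappa> x) \<partial>\<mu>) = Q_loss \<phi>"
    unfolding Q_loss_def using \<kappa>_eq by (intro nn_integral_cong_AE) auto
  then have \<kappa>i: "integrable \<mu> \<kappa>" "(\<integral>x. \<kappa> x \<partial>\<mu>) = enn2real (Q_loss \<phi>)"
    using \<kappa>m fin by (auto intro!: integrableI_nonneg simp: integral_eq_nn_integral \<kappa>_def[abs_def])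
  have sum_real: "enn2real (Q_loss \<phi>) + enn2real (price \<phi>) = - V"
    using total fin V_nonpos by (metis enn2real_ennreal enn2real_plus neg_0_le_iff_le infinity_ennreal_def)
  (* Above this level M is at most a quarter of \<delta> * (e \<bullet> S x). *)
  define C where "C = 4 * M / \<delta>"
  have "(\<integral>z. f (fst z) \<partial>p) \<le> C * (\<integral>x. f x \<partial>\<mu>) + (4 / \<delta>) * (real_of_ereal (cost p) - V)"
    if p: "p \<in> plans" and f: "f \<in> borel_measurable (borel_on X)" and f01: "\<And>x. x \<in> X \<Longrightarrow> 0 \<le> f x \<and> f x \<le> 1" for p f
  proof -
    interpret P: barycentric_plan X Y Z F a u \<mu> \<nu> p by unfold_locales (rule p)
    obtain g where g: "integrable \<mu> g" "(\<integral>x. g x \<partial>\<mu>) = enn2real (price \<phi>)"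
        "AE x in \<mu>. \<phi> (P.S x) \<le> ereal (g x) \<and> 0 \<le> g x"
      using P.jensen[OF \<phi>] unfolding price_def by blast
    define h where "h x = F x (P.S x) + g x + \<kappa> x" for x
    have hi: "integrable \<mu> h" unfolding h_def using P.cost_integrable g \<kappa>i by simp
    have hI: "(\<integral>x. h x \<partial>\<mu>) = real_of_ereal (cost p) - V"
      unfolding h_def P.transport_cost_eq using P.cost_integrable g \<kappa>i sum_real by simp
    have h_bound: "AE x in \<mu>. 0 \<le> h x \<and> e \<bullet> P.S x \<le> C + (4 / \<delta>) * h x"
      using \<kappa>_eq g(3) AE_space
    proof eventually_elim
      case (elim x)
      then have x: "x \<in> X" by (simp add: space_mu)
      note z = P.S_in_Z[OF x]
      have "Q \<phi> x \<le> \<phi> (P.S x) + ereal (F x (P.S x))" by (rule Q_le[OF z])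
      also have "\<dots> \<le> ereal (g x) + ereal (F x (P.S x))" using elim by (intro add_right_mono) auto
      finally have h0: "0 \<le> h x" using elim by (simp add: h_def)
      have "ereal (\<delta> * (e \<bullet> P.S x)) \<le> ereal (g x)" using \<delta>(2)[OF z] elim by (meson order_trans)
      moreover have "0 \<le> \<kappa> x" by (simp add: \<kappa>_def)
      ultimately have h1: "(\<delta> / 2) * (e \<bullet> P.S x) - M \<le> h x" using M(2)[OF x z] by (simp add: h_def)
      have "e \<bullet> P.S x \<le> C + (4 / \<delta>) * h x"
      proof (cases "e \<bullet> P.S x \<le> C")
        case True
        then show ?thesis using h0 \<delta> by (simp add: add_increasing2)
      next
        case False
        then have "M \<le> (\<delta> / 4) * (e \<bullet> P.S x)" using \<delta> by (simp add: C_def field_simps)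
        then have "(\<delta> / 4) * (e \<bullet> P.S x) \<le> h x" using h1 by simp
        then have "e \<bullet> P.S x \<le> (4 / \<delta>) * h x" using \<delta> by (simp add: field_simps)
        moreover have "0 \<le> C" using M \<delta> by (simp add: C_def)
        ultimately show ?thesis by simp
      qed
      then show ?case using h0 by simp
    qed
    have fm: "f \<in> borel_measurable \<mu>" using f by (simp add: measurable_mu)
    have fi: "integrable \<mu> f"
      using f01 by (intro mu.integrable_const_bound[OF _ fm, of 1] AE_I2) (auto simp: space_mu)
    have idY: "(\<lambda>y. y) \<in> borel_measurable (borel_on Y)" by (simp add: measurable_restrict_space1)
    have fst_m: "(\<lambda>z. f (fst z)) \<in> borel_measurable p"
      using measurable_compose[OF fst_measurable_borel_on f] by (simp add: P.measurable_p)
    have snd_m: "snd \<in> borel_measurable p"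
      using measurable_compose[OF snd_measurable_borel_on idY] by (simp add: P.measurable_p)
    have wm: "(\<lambda>x. f x *\<^sub>R e) \<in> borel_measurable (borel_on X)" using f by (intro borel_measurable_scaleR) auto
    have wb: "norm (f x *\<^sub>R e) \<le> norm e" if "x \<in> X" for x
      using f01[OF that] by (simp add: mult_left_le_one_le)
    have "(\<integral>z. f (fst z) \<partial>p) \<le> (\<integral>z. (f (fst z) *\<^sub>R e) \<bullet> snd z \<partial>p)"
    proof (rule integral_mono)
      show "integrable p (\<lambda>z. f (fst z))"
        using f01 by (intro P.p.integrable_const_bound[OF _ fst_m, of 1] AE_I2) (auto simp: P.space_p)
      have "norm ((f (fst z) *\<^sub>R e) \<bullet> snd z) \<le> E" if "z \<in> X \<times> Y" for z
      proof -
        have "0 \<le> f (fst z)" "f (fst z) \<le> 1" "0 \<le> e \<bullet> snd z" "e \<bullet> snd z \<le> E"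
          using f01[of "fst z"] that e_ge_1[of "snd z"] e_le_E[of "snd z"] by auto
        then have "f (fst z) * (e \<bullet> snd z) \<le> 1 * E" by (intro mult_mono) auto
        then show ?thesis using \<open>0 \<le> f (fst z)\<close> \<open>0 \<le> e \<bullet> snd z\<close> by (simp add: abs_mult)
      qed
      then show "integrable p (\<lambda>z. (f (fst z) *\<^sub>R e) \<bullet> snd z)"
        using fst_m snd_m by (intro P.p.integrable_const_bound[where B=E] AE_I2) (auto simp: P.space_p)
      fix z assume "z \<in> space p"
      then have "0 \<le> f (fst z)" "1 \<le> e \<bullet> snd z" using f01 e_ge_1 by (auto simp: P.space_p)
      then have "f (fst z) * 1 \<le> f (fst z) * (e \<bullet> snd z)" by (intro mult_left_mono)
      then show "f (fst z) \<le> (f (fst z) *\<^sub>R e) \<bullet> snd z" by simp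
    qed
    also have "\<dots> = (\<integral>x. (f x *\<^sub>R e) \<bullet> P.S x \<partial>\<mu>)" by (rule P.integral_inner_S(2)[OF wm wb])
    also have "\<dots> \<le> (\<integral>x. C * f x + (4 / \<delta>) * h x \<partial>\<mu>)"
    proof (rule integral_mono_AE)
      show "integrable \<mu> (\<lambda>x. (f x *\<^sub>R e) \<bullet> P.S x)" by (rule P.integral_inner_S(1)[OF wm wb])
      show "integrable \<mu> (\<lambda>x. C * f x + (4 / \<delta>) * h x)" using fi hi by simp
      show "AE x in \<mu>. (f x *\<^sub>R e) \<bullet> P.S x \<le> C * f x + (4 / \<delta>) * h x"
        using h_bound AE_space
      proof eventually_elim
        case (elim x)
        then have f0: "0 \<le> f x" "f x \<le> 1" using f01 by (auto simp: space_mu)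
        have "f x * (e \<bullet> P.S x) \<le> f x * (C + (4 / \<delta>) * h x)" using elim f0 by (intro mult_left_mono) auto
        also have "\<dots> = C * f x + f x * ((4 / \<delta>) * h x)" by (simp add: algebra_simps)
        also have "f x * ((4 / \<delta>) * h x) \<le> 1 * ((4 / \<delta>) * h x)" using elim f0 \<delta> by (intro mult_right_mono) auto
        finally show ?case by simp
      qed
    qed
    also have "\<dots> = C * (\<integral>x. f x \<partial>\<mu>) + (4 / \<delta>) * (\<integral>x. h x \<partial>\<mu>)" using fi hi by simp
    finally show ?thesis by (simp only: hI)
  qed
  moreover have "0 \<le> C" "0 \<le> 4 / \<delta>" using M \<delta> by (auto simp: C_def)
  ultimately show ?thesis by blast
qed

text \<open>
  The excess bound passes to the limit and shows that \<open>p\<close> is a plan. It also upgrades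
  weak convergence to test functions that jump in \<open>x\<close> (\<open>ind_lim\<close>), as
  needed to integrate the maximum of finitely many affine minorants along the partition of
  \<open>X\<close> according to which one is largest.
\<close>

lemma weak_solution_is_strong:
  assumes weak: "weak_solution X Y (barycentric_cost F) \<mu> \<nu> p"
  shows "strong_solution X Y (barycentric_cost F) \<mu> \<nu> p"
proof -
  let ?I = "\<lambda>A w p. \<integral>z. (indicator A (fst z) *\<^sub>R w (fst z)) \<bullet> snd z \<partial>p"
  obtain P where pb: "p \<in> borel_probs (X \<times> Y)" and P: "\<And>n. P n \<in> plans" and wl: "weak_limit_on (X \<times> Y) P p"
    and lim_cost: "(\<lambda>n. cost (P n)) \<longlonglongrightarrow> ereal V"
    using weak unfolding weak_solution_def transport_value_eq by blast
  have sets_p: "sets p = sets (borel_on (X \<times> Y))" and "prob_space p" using pb by (auto simp: space_prob_algebra)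
  interpret p: prob_space p by fact
  have mp: "measurable p N = measurable (borel_on (X \<times> Y)) N" for N :: "'n measure"
    by (rule measurable_cong_sets[OF sets_p refl])
  have space_p: "space p = X \<times> Y" using sets_eq_imp_space_eq[OF sets_p] by (simp add: space_restrict_space)
  define r where "r n = real_of_ereal (cost (P n))" for n
  have r: "cost (P n) = ereal (r n)" for n using cost_real[OF P[of n]] by (auto simp: r_def)
  have lim_r: "r \<longlonglongrightarrow> V" using lim_cost by (simp add: r)
  have wlim: "(\<lambda>n. \<integral>z. f z \<partial>P n) \<longlonglongrightarrow> (\<integral>z. f z \<partial>p)" if "continuous_on (X \<times> Y) f" for f :: "'x \<times> 'a \<Rightarrow> real"
  proof -
    have "bounded (f ` (X \<times> Y))"
      by (intro compact_imp_bounded compact_continuous_image that compact_Times compact_X compact_Y)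
    then show ?thesis using wl that unfolding weak_limit_on_def by blast
  qed
  obtain \<phi> where \<phi>: "\<phi> \<in> dual_candidates" "dual_objective Z F \<mu> \<nu> \<phi> = ereal V" using dual_attained by blast
  obtain C k where C: "0 \<le> C" "0 \<le> k" and excess: "\<And>p f. p \<in> plans \<Longrightarrow> f \<in> borel_measurable (borel_on X) \<Longrightarrow>
      (\<forall>x\<in>X. 0 \<le> f x \<and> f x \<le> 1) \<Longrightarrow> (\<integral>z. f (fst z) \<partial>p) \<le> C * (\<integral>x. f x \<partial>\<mu>) + k * (real_of_ereal (cost p) - V)"
    using excess_mass[OF \<phi>] by blast
  define p1 where "p1 = marginal1 X p"
  have sets_p1: "sets p1 = sets (borel_on X)" by (simp add: p1_def marginal1_def)
  have fst_p: "fst \<in> p \<rightarrow>\<^sub>M borel_on X" and snd_p: "snd \<in> p \<rightarrow>\<^sub>M borel_on Y" by (simp_all add: mp)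
  interpret p1: prob_space p1 unfolding p1_def marginal1_def by (rule p.prob_space_distr[OF fst_p])
  have contX: "f \<in> borel_measurable (borel_on S)" if "continuous_on UNIV f" for f :: "'c::topological_space \<Rightarrow> real" and S
    using that by (intro measurable_restrict_space1 borel_measurable_continuous_onI)
  have p1_le: "measure p1 A \<le> C * measure \<mu> A" if "A \<in> sets p1" for A
  proof (rule measure_le_of_continuous[OF p1.finite_measure_axioms sets_p1 mu.finite_measure_axioms sets_mu C(1) _ that])
    fix f :: "'x \<Rightarrow> real" assume f: "continuous_on UNIV f" "\<And>x. 0 \<le> f x" "\<And>x. f x \<le> 1"
    have "(\<integral>x. f x \<partial>p1) = (\<integral>z. f (fst z) \<partial>p)"
      unfolding p1_def marginal1_def by (rule integral_distr[OF fst_p contX[OF f(1)]])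
    moreover have "(\<integral>z. f (fst z) \<partial>p) \<le> C * (\<integral>x. f x \<partial>\<mu>) + k * (V - V)"
    proof (rule LIMSEQ_le)
      show "(\<lambda>n. \<integral>z. f (fst z) \<partial>P n) \<longlonglongrightarrow> (\<integral>z. f (fst z) \<partial>p)"
        by (rule wlim) (intro continuous_on_compose2[OF f(1)] continuous_intros, auto)
      show "(\<lambda>n. C * (\<integral>x. f x \<partial>\<mu>) + k * (r n - V)) \<longlonglongrightarrow> C * (\<integral>x. f x \<partial>\<mu>) + k * (V - V)"
        by (intro tendsto_intros lim_r)
      show "\<exists>N. \<forall>n\<ge>N. (\<integral>z. f (fst z) \<partial>P n) \<le> C * (\<integral>x. f x \<partial>\<mu>) + k * (r n - V)"
        using excess[OF P contX[OF f(1)]] f unfolding r_def by blast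
    qed
    ultimately show "(\<integral>x. f x \<partial>p1) \<le> C * (\<integral>x. f x \<partial>\<mu>)" by simp
  qed
  have "absolutely_continuous \<mu> p1"
    unfolding absolutely_continuous_def
  proof
    fix A assume "A \<in> null_sets \<mu>"
    then have A: "A \<in> sets p1" "measure \<mu> A = 0" by (auto simp: sets_p1 sets_mu measure_def)
    then have "measure p1 A \<le> 0" using p1_le[OF A(1)] by simp
    then have "measure p1 A = 0" by (simp add: measure_le_0_iff)
    then show "A \<in> null_sets p1" using A(1) by (simp add: null_sets_def p1.emeasure_eq_measure)
  qed
  moreover have "marginal2 Y p = \<nu>"
  proof -
    define p2 where "p2 = marginal2 Y p"
    have sets_p2: "sets p2 = sets (borel_on Y)" by (simp add: p2_def marginal2_def)
    interpret p2: prob_space p2 unfolding p2_def marginal2_def by (rule p.prob_space_distr[OF snd_p])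
    have eq: "(\<integral>y. f y \<partial>p2) = (\<integral>y. f y \<partial>\<nu>)" if f: "continuous_on UNIV f" for f :: "'a \<Rightarrow> real"
    proof -
      have "(\<integral>z. f (snd z) \<partial>P n) = (\<integral>y. f y \<partial>\<nu>)" for n
      proof -
        interpret Pn: barycentric_plan X Y Z F a u \<mu> \<nu> "P n" by unfold_locales (rule P)
        have "(\<integral>y. f y \<partial>marginal2 Y (P n)) = (\<integral>z. f (snd z) \<partial>P n)"
          unfolding marginal2_def by (rule integral_distr[OF _ contX[OF f]]) (simp add: Pn.measurable_p)
        then show ?thesis by (simp add: Pn.marginal2)
      qed
      moreover have "(\<lambda>n. \<integral>z. f (snd z) \<partial>P n) \<longlonglongrightarrow> (\<integral>z. f (snd z) \<partial>p)"
        by (rule wlim) (intro continuous_on_compose2[OF f] continuous_intros, auto)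
      ultimately have "(\<integral>z. f (snd z) \<partial>p) = (\<integral>y. f y \<partial>\<nu>)" by (simp add: LIMSEQ_const_iff)
      then show ?thesis unfolding p2_def marginal2_def using integral_distr[OF snd_p contX[OF f]] by simp
    qed
    have "p2 = \<nu>"
    proof (rule measure_eqI)
      show "sets p2 = sets \<nu>" by (simp add: sets_p2 sets_nu)
      fix B assume B: "B \<in> sets p2"
      have "measure p2 B \<le> 1 * measure \<nu> B"
        by (rule measure_le_of_continuous[OF p2.finite_measure_axioms sets_p2 nu.finite_measure_axioms sets_nu _ _ B])
           (simp_all add: eq)
      moreover have "measure \<nu> B \<le> 1 * measure p2 B"
        by (rule measure_le_of_continuous[OF nu.finite_measure_axioms sets_nu p2.finite_measure_axioms sets_p2])
           (use B in \<open>simp_all add: eq sets_p2 sets_nu\<close>)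
      ultimately show "emeasure p2 B = emeasure \<nu> B"
        by (simp add: p2.emeasure_eq_measure nu.emeasure_eq_measure)
    qed
    then show ?thesis by (simp add: p2_def)
  qed
  ultimately have plan: "p \<in> plans" using pb by (simp add: plans_ac_def p1_def)
  interpret L: barycentric_plan X Y Z F a u \<mu> \<nu> p by unfold_locales (rule plan)
  have ind_lim: "(\<lambda>n. ?I A w (P n)) \<longlonglongrightarrow> ?I A w p"
    if A: "A \<in> sets borel" and w: "continuous_on X w" for A and w :: "'x \<Rightarrow> 'a"
  proof -
    have "bounded (w ` X)" by (intro compact_imp_bounded compact_continuous_image w compact_X)
    then obtain B where "\<forall>v\<in>w ` X. norm v \<le> B" by (auto simp: bounded_iff)
    then have B: "\<And>x. x \<in> X \<Longrightarrow> norm (w x) \<le> max 0 B" by force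
    define T where "T = max 0 B * R"
    have T0: "0 \<le> T" using R(1) by (simp add: T_def)
    have wT: "\<bar>w x \<bullet> y\<bar> \<le> T" if "x \<in> X" "y \<in> Y" for x y
      unfolding T_def using Cauchy_Schwarz_ineq2[of "w x" y] B[OF that(1)] R(2)[OF hull_inc[OF that(2)]]
      by (meson mult_mono norm_ge_zero order_trans max.cobounded1)
    have wm: "w \<in> borel_measurable (borel_on X)" by (rule borel_measurable_continuous_on_restrict[OF w])
    show ?thesis
      unfolding LIMSEQ_iff
    proof (intro allI impI)
      fix \<epsilon> :: real assume \<epsilon>: "0 < \<epsilon>"
      (* Three errors: T (C d + d) from smoothing along the sequence, T d from smoothing in the limit,
         and d from weak convergence; the extra 1 covers T = 0. *)
      define d where "d = \<epsilon> / (T * (C + 2) + 1)"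
      have den: "0 < T * (C + 2) + 1" using T0 C by (simp add: add_nonneg_pos)
      have d: "0 < d" using \<epsilon> den by (simp add: d_def)
      obtain f where f: "continuous_on UNIV f" "\<And>x. 0 \<le> f x" "\<And>x. f x \<le> 1"
        "(\<integral>x. \<bar>indicator A x - f x\<bar> \<partial>\<mu>) < d" "(\<integral>x. \<bar>indicator A x - f x\<bar> \<partial>p1) < d"
        using continuous_approx_indicator[OF mu.finite_measure_axioms sets_mu p1.finite_measure_axioms sets_p1 A d] by blast
      define q where "q x = \<bar>indicator A x - f x\<bar>" for x
      have q01: "0 \<le> q x" "q x \<le> 1" for x using f(2,3)[of x] by (auto simp: q_def indicator_def)
      have qm: "q \<in> borel_measurable (borel_on X)"
        unfolding q_def
        by (intro borel_measurable_abs borel_measurable_diff contX[OF f(1)]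
            measurable_restrict_space1[OF borel_measurable_indicator[OF A]])
      have diff: "\<bar>?I A w p' - (\<integral>z. f (fst z) * (w (fst z) \<bullet> snd z) \<partial>p')\<bar> \<le> T * (\<integral>z. q (fst z) \<partial>p')"
        if p': "prob_space p'" "sets p' = sets (borel_on (X \<times> Y))" for p'
      proof -
        interpret p': prob_space p' by fact
        have m': "measurable p' N = measurable (borel_on (X \<times> Y)) N" for N :: "'n measure"
          by (rule measurable_cong_sets[OF p'(2) refl])
        have sp': "space p' = X \<times> Y" using sets_eq_imp_space_eq[OF p'(2)] by (simp add: space_restrict_space)
        have idY: "(\<lambda>y. y) \<in> borel_measurable (borel_on Y)" by (simp add: measurable_restrict_space1)
        have ws: "(\<lambda>z. w (fst z) \<bullet> snd z) \<in> borel_measurable p'"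
          unfolding m' by (intro borel_measurable_inner measurable_compose[OF fst_measurable_borel_on wm] measurable_compose[OF snd_measurable_borel_on idY])
        have im: "(\<lambda>z. indicator A (fst z) :: real) \<in> borel_measurable p'"
          unfolding m' using A by (intro measurable_compose[OF fst_measurable_borel_on] measurable_restrict_space1 borel_measurable_indicator)
        have fm: "(\<lambda>z. f (fst z)) \<in> borel_measurable p'"
          unfolding m' by (rule measurable_compose[OF fst_measurable_borel_on contX[OF f(1)]])
        have qm': "(\<lambda>z. q (fst z)) \<in> borel_measurable p'"
          unfolding m' by (rule measurable_compose[OF fst_measurable_borel_on qm])
        have 1: "integrable p' (\<lambda>z. indicator A (fst z) * (w (fst z) \<bullet> snd z))"
          using wT im ws T0 by (intro p'.integrable_const_bound[where B=T] AE_I2) (auto simp: sp' indicator_def)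
        have 2: "integrable p' (\<lambda>z. f (fst z) * (w (fst z) \<bullet> snd z))"
        proof (intro p'.integrable_const_bound[where B=T] AE_I2)
          fix z assume "z \<in> space p'"
          then have "\<bar>w (fst z) \<bullet> snd z\<bar> \<le> T" using wT by (auto simp: sp')
          then have "\<bar>f (fst z)\<bar> * \<bar>w (fst z) \<bullet> snd z\<bar> \<le> 1 * T" using f(2,3)[of "fst z"] by (intro mult_mono) auto
          then show "norm (f (fst z) * (w (fst z) \<bullet> snd z)) \<le> T" by (simp add: abs_mult)
        qed (use fm ws in measurable)
        have 3: "integrable p' (\<lambda>z. q (fst z))"
          using q01 by (intro p'.integrable_const_bound[OF _ qm', of 1] AE_I2) auto
        have "\<bar>?I A w p' - (\<integral>z. f (fst z) * (w (fst z) \<bullet> snd z) \<partial>p')\<bar>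
           = \<bar>\<integral>z. indicator A (fst z) * (w (fst z) \<bullet> snd z) - f (fst z) * (w (fst z) \<bullet> snd z) \<partial>p'\<bar>"
          using 1 2 by simp
        also have "\<dots> \<le> (\<integral>z. \<bar>indicator A (fst z) * (w (fst z) \<bullet> snd z) - f (fst z) * (w (fst z) \<bullet> snd z)\<bar> \<partial>p')"
          by (rule integral_abs_bound)
        also have "\<dots> \<le> (\<integral>z. T * q (fst z) \<partial>p')"
        proof (rule integral_mono)
          show "integrable p' (\<lambda>z. \<bar>indicator A (fst z) * (w (fst z) \<bullet> snd z) - f (fst z) * (w (fst z) \<bullet> snd z)\<bar>)" using 1 2 by simp
          show "integrable p' (\<lambda>z. T * q (fst z))" using 3 by simp
          fix z assume "z \<in> space p'"
          then have "\<bar>w (fst z) \<bullet> snd z\<bar> \<le> T" using wT by (auto simp: sp')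
          then have "q (fst z) * \<bar>w (fst z) \<bullet> snd z\<bar> \<le> q (fst z) * T" using q01 by (intro mult_left_mono)
          then show "\<bar>indicator A (fst z) * (w (fst z) \<bullet> snd z) - f (fst z) * (w (fst z) \<bullet> snd z)\<bar> \<le> T * q (fst z)"
            by (simp add: q_def mult.commute flip: left_diff_distrib abs_mult)
        qed
        also have "\<dots> = T * (\<integral>z. q (fst z) \<partial>p')" by simp
        finally show ?thesis .
      qed
      have "continuous_on (X \<times> Y) (\<lambda>z. f (fst z) * (w (fst z) \<bullet> snd z))"
        by (intro continuous_on_mult continuous_on_inner continuous_on_compose2[OF f(1)] continuous_on_compose2[OF w] continuous_intros) auto
      from wlim[OF this] have "eventually (\<lambda>n. dist (\<integral>z. f (fst z) * (w (fst z) \<bullet> snd z) \<partial>P n) (\<integral>z. f (fst z) * (w (fst z) \<bullet> snd z) \<partial>p) < d) sequentially"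
        using d unfolding tendsto_iff by blast
      moreover have "(\<lambda>n. k * (r n - V)) \<longlonglongrightarrow> k * (V - V)" by (intro tendsto_intros lim_r)
      then have "eventually (\<lambda>n. k * (r n - V) < d) sequentially" using d by (intro order_tendstoD) auto
      ultimately have "eventually (\<lambda>n. norm (?I A w (P n) - ?I A w p) < \<epsilon>) sequentially"
      proof eventually_elim
        case (elim n)
        interpret Pn: barycentric_plan X Y Z F a u \<mu> \<nu> "P n" by unfold_locales (rule P)
        have "(\<integral>z. q (fst z) \<partial>P n) \<le> C * (\<integral>x. q x \<partial>\<mu>) + k * (r n - V)"
          using excess[OF P qm] q01 by (simp add: r_def)
        also have "\<dots> \<le> C * d + d" using f(4) C elim by (intro add_mono mult_left_mono) (auto simp: q_def)
        finally have "T * (\<integral>z. q (fst z) \<partial>P n) \<le> T * (C * d + d)" using T0 by (rule mult_left_mono)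
        moreover have "(\<integral>z. q (fst z) \<partial>p) = (\<integral>x. q x \<partial>p1)"
          unfolding p1_def marginal1_def by (rule integral_distr[OF fst_p qm, symmetric])
        then have "T * (\<integral>z. q (fst z) \<partial>p) \<le> T * d" using f(5) T0 by (intro mult_left_mono) (auto simp: q_def)
        ultimately have "\<bar>?I A w (P n) - ?I A w p\<bar> < T * (C * d + d) + d + T * d"
          using diff[OF Pn.p.prob_space_axioms Pn.sets_p] diff[OF p.prob_space_axioms sets_p] elim(1)
          unfolding dist_real_def by linarith
        also have "\<dots> = d * (T * (C + 2) + 1)" by (simp add: algebra_simps)
        also have "\<dots> = \<epsilon>" using den by (simp add: d_def)
        finally show ?case by simp
      qed
      then show "\<exists>no. \<forall>n\<ge>no. norm (?I A w (P n) - ?I A w p) < \<epsilon>"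
        by (simp add: eventually_sequentially)
    qed
  qed
  have um: "u j \<in> borel_measurable (borel_on X)" and am: "a j \<in> borel_measurable (borel_on X)" for j
    by (rule borel_measurable_continuous_on_restrict[OF continuous_u] borel_measurable_continuous_on_restrict[OF continuous_a])+
  have umu[measurable]: "u j \<in> borel_measurable \<mu>" and amu[measurable]: "a j \<in> borel_measurable \<mu>" for j
    using um am by (simp_all add: measurable_mu)
  have "\<exists>B. \<forall>x\<in>X. norm (u j x) \<le> B" for j
    using compact_imp_bounded[OF compact_continuous_image[OF continuous_u compact_X], of j] by (auto simp: bounded_iff)
  then obtain Bu where Bu: "\<And>j x. x \<in> X \<Longrightarrow> norm (u j x) \<le> Bu j" by metis
  have "\<exists>B. \<forall>x\<in>X. norm (a j x) \<le> B" for j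
    using compact_imp_bounded[OF compact_continuous_image[OF continuous_a compact_X], of j] by (auto simp: bounded_iff)
  then obtain Ba where Ba: "\<And>j x. x \<in> X \<Longrightarrow> norm (a j x) \<le> Ba j" by metis
  define l where "l j x = u j x \<bullet> L.S x + a j x" for j x
  have lm[measurable]: "l j \<in> borel_measurable \<mu>" for j unfolding l_def using L.S_measurable by measurable
  define G where "G N x = Max ((\<lambda>j. l j x) ` {..N})" for N x
  have Gm[measurable]: "G N \<in> borel_measurable \<mu>" for N unfolding G_def by measurable
  have l_le_G: "l j x \<le> G N x" if "j \<le> N" for j N x unfolding G_def using that by (intro Max_ge) auto
  have G_ex: "\<exists>j\<le>N. l j x = G N x" for N x
    using Max_in[of "(\<lambda>j. l j x) ` {..N}"] unfolding G_def by fastforce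
  have l_le_F: "l j x \<le> F x (L.S x)" if "x \<in> X" for j x
    unfolding l_def by (rule affine_minorant[OF that L.S_in_Z[OF that]])
  have G_le_F: "G N x \<le> F x (L.S x)" if "x \<in> X" for N x using G_ex[of N x] l_le_F[OF that] by metis
  have l0i: "integrable \<mu> (l 0)"
  proof -
    have "integrable \<mu> (a 0)"
      using Ba by (intro mu.integrable_const_bound[where B="Ba 0"] AE_I2) (auto simp: space_mu)
    then show ?thesis
      unfolding l_def using L.integral_inner_S(1)[OF um Bu] by (intro Bochner_Integration.integrable_add)
  qed
  have G_bd: "norm (G N x) \<le> norm (l 0 x)" if "x \<in> X" for N x
    using l_le_G[of 0 N x] G_le_F[OF that, of N] F_nonpos[OF that L.S_in_Z[OF that]] by simp
  have G_le_V: "(\<integral>x. G N x \<partial>\<mu>) \<le> V" for N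
  proof -
    define J where "J x = (LEAST j. j \<le> N \<and> l j x = G N x)" for x
    have J: "J x \<le> N" "l (J x) x = G N x" for x
      using LeastI_ex[of "\<lambda>j. j \<le> N \<and> l j x = G N x"] G_ex[of N x] by (auto simp: J_def)
    have Jm: "J \<in> \<mu> \<rightarrow>\<^sub>M count_space UNIV" unfolding J_def by measurable
    have "\<exists>A. A \<in> sets borel \<and> J -` {j} \<inter> X = A \<inter> X" for j
      using measurable_sets[OF Jm, of "{j}"] by (auto simp: sets_mu space_mu sets_restrict_space)
    then obtain A where A: "\<And>j. A j \<in> sets borel" "\<And>j. J -` {j} \<inter> X = A j \<inter> X" by metis
    have xA: "x \<in> A j \<longleftrightarrow> J x = j" if "x \<in> X" for x j using A(2)[of j] that by blast
    have iA: "(indicator (A j) :: 'x \<Rightarrow> real) \<in> borel_measurable (borel_on X)" for j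
      using A(1) by (intro measurable_restrict_space1 borel_measurable_indicator)
    have wm: "(\<lambda>x. indicator (A j) x *\<^sub>R u j x) \<in> borel_measurable (borel_on X)" for j
      using iA um by (rule borel_measurable_scaleR)
    have wb: "norm (indicator (A j) x *\<^sub>R u j x) \<le> Bu j" if "x \<in> X" for j x
      using Bu[OF that, of j] order_trans[OF norm_ge_zero Bu[OF that, of j]] by (auto simp: indicator_def)
    have ai: "integrable \<mu> (\<lambda>x. indicator (A j) x * a j x)" for j
    proof (intro mu.integrable_const_bound[where B="Ba j"] AE_I2)
      fix x assume "x \<in> space \<mu>"
      then have x: "x \<in> X" by (simp add: space_mu)
      show "norm (indicator (A j) x * a j x) \<le> Ba j"
        using Ba[OF x, of j] order_trans[OF norm_ge_zero Ba[OF x, of j]] by (auto simp: indicator_def)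
    qed (use iA am in \<open>simp add: measurable_mu\<close>)
    have sum_J: "(\<Sum>j\<le>N. indicator (A j) x * h j) = (h (J x) :: real)" if "x \<in> X" for x h
    proof -
      have "(\<Sum>j\<le>N. indicator (A j) x * h j) = (\<Sum>j\<le>N. if j = J x then h j else 0)"
        using xA[OF that] by (intro sum.cong) (auto simp: indicator_def)
      then show ?thesis using J(1) by simp
    qed
    have decomp: "(\<Sum>j\<le>N. ?I (A j) (u j) p' + (\<integral>x. indicator (A j) x * a j x \<partial>\<mu>)) =
        (\<integral>x. (\<Sum>j\<le>N. indicator (A j) x * (u j x \<bullet> S' x + a j x)) \<partial>\<mu>)"
      "integrable \<mu> (\<lambda>x. \<Sum>j\<le>N. indicator (A j) x * (u j x \<bullet> S' x + a j x))"
      if "\<And>j. integrable \<mu> (\<lambda>x. (indicator (A j) x *\<^sub>R u j x) \<bullet> S' x)"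
        "\<And>j. ?I (A j) (u j) p' = (\<integral>x. (indicator (A j) x *\<^sub>R u j x) \<bullet> S' x \<partial>\<mu>)" for p' S'
    proof -
      have e: "indicator (A j) x * (u j x \<bullet> S' x + a j x) = (indicator (A j) x *\<^sub>R u j x) \<bullet> S' x + indicator (A j) x * a j x" for j x
        by (simp add: distrib_left)
      have i: "integrable \<mu> (\<lambda>x. indicator (A j) x * (u j x \<bullet> S' x + a j x))" for j
        unfolding e using that(1) ai by (rule Bochner_Integration.integrable_add)
      show "integrable \<mu> (\<lambda>x. \<Sum>j\<le>N. indicator (A j) x * (u j x \<bullet> S' x + a j x))" using i by (rule Bochner_Integration.integrable_sum)
      have "(\<integral>x. (\<Sum>j\<le>N. indicator (A j) x * (u j x \<bullet> S' x + a j x)) \<partial>\<mu>) = (\<Sum>j\<le>N. (\<integral>x. indicator (A j) x * (u j x \<bullet> S' x + a j x) \<partial>\<mu>))"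
        using i by (rule Bochner_Integration.integral_sum)
      also have "\<dots> = (\<Sum>j\<le>N. ?I (A j) (u j) p' + (\<integral>x. indicator (A j) x * a j x \<partial>\<mu>))"
        unfolding e that(2) using that(1) ai by (intro sum.cong refl Bochner_Integration.integral_add)
      finally show "(\<Sum>j\<le>N. ?I (A j) (u j) p' + (\<integral>x. indicator (A j) x * a j x \<partial>\<mu>)) =
        (\<integral>x. (\<Sum>j\<le>N. indicator (A j) x * (u j x \<bullet> S' x + a j x)) \<partial>\<mu>)" by simp
    qed
    have "(\<integral>x. G N x \<partial>\<mu>) = (\<integral>x. (\<Sum>j\<le>N. indicator (A j) x * (u j x \<bullet> L.S x + a j x)) \<partial>\<mu>)"
    proof (rule Bochner_Integration.integral_cong[OF refl])
      fix x assume "x \<in> space \<mu>"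
      then have "x \<in> X" by (simp add: space_mu)
      from sum_J[OF this, of "\<lambda>j. l j x"] J(2)[of x]
      show "G N x = (\<Sum>j\<le>N. indicator (A j) x * (u j x \<bullet> L.S x + a j x))" by (simp add: l_def)
    qed
    also have "\<dots> = (\<Sum>j\<le>N. ?I (A j) (u j) p + (\<integral>x. indicator (A j) x * a j x \<partial>\<mu>))"
      by (rule decomp(1)[of L.S p, OF L.integral_inner_S(1)[OF wm wb] L.integral_inner_S(2)[OF wm wb], symmetric])
    also have "\<dots> \<le> V"
    proof (rule LIMSEQ_le[OF _ lim_r])
      show "(\<lambda>n. \<Sum>j\<le>N. ?I (A j) (u j) (P n) + (\<integral>x. indicator (A j) x * a j x \<partial>\<mu>)) \<longlonglongrightarrow>
        (\<Sum>j\<le>N. ?I (A j) (u j) p + (\<integral>x. indicator (A j) x * a j x \<partial>\<mu>))"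
        by (intro tendsto_sum tendsto_add tendsto_const ind_lim A continuous_u)
      have "(\<Sum>j\<le>N. ?I (A j) (u j) (P n) + (\<integral>x. indicator (A j) x * a j x \<partial>\<mu>)) \<le> r n" for n
      proof -
        interpret Pn: barycentric_plan X Y Z F a u \<mu> \<nu> "P n" by unfold_locales (rule P)
        note D = decomp[of Pn.S "P n", OF Pn.integral_inner_S(1)[OF wm wb] Pn.integral_inner_S(2)[OF wm wb]]
        have "(\<integral>x. (\<Sum>j\<le>N. indicator (A j) x * (u j x \<bullet> Pn.S x + a j x)) \<partial>\<mu>) \<le> (\<integral>x. F x (Pn.S x) \<partial>\<mu>)"
        proof (rule integral_mono[OF D(2) Pn.cost_integrable])
          fix x assume "x \<in> space \<mu>"
          then have x: "x \<in> X" by (simp add: space_mu)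
          show "(\<Sum>j\<le>N. indicator (A j) x * (u j x \<bullet> Pn.S x + a j x)) \<le> F x (Pn.S x)"
            unfolding sum_J[OF x] by (rule affine_minorant[OF x Pn.S_in_Z[OF x]])
        qed
        also have "\<dots> = r n" using r[of n] Pn.transport_cost_eq by simp
        finally show ?thesis by (simp only: D(1))
      qed
      then show "\<exists>n0. \<forall>n\<ge>n0. (\<Sum>j\<le>N. ?I (A j) (u j) (P n) + (\<integral>x. indicator (A j) x * a j x \<partial>\<mu>)) \<le> r n" by blast
    qed
    finally show ?thesis .
  qed
  have "(\<lambda>N. \<integral>x. G N x \<partial>\<mu>) \<longlonglongrightarrow> (\<integral>x. F x (L.S x) \<partial>\<mu>)"
  proof (rule integral_dominated_convergence[where w="\<lambda>x. norm (l 0 x)"])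
    show "(\<lambda>x. F x (L.S x)) \<in> borel_measurable \<mu>" using L.cost_integrable by auto
    show "integrable \<mu> (\<lambda>x. norm (l 0 x))" using l0i by simp
    show "AE x in \<mu>. norm (G i x) \<le> norm (l 0 x)" for i using G_bd by (intro AE_I2) (simp add: space_mu)
    show "AE x in \<mu>. (\<lambda>N. G N x) \<longlonglongrightarrow> F x (L.S x)"
    proof (rule AE_I2)
      fix x assume "x \<in> space \<mu>"
      then have x: "x \<in> X" by (simp add: space_mu)
      show "(\<lambda>N. G N x) \<longlonglongrightarrow> F x (L.S x)"
      proof (rule order_tendstoI)
        fix v assume "v < F x (L.S x)"
        then have "ereal v < (SUP j. ereal (u j x \<bullet> L.S x + a j x))" by (subst F_sup[OF x L.S_in_Z[OF x], symmetric]) simp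
        then obtain j where "v < l j x" by (auto simp: less_SUP_iff l_def)
        then show "eventually (\<lambda>N. v < G N x) sequentially"
          using l_le_G[of j _ x] by (auto simp: eventually_sequentially intro: less_le_trans)
      next
        fix v assume "F x (L.S x) < v"
        then show "eventually (\<lambda>N. G N x < v) sequentially" using G_le_F[OF x] by (auto intro: le_less_trans always_eventually)
      qed
    qed
  qed measurable
  then have "(\<integral>x. F x (L.S x) \<partial>\<mu>) \<le> V" by (rule LIMSEQ_le_const2) (use G_le_V in blast)
  then have "cost p \<le> ereal V" by (simp add: L.transport_cost_eq)
  then have "cost p = ereal V" using V_le_cost[OF plan] by (rule antisym)
  then show ?thesis using plan by (simp add: strong_solution_def transport_value_eq)
qed

end

section \<open>The duality theorem\<close>

theorem theorem5p3:
  fixes X :: "'x::metric_space set"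
    and Y Z :: "'a::euclidean_space set"
    and F :: "'x \<Rightarrow> 'a \<Rightarrow> real"
    and c :: "'x \<Rightarrow> 'a measure \<Rightarrow> ereal"
    and a :: "nat \<Rightarrow> 'x \<Rightarrow> real"
    and u :: "nat \<Rightarrow> 'x \<Rightarrow> 'a"
    and \<mu> :: "'x measure" and \<nu> :: "'a measure"
  assumes "compact X" and "compact Y"
    and "Z = conical_hull Y"
    and "c = barycentric_cost F"
    and "\<And>x. x \<in> X \<Longrightarrow> convex_on Z (F x)"
    and "0 \<notin> convex hull Y"
    and "\<And>x z. x \<in> X \<Longrightarrow> z \<in> Z \<Longrightarrow> F x z \<le> 0"
    and "continuous_on (X \<times> Z) (\<lambda>(x, z). F x z)"
    and "\<And>k. continuous_on X (a k)"
    and "\<And>k. continuous_on X (u k)"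
    and "\<And>x z. x \<in> X \<Longrightarrow> z \<in> Z \<Longrightarrow> ereal (F x z) = (SUP k. ereal (u k x \<bullet> z + a k x))"
    and "\<And>x z. x \<in> X \<Longrightarrow> z \<in> Z - {0} \<Longrightarrow> ((\<lambda>l. F x (l *\<^sub>R z) / l) \<longlongrightarrow> 0) at_top"
    and "((\<lambda>l. SUP (x, y)\<in>X \<times> Y. ereal (F x (l *\<^sub>R y))) \<longlongrightarrow> - \<infinity>) at_top"
    and "\<mu> \<in> borel_probs X" and "\<nu> \<in> borel_probs Y"
  shows "transport_value X Y c \<mu> \<nu> = (SUP \<phi>\<in>Phi_plus Z \<inter> ext_L1 \<nu>. dual_objective Z F \<mu> \<nu> \<phi>)
    \<and> (\<exists>\<phi>\<in>Phi_plus Z \<inter> ext_L1 \<nu>.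
          dual_objective Z F \<mu> \<nu> \<phi> = (SUP \<psi>\<in>Phi_plus Z \<inter> ext_L1 \<nu>. dual_objective Z F \<mu> \<nu> \<psi>)
          \<and> (\<forall>z\<in>Z - {0}. 0 < \<phi> z))
    \<and> (\<forall>p. weak_solution X Y c \<mu> \<nu> p \<longrightarrow> strong_solution X Y c \<mu> \<nu> p)"
proof -
  interpret barycentric_problem X Y Z F a u \<mu> \<nu>
    using assms(1-3,5-15) by (intro barycentric_problem.intro)
  have sup: "(SUP \<phi>\<in>Phi_plus Z \<inter> ext_L1 \<nu>. dual_objective Z F \<mu> \<nu> \<phi>) = ereal V"
  proof (rule antisym)
    show "(SUP \<phi>\<in>dual_candidates. dual_objective Z F \<mu> \<nu> \<phi>) \<le> ereal V"
      by (rule SUP_least) (rule dual_le_V)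
    obtain \<phi> where "\<phi> \<in> dual_candidates" "dual_objective Z F \<mu> \<nu> \<phi> = ereal V" using dual_attained by blast
    then show "ereal V \<le> (SUP \<phi>\<in>dual_candidates. dual_objective Z F \<mu> \<nu> \<phi>)" by (metis SUP_upper)
  qed
  obtain \<phi> where \<phi>: "\<phi> \<in> dual_candidates" "dual_objective Z F \<mu> \<nu> \<phi> = ereal V"
    using dual_attained by blast
  have "0 < \<phi> z" if "z \<in> Z - {0}" for z
  proof -
    obtain \<delta> where \<delta>: "0 < \<delta> \<and> (\<forall>z\<in>Z. ereal (\<delta> * (e \<bullet> z)) \<le> \<phi> z)"
      using dual_optimal_coercive[OF \<phi>] by (elim exE)
    then have "ereal (\<delta> * (e \<bullet> z)) \<le> \<phi> z" using that by simp
    moreover have "0 < \<delta> * (e \<bullet> z)" using \<delta> e_pos[OF that] by simp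
    ultimately show ?thesis by (cases "\<phi> z") auto
  qed
  then show ?thesis
    unfolding assms(4) transport_value_eq sup using \<phi> weak_solution_is_strong by blast
qed

end
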